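(* Let $P,Q$ be probability distributions in $\mathcal P$, let $X_1,\ldots,X_m$ be i.i.d. $P$ and, independently, $Y_1,\ldots,Y_n$ i.i.d. $Q$. Let $m\to\infty$, $n\to\infty$, with $N=m+n$, $p_m=m/N$, and $p_m\to p\in(0,1)$ with $$p_m-p=O(N^{-1/2}).$$ Put $q=1-p$ and $\bar P=pP+qQ$, and assume $\bar P\in\mathcal P$. Assume that the estimator sequence $\hat\theta$ is asymptotically linear under $P$, under $Q$ and under $\bar P$, that is, for each $R\in\{P,Q,\bar P\}$ there is a function $f_R$ such that, when $V_1,V_2,\ldots$ are i.i.d. $R$, $$r^{1/2}\bigl[\hat\theta_r(V_1,\ldots,V_r)-\theta(R)\bigr]=\frac1{\sqrt r}\sum_{i=1}^r f_R(V_i)+o_R(1)\qquad (r\to\infty),$$ where $E_R f_R(V_1)=0$ and $0<\sigma^2(R)\equiv E_R f_R^2(V_1)<\infty$. Let $$T_{m,n}=N^{1/2}\bigl[\hat\theta_m(X_1,\ldots,X_m)-\hat\theta_n(Y_1,\ldots,Y_n)\bigr].$$ Then the permutation distribution $\hat R^T_{m,n}$ of $T_{m,n}$ satisfies $$\sup_t\bigl|\hat R^T_{m,n}(t)-\Phi\bigl(t/\tau(\bar P)\bigr)\bigr|\to 0\quad\text{in probability},$$ where $$\tau^2(\bar P)=\frac{1}{p(1-p)}\,\sigma^2(\bar P).$$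
   Context: $\mathcal P$ is a space of probability distributions and $\theta(\cdot)$ is a real-valued parameter defined on $\mathcal P$. For every sample size $r$, $\hat\theta_r$ is a real-valued function of $r$ observations (an estimator of $\theta$). $o_R(1)$ denotes a term converging to $0$ in probability when sampling i.i.d. from $R$. $\Phi$ is the standard normal c.d.f. It is not assumed that $\theta(P)=\theta(Q)$. Write $Z=(Z_1,\ldots,Z_N)=(X_1,\ldots,X_m,Y_1,\ldots,Y_n)$ and let $\mathbf G_N$ be the set of all permutations of $\{1,\ldots,N\}$. For a statistic $T_{m,n}=T_{m,n}(Z_1,\ldots,Z_N)$, the permutation distribution is the random c.d.f. $$\hat R^T_{m,n}(t)=\frac1{N!}\sum_{\pi\in\mathbf G_N} I\{T_{m,n}(Z_{\pi(1)},\ldots,Z_{\pi(N)})\le t\},$$ i.e. the statistic is recomputed on each permuted data set ($\hat\theta_m$ evaluated at the first $m$ coordinates, $\hat\theta_n$ at the last $n$). *)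

theory Defs
  imports "HOL-Probability.Probability" "HOL-Library.Landau_Symbols"
    "HOL-Combinatorics.Permutations"
begin

definition converges_in_prob ::
  "'w measure \<Rightarrow> (nat \<Rightarrow> 'w \<Rightarrow> real) \<Rightarrow> real \<Rightarrow> bool" where
  "converges_in_prob M X c \<longleftrightarrow>
     (\<forall>k. X k \<in> borel_measurable M) \<and>
     (\<forall>\<epsilon>>0. (\<lambda>k. measure M {\<omega> \<in> space M. \<bar>X k \<omega> - c\<bar> > \<epsilon>}) \<longlonglongrightarrow> 0)"

text \<open>The mixture p P + (1 - p) Q of two measures on the same measurable space.\<close>

definition mixture :: "real \<Rightarrow> 'a measure \<Rightarrow> 'a measure \<Rightarrow> 'a measure" where
  "mixture p P Q = measure_of (space P) (sets P)
     (\<lambda>A. ennreal p * emeasure P A + ennreal (1 - p) * emeasure Q A)"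

lemma sets_mixture [simp, measurable_cong]: "sets (mixture p P Q) = sets P"
  and space_mixture [simp]: "space (mixture p P Q) = space P"
  by (simp_all add: mixture_def)

lemma emeasure_mixture:
  assumes "sets Q = sets P" "A \<in> sets P"
  shows "emeasure (mixture p P Q) A = ennreal p * emeasure P A + ennreal (1 - p) * emeasure Q A"
proof (rule emeasure_measure_of_sigma[of "space P" "sets P"
    "\<lambda>A. ennreal p * emeasure P A + ennreal (1 - p) * emeasure Q A" A, folded mixture_def])
  show "sigma_algebra (space P) (sets P)" ..
  show "positive (sets P) (\<lambda>A. ennreal p * emeasure P A + ennreal (1 - p) * emeasure Q A)"
    by (simp add: positive_def)
  show "countably_additive (sets P) (\<lambda>A. ennreal p * emeasure P A + ennreal (1 - p) * emeasure Q A)"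
  proof (rule countably_additiveI)
    fix F :: "nat \<Rightarrow> 'a set"
    assume F: "range F \<subseteq> sets P" "disjoint_family F" "(\<Union>i. F i) \<in> sets P"
    have "(\<Sum>i. emeasure P (F i)) = emeasure P (\<Union>i. F i)"
      using F by (intro suminf_emeasure) auto
    moreover have "(\<Sum>i. emeasure Q (F i)) = emeasure Q (\<Union>i. F i)"
      using F assms(1) by (intro suminf_emeasure) auto
    ultimately show "(\<Sum>i. ennreal p * emeasure P (F i) + ennreal (1 - p) * emeasure Q (F i))
        = ennreal p * emeasure P (\<Union>i. F i) + ennreal (1 - p) * emeasure Q (\<Union>i. F i)"
      by (subst suminf_add[symmetric]) simp_all
  qed
qed (fact assms(2))

text \<open>Observations are indexed from 0. The estimator based on r observations is a function
  on the product space with index set {..<r}, hence the restriction of its argument. The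
  i.i.d. sequence with law R is realised by the coordinates V 0, V 1, ... of the infinite
  product space.\<close>

definition asymptotically_linear ::
  "(nat \<Rightarrow> (nat \<Rightarrow> 'a) \<Rightarrow> real) \<Rightarrow> ('a measure \<Rightarrow> real) \<Rightarrow> 'a measure \<Rightarrow> ('a \<Rightarrow> real) \<Rightarrow> bool" where
  "asymptotically_linear est \<theta> R f \<longleftrightarrow>
     f \<in> borel_measurable R \<and>
     integrable R f \<and> (LINT x|R. f x) = 0 \<and>
     integrable R (\<lambda>x. (f x)\<^sup>2) \<and> (LINT x|R. (f x)\<^sup>2) > 0 \<and>
     converges_in_prob (\<Pi>\<^sub>M i\<in>(UNIV :: nat set). R)
       (\<lambda>r V. sqrt (real r) * (est r (restrict V {..<r}) - \<theta> R)
               - 1 / sqrt (real r) * (\<Sum>i<r. f (V i))) 0"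

definition pooled_sample ::
  "nat \<Rightarrow> (nat \<Rightarrow> 'w \<Rightarrow> 'a) \<Rightarrow> (nat \<Rightarrow> 'w \<Rightarrow> 'a) \<Rightarrow> 'w \<Rightarrow> nat \<Rightarrow> 'a" where
  "pooled_sample m X Y \<omega> i = (if i < m then X i \<omega> else Y (i - m) \<omega>)"

definition two_sample_stat ::
  "(nat \<Rightarrow> (nat \<Rightarrow> 'a) \<Rightarrow> real) \<Rightarrow> nat \<Rightarrow> nat \<Rightarrow> (nat \<Rightarrow> 'a) \<Rightarrow> real" where
  "two_sample_stat est m n z =
     sqrt (real (m + n)) * (est m (\<lambda>i\<in>{..<m}. z i) - est n (\<lambda>j\<in>{..<n}. z (m + j)))"

definition permutation_cdf ::
  "nat \<Rightarrow> ((nat \<Rightarrow> 'a) \<Rightarrow> real) \<Rightarrow> (nat \<Rightarrow> 'a) \<Rightarrow> real \<Rightarrow> real" where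
  "permutation_cdf N T z t =
     1 / fact N * (\<Sum>\<pi> | \<pi> permutes {..<N}. if T (\<lambda>i. z (\<pi> i)) \<le> t then 1 else 0)"

end

theory Submission
  imports Defs
begin

text \<open>The pooled sample, randomly permuted, is an i.i.d. sample from the mixture \<open>p P + (1 - p) Q\<close> conditioned on
  containing exactly \<open>m\<close> observations from \<open>P\<close>. By local bounds for binomial probabilities, and because
  \<open>m / N - p = O(1 / sqrt N)\<close>, the law of its first \<open>m\<close> (or its last \<open>n\<close>) coordinates is dominated by a constant multiple
  of the i.i.d. law. Hence the linearization of the estimator under the mixture, with influence function \<open>g\<close>, stays
  valid for the permuted data, and the permutation statistic may be replaced by the corresponding difference of two
  means of \<open>g\<close>. Conditionally on the data, that difference is a sum over a sample without replacement; Hajek's comparison with a Bernoulli sample gives its characteristic function, with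
  limit \<open>exp (- \<sigma>\<^sup>2 s\<^sup>2 / (2 p (1 - p)))\<close> as soon as the first two empirical moments of \<open>g\<close> converge and
  \<open>max \<bar>g\<bar> = o(sqrt N)\<close>. The theorems of Levy and Polya finish the proof.\<close>

section \<open>Local bounds for binomial probabilities\<close>

text \<open>Asymptotic linearity speaks only of i.i.d. samples, so on permuted data the remainder of
  the linearization can be controlled only by comparing laws. The comparison is made for one block
  at a time. For the full sample, conditioning on exactly \<open>m\<close> observations from
  \<open>P\<close> would cost a factor of order sqrt N, the reciprocal of a binomial probability. A
  block that leaves a fixed proportion of the sample free costs instead a ratio of two binomial
  probabilities, both of order 1 / sqrt N; the rate assumed for m / N - p keeps the denominator of
  that order. As the remainder is small only in probability, it is measured by the mean of
  \<open>min 1 \<bar>Z\<bar>\<close>, a bounded integral that tolerates both a constant factor in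
  the law and averaging over permutations. The randomness of the data is kept out of the central
  limit theorem: this is proved for deterministic arrays and then recast with a single tolerance
  \<delta>. The data enter only through the probabilities of four events, and no passage to
  subsequences is needed.\<close>

lemma Bernstein_nonneg': "0 < x \<Longrightarrow> x < 1 \<Longrightarrow> 0 \<le> Bernstein n k x"
  by (simp add: Bernstein_def)

text \<open>The ratio of consecutive weights with denominators cleared. No bound on \<open>k\<close>
  is required in this form, since both sides vanish for \<open>k \<ge> n\<close>.\<close>

lemma Bernstein_step:
  "real (Suc k) * (1 - x) * Bernstein n (Suc k) x = (real n - real k) * x * Bernstein n k x"
proof (cases "k < n")
  case True
  have 1: "real (Suc k) * real (n choose Suc k) = (real n - real k) * real (n choose k)"
    using binomial_absorb_comp[of n k] binomial_absorption[of k "n"] True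
    by (metis (no_types, lifting) of_nat_diff of_nat_mult less_imp_le binomial_absorption mult.commute)
  have 2: "n - k = Suc (n - Suc k)" using True by simp
  have "real (Suc k) * (1 - x) * Bernstein n (Suc k) x
      = (real (Suc k) * real (n choose Suc k)) * x * (x ^ k * (1 - x) ^ (n - k))"
    unfolding Bernstein_def 2 by (simp add: algebra_simps)
  then show ?thesis
    unfolding 1 Bernstein_def by (simp add: algebra_simps)
next
  case False
  then have "k = n \<or> n < k" by auto
  then show ?thesis by (auto simp: Bernstein_def binomial_eq_0)
qed

text \<open>The hypothesis on \<open>k\<close> is equivalent to (k + 1)(1 - x) <= (n - k) x, that
  is, to the ratio in \<open>Bernstein_step\<close> being at least 1.\<close>

lemma Bernstein_mono_step:
  assumes x: "0 < x" "x < 1" and k: "real (Suc k) \<le> (real n + 1) * x"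
  shows "Bernstein n k x \<le> Bernstein n (Suc k) x"
proof -
  have "real (Suc k) * (1 - x) * Bernstein n k x \<le> (real n - real k) * x * Bernstein n k x"
    using k x by (intro mult_right_mono Bernstein_nonneg') (auto simp: algebra_simps)
  then have "real (Suc k) * (1 - x) * Bernstein n k x \<le> real (Suc k) * (1 - x) * Bernstein n (Suc k) x"
    by (simp only: Bernstein_step)
  then show ?thesis using x by (subst (asm) mult_le_cancel_left_pos) auto
qed

lemma Bernstein_antimono_step:
  assumes x: "0 < x" "x < 1" and k: "real (Suc k) \<ge> (real n + 1) * x"
  shows "Bernstein n k x \<ge> Bernstein n (Suc k) x"
proof -
  have "real (Suc k) * (1 - x) * Bernstein n k x \<ge> (real n - real k) * x * Bernstein n k x"
    using k x by (intro mult_right_mono Bernstein_nonneg') (auto simp: algebra_simps)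
  then have "real (Suc k) * (1 - x) * Bernstein n k x \<ge> real (Suc k) * (1 - x) * Bernstein n (Suc k) x"
    by (simp only: Bernstein_step)
  then show ?thesis using x by (subst (asm) mult_le_cancel_left_pos) auto
qed

lemma Bernstein_mode:
  assumes x: "0 < x" "x < 1" and j: "real j \<le> (real n + 1) * x" "(real n + 1) * x \<le> real j + 1"
  shows "Bernstein n k x \<le> Bernstein n j x"
proof (cases "k \<le> j")
  case True
  then show ?thesis
  proof (induction rule: inc_induct)
    case (step i)
    have "real (Suc i) \<le> real j" using step by simp
    then show ?case using Bernstein_mono_step[OF x, of i n] step j by linarith
  qed simp
next
  case False
  then have "j \<le> k" by simp
  then show ?thesis
  proof (induction rule: dec_induct)
    case (step i)
    have "real j + 1 \<le> real (Suc i)" using step by simp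
    then show ?case using Bernstein_antimono_step[OF x, of n i] step j by linarith
  qed simp
qed

lemma sum_Bernstein_le_1:
  assumes x: "0 < x" "x < 1" and "finite A"
  shows "(\<Sum>k\<in>A. Bernstein n k x) \<le> 1"
proof -
  have "(\<Sum>k\<in>A. Bernstein n k x) \<le> (\<Sum>k\<in>A \<union> {..n}. Bernstein n k x)"
    using assms by (intro sum_mono2 Bernstein_nonneg') auto
  also have "\<dots> = (\<Sum>k\<le>n. Bernstein n k x)"
    using assms by (intro sum.mono_neutral_right) (auto simp: Bernstein_def)
  finally show ?thesis by simp
qed

text \<open>With r = n x (1 - x), the variance, the step from \<open>j + i\<close> to
  \<open>j + i + 1\<close> multiplies the weight by at least 1 - (i + 1) / r. The product of these
  factors is at least one minus the sum of the fractions, and 1 + ... + i <= i^2.\<close>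

lemma Bernstein_mode_decay:
  assumes x: "0 < x" "x < 1" and n: "n > 0"
    and j: "real j \<le> (real n + 1) * x" "(real n + 1) * x \<le> real j + 1"
  shows "(1 - (real i)\<^sup>2 / (real n * x * (1 - x))) * Bernstein n j x \<le> Bernstein n (j + i) x"
proof (induction i)
  case (Suc i)
  define r where "r = real n * x * (1 - x)"
  have r: "r > 0" using x n by (simp add: r_def)
  define b where "b = Bernstein n (j + i) x"
  have b: "b \<ge> 0" using x by (simp add: b_def Bernstein_nonneg')
  let ?s = "1 - (real i)\<^sup>2 / r" and ?t = "1 - real (i + 1) / r"
  have step: "?t * b \<le> Bernstein n (Suc (j + i)) x"
  proof -
    let ?d = "real (Suc (j + i)) * (1 - x)"
    have d: "?d > 0" using x by simp
    have dr: "r \<le> ?d" unfolding r_def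
      using j x by (intro mult_right_mono) (auto simp: algebra_simps)
    have "?d * ?t = ?d - ?d / r * real (i + 1)" using r by (simp add: field_simps)
    also have "\<dots> \<le> ?d - 1 * real (i + 1)"
      using dr r by (intro diff_left_mono mult_right_mono) auto
    also have "\<dots> \<le> (real n - real (j + i)) * x" using j by (simp add: algebra_simps)
    finally have "?d * ?t * b \<le> (real n - real (j + i)) * x * b"
      using b by (rule mult_right_mono)
    also have "\<dots> = ?d * Bernstein n (Suc (j + i)) x"
      unfolding b_def by (rule Bernstein_step[symmetric])
    finally have "?d * (?t * b) \<le> ?d * Bernstein n (Suc (j + i)) x" by (simp only: mult.assoc)
    then show ?thesis using d by (rule mult_left_le_imp_le)
  qed
  have B: "Bernstein n j x \<ge> 0" using x by (simp add: Bernstein_nonneg')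
  show ?case
  \<comment> \<open>A negative factor \<open>?t\<close> could not multiply the induction hypothesis;
    but then the claimed lower bound is itself at most 0.\<close>
  proof (cases "real (i + 1) \<le> r")
    case True
    then have t: "?t \<ge> 0" using r by (simp add: field_simps)
    have "(1 - (real (Suc i))\<^sup>2 / r) \<le> ?t * ?s"
    proof -
      have "?t * ?s = 1 - (real (i+1) + (real i)\<^sup>2) / r + real (i+1) / r * ((real i)\<^sup>2 / r)"
        using r by (simp add: field_simps)
      moreover have "(real (i+1) + (real i)\<^sup>2) / r \<le> (real (Suc i))\<^sup>2 / r"
        using r by (intro divide_right_mono) (auto simp: power2_eq_square algebra_simps)
      moreover have "0 \<le> real (i+1) / r * ((real i)\<^sup>2 / r)" using r by auto
      ultimately show ?thesis by linarith
    qed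
    then have "(1 - (real (Suc i))\<^sup>2 / r) * Bernstein n j x \<le> ?t * (?s * Bernstein n j x)"
      using B by (simp only: mult.assoc[symmetric] mult_right_mono)
    also have "\<dots> \<le> ?t * b" using Suc t by (intro mult_left_mono) (auto simp: b_def r_def)
    also note step
    finally show ?thesis by (simp add: r_def)
  next
    case False
    then have "r \<le> real (Suc i) ^ 2"
      by (smt (verit) Suc_eq_plus1 of_nat_0_le_iff of_nat_Suc power2_eq_square mult_le_cancel_left1)
    then have "1 - (real (Suc i))\<^sup>2 / r \<le> 0" using r by (simp add: field_simps)
    then have "(1 - (real (Suc i))\<^sup>2 / r) * Bernstein n j x \<le> 0" using B by (rule mult_nonpos_nonneg)
    also have "0 \<le> Bernstein n (j + Suc i) x" using x by (rule Bernstein_nonneg')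
    finally show ?thesis by (simp add: r_def)
  qed
qed simp

text \<open>The mode cannot be high: by \<open>Bernstein_mode_decay\<close> all weights from the
  mode to half a standard deviation \<open>r\<close> beyond it are at least 3/4 of the modal one,
  and together they are at most 1. This gives 8 / (3 r), rounded up to 3 / r.\<close>

lemma Bernstein_upper:
  assumes x: "0 < x" "x < 1" and n: "n > 0"
  shows "Bernstein n k x \<le> 3 / sqrt (x * (1 - x)) / sqrt (real n)"
proof -
  define r where "r = sqrt (real n * x * (1 - x))"
  have r: "r > 0" "r\<^sup>2 = real n * x * (1 - x)" using x n by (auto simp: r_def)
  define j where "j = nat \<lfloor>(real n + 1) * x\<rfloor>"
  have j: "real j \<le> (real n + 1) * x" "(real n + 1) * x \<le> real j + 1"
    using x by (auto simp: j_def; linarith)+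
  define l where "l = nat \<lfloor>r / 2\<rfloor>"
  have l: "real l \<le> r / 2" "r / 2 \<le> real l + 1" using r by (auto simp: l_def; linarith)+
  have B: "Bernstein n j x \<ge> 0" using x by (simp add: Bernstein_nonneg')
  have "r / 2 * (3/4 * Bernstein n j x) \<le> (real l + 1) * (3/4 * Bernstein n j x)"
    using l B by (intro mult_right_mono) auto
  also have "\<dots> = (\<Sum>i\<le>l. 3/4 * Bernstein n j x)" by simp
  also have "\<dots> \<le> (\<Sum>i\<le>l. Bernstein n (j + i) x)"
  proof (rule sum_mono)
    fix i assume "i \<in> {..l}"
    then have "real i \<le> r / 2" using l by auto
    then have "(real i)\<^sup>2 \<le> (r/2)\<^sup>2" by (intro power_mono) auto
    then have "(real i)\<^sup>2 / r\<^sup>2 \<le> 1/4" using r by (simp add: field_simps power2_eq_square)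
    then have "3/4 * Bernstein n j x \<le> (1 - (real i)\<^sup>2 / r\<^sup>2) * Bernstein n j x"
      using B by (intro mult_right_mono) auto
    also have "\<dots> \<le> Bernstein n (j + i) x"
      unfolding r by (rule Bernstein_mode_decay[OF x n j])
    finally show "3/4 * Bernstein n j x \<le> Bernstein n (j + i) x" .
  qed
  also have "\<dots> = (\<Sum>k\<in>(+) j ` {..l}. Bernstein n k x)"
    by (subst sum.reindex) auto
  also have "\<dots> \<le> 1" using x by (intro sum_Bernstein_le_1) auto
  finally have "Bernstein n j x \<le> 8 / (3 * r)" using r by (simp add: field_simps)
  also have "\<dots> \<le> 3 / r" using r by (simp add: field_simps)
  also have "3 / r = 3 / sqrt (x * (1 - x)) / sqrt (real n)"
    by (simp add: r_def real_sqrt_mult)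
  finally show ?thesis using Bernstein_mode[OF x j, of k] by linarith
qed

lemma Bernstein_variance:
  "(\<Sum>k\<le>n. (real k - real n * x)\<^sup>2 * Bernstein n k x) = real n * x * (1 - x)"
proof -
  have "(\<Sum>k\<le>n. (real k - real n * x)\<^sup>2 * Bernstein n k x)
      = (\<Sum>k\<le>n. real k * (real k - 1) * Bernstein n k x)
        + (1 - 2 * real n * x) * (\<Sum>k\<le>n. real k * Bernstein n k x)
        + (real n * x)\<^sup>2 * (\<Sum>k\<le>n. Bernstein n k x)"
    unfolding sum_distrib_left sum.distrib[symmetric]
    by (intro sum.cong refl) (simp add: algebra_simps power2_eq_square)
  then show ?thesis
    unfolding sum_kk_Bernstein sum_k_Bernstein sum_Bernstein
    by (simp add: algebra_simps power2_eq_square)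
qed

text \<open>At \<open>x = m / N\<close> the mode is \<open>m\<close>, and Chebyshev puts mass 3/4 on the at most \<open>3 sqrt N\<close> integers
  within \<open>sqrt N\<close> of it.\<close>

lemma Bernstein_lower_mode:
  assumes m: "0 < m" "m < N"
  shows "1 / (4 * sqrt (real N)) \<le> Bernstein N m (real m / real N)"
proof -
  define x where "x = real m / real N"
  have N: "real N \<ge> 1" using m by simp
  have x: "0 < x" "x < 1" using m by (auto simp: x_def)
  have mx: "real N * x = real m" using m by (simp add: x_def)
  define I where "I = {k. k \<le> N \<and> \<bar>real k - real m\<bar> < sqrt (real N)}"
  define J where "J = {k. k \<le> N \<and> \<not> \<bar>real k - real m\<bar> < sqrt (real N)}"
  have IJ: "finite I" "finite J" "I \<inter> J = {}" "I \<union> J = {..N}" by (auto simp: I_def J_def)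
  have "real N * (\<Sum>k\<in>J. Bernstein N k x) \<le> (\<Sum>k\<in>J. (real k - real N * x)\<^sup>2 * Bernstein N k x)"
    unfolding sum_distrib_left
  proof (intro sum_mono mult_right_mono Bernstein_nonneg' x)
    fix k assume "k \<in> J"
    then have "sqrt (real N) \<le> \<bar>real k - real m\<bar>" by (auto simp: J_def)
    then show "real N \<le> (real k - real N * x)\<^sup>2"
      unfolding mx by (metis of_nat_0_le_iff power2_abs real_sqrt_ge_zero real_sqrt_pow2 power_mono)
  qed
  also have "\<dots> \<le> (\<Sum>k\<le>N. (real k - real N * x)\<^sup>2 * Bernstein N k x)"
    using x by (intro sum_mono2) (auto simp: J_def Bernstein_nonneg')
  also have "\<dots> = real N * (x * (1 - x))" by (simp add: Bernstein_variance)
  also have "\<dots> \<le> real N * (1/4)"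
  proof (intro mult_left_mono)
    have "0 \<le> (x - 1/2)\<^sup>2" by simp
    then show "x * (1 - x) \<le> 1/4" by (simp add: power2_eq_square algebra_simps)
  qed simp
  finally have J: "(\<Sum>k\<in>J. Bernstein N k x) \<le> 1/4" using N by (simp add: mult_le_cancel_left_pos)
  have "(\<Sum>k\<in>I. Bernstein N k x) + (\<Sum>k\<in>J. Bernstein N k x) = 1"
    using IJ sum.union_disjoint[of I J "\<lambda>k. Bernstein N k x"] by simp
  with J have "3/4 \<le> (\<Sum>k\<in>I. Bernstein N k x)" by simp
  also have "\<dots> \<le> (\<Sum>k\<in>I. Bernstein N m x)"
    by (intro sum_mono Bernstein_mode x) (use x mx in \<open>auto simp: algebra_simps\<close>)
  also have "\<dots> = real (card I) * Bernstein N m x" by simp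
  also have "\<dots> \<le> (3 * sqrt (real N)) * Bernstein N m x"
  proof (intro mult_right_mono Bernstein_nonneg' x)
    define l where "l = nat \<lfloor>sqrt (real N)\<rfloor>"
    have "I \<subseteq> {m - l..m + l}"
    proof
      fix k assume "k \<in> I"
      then have "\<bar>real k - real m\<bar> < sqrt (real N)" by (auto simp: I_def)
      then have "of_int \<bar>int k - int m\<bar> \<le> sqrt (real N)" by simp
      then have "\<bar>int k - int m\<bar> \<le> \<lfloor>sqrt (real N)\<rfloor>" by (simp only: le_floor_iff)
      then show "k \<in> {m - l..m + l}" by (auto simp: l_def)
    qed
    then have "card I \<le> card {m - l..m + l}" by (intro card_mono) auto
    also have "\<dots> \<le> 2 * l + 1" by simp
    finally have "real (card I) \<le> 2 * real l + 1" by linarith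
    moreover have "real l \<le> sqrt (real N)" by (simp add: l_def)
    moreover have "1 \<le> sqrt (real N)" using N by simp
    ultimately show "real (card I) \<le> 3 * sqrt (real N)" by linarith
  qed
  finally show ?thesis using N by (simp add: x_def field_simps)
qed

text \<open>Changing the success probability from \<open>x = m / N\<close> to \<open>p\<close> costs at most the exponential of
  \<open>N\<close> times the chi-square distance, which is bounded when \<open>x - p\<close> is of order \<open>1 / sqrt N\<close>.\<close>

lemma Bernstein_lower:
  assumes m: "0 < m" "m < N" and p: "0 < p" "p < 1"
    and c: "\<bar>real m / real N - p\<bar> \<le> c / sqrt (real N)"
  shows "exp (- (c\<^sup>2 / (p * (1 - p)))) / (4 * sqrt (real N)) \<le> Bernstein N m p"
proof -
  define x where "x = real m / real N"
  have x: "0 < x" "x < 1" using m by (auto simp: x_def)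
  have N: "real N > 0" using m by simp
  \<comment> \<open>This is 1 + t <= exp t at t = y / z - 1. It is used for \<open>x\<close> against
    \<open>p\<close> and for \<open>1 - x\<close> against \<open>1 - p\<close>, raised to the powers
    \<open>m\<close> and \<open>N - m\<close>; by \<open>eq\<close> the exponents then add up to
    minus \<open>N\<close> times the chi-square distance.\<close>
  have aux: "y * exp (1 - y / z) \<le> z" if "0 < y" "0 < z" for y z :: real
  proof -
    have "y / z \<le> exp (y / z - 1)" using exp_ge_add_one_self[of "y/z - 1"] by simp
    then have "y \<le> z * exp (y / z - 1)" using that by (simp add: field_simps)
    then have "y * exp (1 - y / z) \<le> z * exp (y / z - 1) * exp (1 - y / z)"
      by (intro mult_right_mono) auto
    also have "\<dots> = z" by (simp add: mult.assoc exp_add[symmetric])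
    finally show ?thesis .
  qed
  have dist: "real N * (x - p)\<^sup>2 \<le> c\<^sup>2"
  proof -
    have "\<bar>x - p\<bar>\<^sup>2 \<le> (c / sqrt (real N))\<^sup>2" using c by (intro power_mono) (auto simp: x_def)
    also have "\<dots> = c\<^sup>2 / real N" by (simp add: power_divide)
    finally show ?thesis using N by (simp add: field_simps)
  qed
  have eq: "real m * (1 - x / p) + real (N - m) * (1 - (1 - x) / (1 - p)) = - (real N * (x - p)\<^sup>2 / (p * (1 - p)))"
  proof -
    have "real m = real N * x" "real (N - m) = real N * (1 - x)"
      using m by (auto simp: x_def field_simps)
    moreover have "real N * x * (1 - x / p) + real N * (1 - x) * (1 - (1 - x) / (1 - p))
        = - (real N * (x - p)\<^sup>2 / (p * (1 - p)))"
      using p by (simp add: divide_simps) (simp add: power2_eq_square algebra_simps)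
    ultimately show ?thesis by simp
  qed
  have "exp (- (c\<^sup>2 / (p * (1 - p)))) * Bernstein N m x
      \<le> exp (- (real N * (x - p)\<^sup>2 / (p * (1 - p)))) * Bernstein N m x"
    using dist p x by (intro mult_right_mono Bernstein_nonneg') (auto intro!: divide_right_mono)
  also have "\<dots> = real (N choose m) * ((x * exp (1 - x / p)) ^ m * ((1 - x) * exp (1 - (1 - x) / (1 - p))) ^ (N - m))"
    unfolding eq[symmetric] exp_add exp_of_nat_mult Bernstein_def power_mult_distrib by (simp add: ac_simps)
  also have "\<dots> \<le> real (N choose m) * (p ^ m * (1 - p) ^ (N - m))"
    using x p by (intro mult_left_mono mult_mono power_mono aux) auto
  also have "\<dots> = Bernstein N m p" by (simp add: Bernstein_def)
  finally have "exp (- (c\<^sup>2 / (p * (1 - p)))) * Bernstein N m x \<le> Bernstein N m p" .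
  moreover have "exp (- (c\<^sup>2 / (p * (1 - p)))) * (1 / (4 * sqrt (real N))) \<le> exp (- (c\<^sup>2 / (p * (1 - p)))) * Bernstein N m x"
    unfolding x_def by (intro mult_left_mono Bernstein_lower_mode m) auto
  ultimately show ?thesis by simp
qed

text \<open>The left side is the probability that a uniform \<open>m\<close>-subset meets a fixed
  \<open>r\<close>-set in a prescribed \<open>a\<close>-subset. It equals the Bernoulli probability
  of that pattern times \<open>Bernstein (N - r) (m - a) p / Bernstein N m p\<close>, which is
  Bayes' rule given a total of \<open>m\<close> successes. The upper bound for the numerator and the
  lower bound for the denominator leave sqrt (N / (N - r)), with 12 = 3 * 4.\<close>

lemma hypergeometric_le_binomial:
  assumes m: "0 < m" "m < N" and r: "r < N" and a: "a \<le> r" "a \<le> m" and p: "0 < p" "p < 1"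
    and c: "\<bar>real m / real N - p\<bar> \<le> c / sqrt (real N)"
  shows "real ((N - r) choose (m - a)) / real (N choose m)
    \<le> 12 * exp (c\<^sup>2 / (p * (1 - p))) / sqrt (p * (1 - p)) * sqrt (real N / real (N - r))
      * (p ^ a * (1 - p) ^ (r - a))"
proof (cases "m - a \<le> N - r")
  case True
  define E where "E = exp (c\<^sup>2 / (p * (1 - p)))"
  define s where "s = sqrt (p * (1 - p))"
  have E: "E > 0" "s > 0" using p by (auto simp: E_def s_def)
  have N: "real N > 0" "real (N - r) > 0" using m r by auto
  have pow: "p ^ a * p ^ (m - a) = p ^ m" "(1-p) ^ (r - a) * (1-p) ^ (N - r - (m - a)) = (1-p) ^ (N - m)"
    using True r a m by (auto simp: power_add[symmetric])
  have low: "1 / (4 * E * sqrt (real N)) \<le> Bernstein N m p"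
    using Bernstein_lower[OF m p c] by (simp add: E_def exp_minus field_simps)
  have up: "Bernstein (N - r) (m - a) p \<le> 3 / s / sqrt (real (N - r))"
    unfolding s_def using N by (intro Bernstein_upper p) auto
  have "Bernstein (N - r) (m - a) p * (p ^ a * (1 - p) ^ (r - a)) * real (N choose m)
      = real ((N - r) choose (m - a)) * Bernstein N m p"
    unfolding Bernstein_def pow[symmetric] by (simp add: ac_simps)
  moreover have "Bernstein N m p > 0" using m p by (simp add: Bernstein_pos)
  moreover have "real (N choose m) > 0" using m by simp
  ultimately have "real ((N - r) choose (m - a)) / real (N choose m)
      = Bernstein (N - r) (m - a) p / Bernstein N m p * (p ^ a * (1 - p) ^ (r - a))"
    by (simp add: field_simps)
  also have "\<dots> \<le> (3 / s / sqrt (real (N - r))) / (1 / (4 * E * sqrt (real N))) * (p ^ a * (1 - p) ^ (r - a))"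
    using low up p E N by (intro mult_right_mono frac_le) (auto intro: Bernstein_nonneg')
  also have "\<dots> = 12 * E / s * sqrt (real N / real (N - r)) * (p ^ a * (1 - p) ^ (r - a))"
    using E N by (simp add: real_sqrt_divide field_simps)
  finally show ?thesis by (simp add: E_def s_def)
next
  case False
  then show ?thesis using p by (simp add: binomial_eq_0)
qed

section \<open>Averages over permutations\<close>

lemma permutes_image_extend:
  assumes S: "finite S" and A: "A \<subseteq> S" and B: "B \<subseteq> S" and card: "card B = card A"
  obtains \<sigma> where "\<sigma> permutes S" "\<sigma> ` A = B"
proof -
  have fin: "finite A" "finite B" using A B S finite_subset by auto
  obtain f where f: "bij_betw f A B" using finite_same_card_bij[OF fin] card by auto
  have "card (S - A) = card (S - B)" using A B fin card by (simp add: card_Diff_subset)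
  then obtain g where g: "bij_betw g (S - A) (S - B)"
    using finite_same_card_bij[of "S - A" "S - B"] S by auto
  define \<sigma> where "\<sigma> x = (if x \<in> A then f x else if x \<in> S then g x else x)" for x
  have 1: "bij_betw \<sigma> A B" using f by (rule bij_betw_cong[THEN iffD1, rotated]) (simp add: \<sigma>_def)
  have 2: "bij_betw \<sigma> (S - A) (S - B)" using g by (rule bij_betw_cong[THEN iffD1, rotated]) (simp add: \<sigma>_def)
  have "bij_betw \<sigma> (A \<union> (S - A)) (B \<union> (S - B))" using 1 2 by (rule bij_betw_combine) auto
  then have "bij_betw \<sigma> S S" using A B by (simp add: Un_absorb1)
  then have "\<sigma> permutes S" by (rule bij_imp_permutes) (use A in \<open>auto simp: \<sigma>_def\<close>)
  moreover have "\<sigma> ` A = B" using 1 by (simp add: bij_betw_def)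
  ultimately show ?thesis by (rule that)
qed

text \<open>Composing with a permutation that carries \<open>A\<close> to \<open>B\<close> shows
  that the count is the same for every \<open>B\<close> of this size. It is therefore the number of
  all permutations divided by the number of such \<open>B\<close>.\<close>

lemma card_permutes_image:
  assumes S: "finite S" and A: "A \<subseteq> S" and B: "B \<subseteq> S" and card: "card B = card A"
  shows "card {\<pi>. \<pi> permutes S \<and> \<pi> ` A = B} = fact (card A) * fact (card S - card A)"
proof -
  define c where "c = (\<lambda>B. card {\<pi>. \<pi> permutes S \<and> \<pi> ` A = B})"
  define T where "T = {B. B \<subseteq> S \<and> card B = card A}"
  have finT: "finite T" using S by (auto simp: T_def)
  have c_eq: "c B = c A" if BT: "B \<in> T" for B
  proof -
    obtain \<sigma> where \<sigma>: "\<sigma> permutes S" "\<sigma> ` A = B"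
      by (rule permutes_image_extend[OF S A, of B]) (use BT in \<open>auto simp: T_def\<close>)
    have "bij_betw (\<lambda>\<pi>. \<sigma> \<circ> \<pi>) {\<pi>. \<pi> permutes S \<and> \<pi> ` A = A} {\<pi>. \<pi> permutes S \<and> \<pi> ` A = B}"
    proof (rule bij_betw_byWitness[where f' = "\<lambda>\<pi>. inv \<sigma> \<circ> \<pi>"])
      show "\<forall>\<pi>\<in>{\<pi>. \<pi> permutes S \<and> \<pi> ` A = A}. inv \<sigma> \<circ> (\<sigma> \<circ> \<pi>) = \<pi>"
        using permutes_inv_o[OF \<sigma>(1)] by (auto simp: o_assoc)
      show "\<forall>\<pi>\<in>{\<pi>. \<pi> permutes S \<and> \<pi> ` A = B}. \<sigma> \<circ> (inv \<sigma> \<circ> \<pi>) = \<pi>"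
        using permutes_inv_o[OF \<sigma>(1)] by (auto simp: o_assoc)
      show "(\<circ>) \<sigma> ` {\<pi>. \<pi> permutes S \<and> \<pi> ` A = A} \<subseteq> {\<pi>. \<pi> permutes S \<and> \<pi> ` A = B}"
      proof (intro image_subsetI CollectI conjI)
        fix \<pi> assume "\<pi> \<in> {\<pi>. \<pi> permutes S \<and> \<pi> ` A = A}"
        then have \<pi>: "\<pi> permutes S" "\<pi> ` A = A" by auto
        show "\<sigma> \<circ> \<pi> permutes S" using \<pi>(1) \<sigma>(1) by (rule permutes_compose)
        show "(\<sigma> \<circ> \<pi>) ` A = B" unfolding image_comp[symmetric] \<pi>(2) \<sigma>(2) ..
      qed
      have "inv \<sigma> ` B = A"
        unfolding \<sigma>(2)[symmetric] image_comp permutes_inv_o(2)[OF \<sigma>(1)] by simp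
      show "(\<circ>) (inv \<sigma>) ` {\<pi>. \<pi> permutes S \<and> \<pi> ` A = B} \<subseteq> {\<pi>. \<pi> permutes S \<and> \<pi> ` A = A}"
      proof (intro image_subsetI CollectI conjI)
        fix \<pi> assume "\<pi> \<in> {\<pi>. \<pi> permutes S \<and> \<pi> ` A = B}"
        then have \<pi>: "\<pi> permutes S" "\<pi> ` A = B" by auto
        show "inv \<sigma> \<circ> \<pi> permutes S" using \<pi>(1) permutes_inv[OF \<sigma>(1)] by (rule permutes_compose)
        show "(inv \<sigma> \<circ> \<pi>) ` A = A" unfolding image_comp[symmetric] \<pi>(2) \<open>inv \<sigma> ` B = A\<close> ..
      qed
    qed
    then show ?thesis unfolding c_def by (simp add: bij_betw_same_card)
  qed
  have "fact (card S) = card {\<pi>. \<pi> permutes S}" using S by (simp add: card_permutations)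
  also have "{\<pi>. \<pi> permutes S} = (\<Union>B\<in>T. {\<pi>. \<pi> permutes S \<and> \<pi> ` A = B})"
    using A by (auto simp: T_def permutes_in_image subset_iff intro!: card_image permutes_inj_on)
  also have "card \<dots> = (\<Sum>B\<in>T. c B)"
    unfolding c_def using finT S by (intro card_UN_disjoint) (auto intro: finite_subset[OF _ finite_permutations[of S]])
  also have "\<dots> = (\<Sum>B\<in>T. c A)" using c_eq by (intro sum.cong) auto
  also have "\<dots> = card T * c A" by simp
  also have "card T = card S choose card A" using n_subsets[OF S] by (simp add: T_def)
  finally have "(card S choose card A) * c A = (card S choose card A) * (fact (card A) * fact (card S - card A))"
    using binomial_fact_lemma[of "card A" "card S"] card_mono[OF S A] by (simp add: ac_simps)
  moreover have "card S choose card A \<noteq> 0" using card_mono[OF S A] by simp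
  ultimately have "c A = fact (card A) * fact (card S - card A)" by simp
  then show ?thesis using c_eq[of B] B card by (simp add: c_def T_def)
qed

lemma sum_permutes_image:
  fixes h :: "'a set \<Rightarrow> 'b::comm_semiring_1"
  assumes S: "finite S" and A: "A \<subseteq> S"
  shows "(\<Sum>\<pi> | \<pi> permutes S. h (\<pi> ` A))
    = of_nat (fact (card A) * fact (card S - card A)) * (\<Sum>B | B \<subseteq> S \<and> card B = card A. h B)"
proof -
  define T where "T = {B. B \<subseteq> S \<and> card B = card A}"
  have finT: "finite T" using S by (auto simp: T_def)
  have "(\<Sum>\<pi> | \<pi> permutes S. h (\<pi> ` A))
      = (\<Sum>B\<in>T. \<Sum>\<pi> | \<pi> \<in> {\<pi>. \<pi> permutes S} \<and> \<pi> ` A = B. h (\<pi> ` A))"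
    using finT S A
    by (intro sum.group[symmetric]) (auto simp: T_def finite_permutations permutes_in_image
        intro!: card_image permutes_inj_on)
  also have "\<dots> = (\<Sum>B\<in>T. of_nat (fact (card A) * fact (card S - card A)) * h B)"
  proof (rule sum.cong[OF refl])
    fix B assume B: "B \<in> T"
    have "(\<Sum>\<pi> | \<pi> \<in> {\<pi>. \<pi> permutes S} \<and> \<pi> ` A = B. h (\<pi> ` A))
        = (\<Sum>\<pi> | \<pi> permutes S \<and> \<pi> ` A = B. h B)" by (rule sum.cong) auto
    then show "(\<Sum>\<pi> | \<pi> \<in> {\<pi>. \<pi> permutes S} \<and> \<pi> ` A = B. h (\<pi> ` A))
        = of_nat (fact (card A) * fact (card S - card A)) * h B"
      using card_permutes_image[OF S A, of B] B by (simp add: T_def)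
  qed
  finally show ?thesis by (simp add: sum_distrib_left T_def)
qed

text \<open>Inverting the permutation turns preimages into images. With \<open>A = {..<m}\<close>
  the set is that of the positions where the permuted pooled sample shows an observation from the
  first sample.\<close>

lemma sum_permutes_vimage:
  fixes h :: "'a set \<Rightarrow> 'b::comm_semiring_1"
  assumes S: "finite S" and A: "A \<subseteq> S"
  shows "(\<Sum>\<pi> | \<pi> permutes S. h {x\<in>S. \<pi> x \<in> A})
    = of_nat (fact (card A) * fact (card S - card A)) * (\<Sum>B | B \<subseteq> S \<and> card B = card A. h B)"
proof -
  have "(\<Sum>\<pi> | \<pi> permutes S. h {x\<in>S. \<pi> x \<in> A}) = (\<Sum>\<pi> | \<pi> permutes S. h {x\<in>S. inv \<pi> x \<in> A})"
    by (rule sum_permutations_inverse)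
  also have "\<dots> = (\<Sum>\<pi> | \<pi> permutes S. h (\<pi> ` A))"
  proof (rule sum.cong[OF refl])
    fix \<pi> assume "\<pi> \<in> {\<pi>. \<pi> permutes S}"
    then have \<pi>: "\<pi> permutes S" by simp
    have "{x\<in>S. inv \<pi> x \<in> A} = \<pi> ` A"
    proof (intro equalityI subsetI)
      fix x assume "x \<in> {x\<in>S. inv \<pi> x \<in> A}"
      then show "x \<in> \<pi> ` A" using \<pi> by (metis (no_types, lifting) imageI mem_Collect_eq permutes_inverses(1))
    next
      fix x assume "x \<in> \<pi> ` A"
      then show "x \<in> {x\<in>S. inv \<pi> x \<in> A}"
        using \<pi> A permutes_inverses(2)[OF \<pi>] permutes_in_image[OF \<pi>] by auto
    qed
    then show "h {x\<in>S. inv \<pi> x \<in> A} = h (\<pi> ` A)" by simp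
  qed
  finally show ?thesis using sum_permutes_image[OF assms] by simp
qed

lemma card_subsets_with_trace:
  assumes S: "finite S" and I: "I \<subseteq> S" and A: "A \<subseteq> I" and a: "card A \<le> m"
  shows "card {B. B \<subseteq> S \<and> card B = m \<and> B \<inter> I = A} = (card S - card I) choose (m - card A)"
proof -
  have "finite I" using I S by (rule finite_subset)
  moreover have "finite A" using A \<open>finite I\<close> by (rule finite_subset)
  ultimately have fin: "finite I" "finite A" by auto
  have "bij_betw (\<lambda>D. A \<union> D) {D. D \<subseteq> S - I \<and> card D = m - card A} {B. B \<subseteq> S \<and> card B = m \<and> B \<inter> I = A}"
  proof (rule bij_betw_byWitness[where f' = "\<lambda>B. B - A"])
    show "(\<union>) A ` {D. D \<subseteq> S - I \<and> card D = m - card A} \<subseteq> {B. B \<subseteq> S \<and> card B = m \<and> B \<inter> I = A}"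
    proof safe
      fix D assume D: "D \<subseteq> S - I" "card D = m - card A"
      then have "card (A \<union> D) = card A + card D"
        using A S fin by (intro card_Un_disjoint) (auto intro: finite_subset)
      then show "card (A \<union> D) = m" using D a by simp
    qed (use A I in auto)
    show "(\<lambda>B. B - A) ` {B. B \<subseteq> S \<and> card B = m \<and> B \<inter> I = A} \<subseteq> {D. D \<subseteq> S - I \<and> card D = m - card A}"
      using fin by (auto simp: card_Diff_subset)
  qed (use A in auto)
  then have "card {B. B \<subseteq> S \<and> card B = m \<and> B \<inter> I = A} = card {D. D \<subseteq> S - I \<and> card D = m - card A}"
    by (simp add: bij_betw_same_card)
  also have "\<dots> = card (S - I) choose (m - card A)" using S by (intro n_subsets) auto
  also have "card (S - I) = card S - card I" using I fin by (simp add: card_Diff_subset)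
  finally show ?thesis .
qed

text \<open>Source of the hypergeometric weights. The \<open>if\<close> guards against truncated
  subtraction: for \<open>card A > m\<close> the difference would be 0 and the binomial coefficient
  1 instead of 0.\<close>

lemma sum_subsets_trace:
  fixes H :: "'a set \<Rightarrow> 'b::comm_semiring_1"
  assumes S: "finite S" and I: "I \<subseteq> S"
  shows "(\<Sum>B | B \<subseteq> S \<and> card B = m. H (B \<inter> I))
    = (\<Sum>A\<in>Pow I. of_nat (if card A \<le> m then (card S - card I) choose (m - card A) else 0) * H A)"
proof -
  have "(\<Sum>B | B \<subseteq> S \<and> card B = m. H (B \<inter> I))
      = (\<Sum>A\<in>Pow I. \<Sum>B | B \<in> {B. B \<subseteq> S \<and> card B = m} \<and> B \<inter> I = A. H (B \<inter> I))"
    using S I by (intro sum.group[symmetric]) (auto intro: finite_subset)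
  also have "\<dots> = (\<Sum>A\<in>Pow I. of_nat (if card A \<le> m then (card S - card I) choose (m - card A) else 0) * H A)"
  proof (rule sum.cong[OF refl])
    fix A assume A: "A \<in> Pow I"
    have "(\<Sum>B | B \<in> {B. B \<subseteq> S \<and> card B = m} \<and> B \<inter> I = A. H (B \<inter> I))
        = (\<Sum>B | B \<subseteq> S \<and> card B = m \<and> B \<inter> I = A. H A)" by (rule sum.cong) auto
    also have "\<dots> = of_nat (card {B. B \<subseteq> S \<and> card B = m \<and> B \<inter> I = A}) * H A" by simp
    also have "card {B. B \<subseteq> S \<and> card B = m \<and> B \<inter> I = A}
        = (if card A \<le> m then (card S - card I) choose (m - card A) else 0)"
    proof (cases "card A \<le> m")
      case True
      then show ?thesis using card_subsets_with_trace[OF S I] A by simp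
    next
      case False
      have "card A \<le> card B" if "B \<subseteq> S" "B \<inter> I = A" for B
        using that S by (intro card_mono) (auto intro: finite_subset)
      then have "{B. B \<subseteq> S \<and> card B = m \<and> B \<inter> I = A} = {}" using False by auto
      then show ?thesis using False by (simp only: card.empty if_False)
    qed
    finally show "(\<Sum>B | B \<in> {B. B \<subseteq> S \<and> card B = m} \<and> B \<inter> I = A. H (B \<inter> I))
        = of_nat (if card A \<le> m then (card S - card I) choose (m - card A) else 0) * H A" .
  qed
  finally show ?thesis .
qed

section \<open>Sampling without replacement\<close>

lemma sum_permutes_swap:
  fixes F :: "('a \<Rightarrow> 'a) \<Rightarrow> 'b::comm_monoid_add"
  assumes "i \<in> S" "j \<in> S"
  shows "(\<Sum>\<pi> | \<pi> permutes S. F (\<pi> \<circ> Transposition.transpose i j)) = (\<Sum>\<pi> | \<pi> permutes S. F \<pi>)"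
  using sum_permutations_compose_right[OF permutes_swap_id[OF assms], of F] by simp

lemma sum_permutes_total:
  assumes "\<pi> permutes S"
  shows "(\<Sum>j\<in>S. c (\<pi> j)) = (\<Sum>j\<in>S. c j)"
  using sum.permute[OF assms, of c] by (simp add: comp_def)

text \<open>By exchangeability every coordinate has the same sum over permutations, while the sum
  over all coordinates does not depend on the permutation.\<close>

lemma sum_permutes_coordinate:
  fixes c :: "nat \<Rightarrow> real"
  assumes i: "i < N"
  shows "(\<Sum>\<pi> | \<pi> permutes {..<N}. c (\<pi> i)) = fact N / real N * (\<Sum>j<N. c j)"
proof -
  define e where "e = (\<lambda>i. \<Sum>\<pi> | \<pi> permutes {..<N}. c (\<pi> i))"
  have "e j = e i" if "j < N" for j
    using sum_permutes_swap[of i "{..<N}" j "\<lambda>\<pi>. c (\<pi> i)"] i that by (simp add: e_def)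
  then have "(\<Sum>j<N. e j) = real N * e i" by simp
  moreover have "(\<Sum>j<N. e j) = (\<Sum>\<pi> | \<pi> permutes {..<N}. \<Sum>j<N. c (\<pi> j))"
    unfolding e_def by (rule sum.swap)
  moreover have "\<dots> = (\<Sum>\<pi> | \<pi> permutes {..<N}. \<Sum>j<N. c j)"
    by (intro sum.cong refl sum_permutes_total) simp
  ultimately have "real N * e i = fact N * (\<Sum>j<N. c j)"
    by (simp add: card_permutations)
  then show ?thesis using i by (simp add: e_def field_simps)
qed

text \<open>Draws without replacement are negatively correlated: the coordinates of a permuted
  centred vector add up to 0, so the \<open>N - 1\<close> equal cross terms cancel a nonnegative
  square term.\<close>

lemma sum_permutes_cross_nonpos:
  fixes c :: "nat \<Rightarrow> real"
  assumes i: "i < N" "i' < N" "i \<noteq> i'" and c: "(\<Sum>j<N. c j) = 0"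
  shows "(\<Sum>\<pi> | \<pi> permutes {..<N}. c (\<pi> i) * c (\<pi> i')) \<le> 0"
proof -
  define e where "e = (\<lambda>j. \<Sum>\<pi> | \<pi> permutes {..<N}. c (\<pi> i) * c (\<pi> j))"
  have "e j = e i'" if "j < N" "j \<noteq> i" for j
    using sum_permutes_swap[of i' "{..<N}" j "\<lambda>\<pi>. c (\<pi> i) * c (\<pi> i')"] i that
    by (simp add: e_def Transposition.transpose_def)
  then have "(\<Sum>j\<in>{..<N} - {i}. e j) = (\<Sum>j\<in>{..<N} - {i}. e i')" by (intro sum.cong) auto
  also have "\<dots> = (real N - 1) * e i'" using i by (simp add: of_nat_diff)
  finally have "(\<Sum>j<N. e j) = e i + (real N - 1) * e i'"
    using sum.remove[of "{..<N}" i e] i by simp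
  moreover have "(\<Sum>j<N. e j) = (\<Sum>\<pi> | \<pi> permutes {..<N}. c (\<pi> i) * (\<Sum>j<N. c (\<pi> j)))"
    unfolding e_def sum_distrib_left by (rule sum.swap)
  moreover have "\<dots> = (\<Sum>\<pi> | \<pi> permutes {..<N}. c (\<pi> i) * (\<Sum>j<N. c j))"
    by (intro sum.cong refl arg_cong[where f = "(*) _"] sum_permutes_total) simp
  moreover have "e i \<ge> 0" by (auto simp: e_def intro!: sum_nonneg)
  ultimately have "(real N - 1) * e i' \<le> 0" using c by simp
  moreover have "real N - 1 > 0" using i by linarith
  ultimately have "e i' \<le> 0" by (simp add: mult_le_0_iff)
  then show ?thesis by (simp add: e_def)
qed

text \<open>Dropping the nonpositive cross terms leaves the variance of a sample with replacement.
  The bound depends on \<open>I\<close> only through its size, so it suits the block of positions in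
  which two prefixes differ.\<close>

lemma sum_permutes_square_le:
  fixes c :: "nat \<Rightarrow> real"
  assumes I: "I \<subseteq> {..<N}" and c: "(\<Sum>j<N. c j) = 0"
  shows "(\<Sum>\<pi> | \<pi> permutes {..<N}. (\<Sum>i\<in>I. c (\<pi> i))\<^sup>2)
    \<le> fact N * (real (card I) * ((\<Sum>j<N. (c j)\<^sup>2) / real N))"
proof -
  define e where "e = (\<lambda>i j. \<Sum>\<pi> | \<pi> permutes {..<N}. c (\<pi> i) * c (\<pi> j))"
  have fin: "finite I" using I by (rule finite_subset) simp
  have "(\<Sum>\<pi> | \<pi> permutes {..<N}. (\<Sum>i\<in>I. c (\<pi> i))\<^sup>2) = (\<Sum>i\<in>I. \<Sum>j\<in>I. e i j)"
    unfolding e_def power2_eq_square sum_product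
    by (subst sum.swap) (intro sum.cong refl, subst sum.swap, rule refl)
  also have "\<dots> \<le> (\<Sum>i\<in>I. e i i)"
  proof (rule sum_mono)
    fix i assume i: "i \<in> I"
    have "(\<Sum>j\<in>I. e i j) = e i i + (\<Sum>j\<in>I - {i}. e i j)" using fin i by (rule sum.remove)
    also have "(\<Sum>j\<in>I - {i}. e i j) \<le> 0"
      using I i c unfolding e_def by (intro sum_nonpos sum_permutes_cross_nonpos) auto
    finally show "(\<Sum>j\<in>I. e i j) \<le> e i i" by simp
  qed
  also have "\<dots> = (\<Sum>i\<in>I. fact N / real N * (\<Sum>j<N. (c j)\<^sup>2))"
  proof (rule sum.cong[OF refl])
    fix i assume "i \<in> I"
    then have "i < N" using I by auto
    from sum_permutes_coordinate[OF this, of "\<lambda>x. (c x)\<^sup>2"]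
    show "e i i = fact N / real N * (\<Sum>j<N. (c j)\<^sup>2)" by (simp add: e_def power2_eq_square)
  qed
  finally show ?thesis by (simp add: algebra_simps)
qed

text \<open>If \<open>K\<close> is binomial and \<open>\<pi>\<close> is an independent uniform permutation, then \<open>\<pi> ` {..<K}\<close> contains
  each index independently with probability \<open>x\<close>.\<close>

lemma binomial_prefix_average:
  fixes h :: "nat set \<Rightarrow> complex"
  shows "(\<Sum>k\<le>N. of_real (Bernstein N k x) * ((\<Sum>\<pi> | \<pi> permutes {..<N}. h (\<pi> ` {..<k})) / fact N))
    = (\<Sum>A\<in>Pow {..<N}. of_real (x ^ card A * (1 - x) ^ (N - card A)) * h A)"
proof -
  have "(\<Sum>A\<in>Pow {..<N}. of_real (x ^ card A * (1 - x) ^ (N - card A)) * h A)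
      = (\<Sum>k\<le>N. \<Sum>A | A \<in> Pow {..<N} \<and> card A = k. of_real (x ^ card A * (1 - x) ^ (N - card A)) * h A)"
    using card_mono[of "{..<N}"] by (intro sum.group[symmetric]) fastforce+
  also have "\<dots> = (\<Sum>k\<le>N. of_real (Bernstein N k x) * ((\<Sum>\<pi> | \<pi> permutes {..<N}. h (\<pi> ` {..<k})) / fact N))"
  proof (rule sum.cong[OF refl])
    fix k assume k: "k \<in> {..N}"
    define H where "H = (\<Sum>A | A \<subseteq> {..<N} \<and> card A = k. h A)"
    have "(fact k * fact (N - k) * of_nat (N choose k) :: complex) = fact N"
      using k binomial_fact_lemma[of k N] by (metis atMost_iff of_nat_fact of_nat_mult)
    then have f: "of_nat (N choose k) * (fact k * fact (N - k)) / (fact N :: complex) = 1"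
      by (simp add: ac_simps)
    have "of_real (Bernstein N k x) * ((\<Sum>\<pi> | \<pi> permutes {..<N}. h (\<pi> ` {..<k})) / fact N)
        = of_real (x ^ k * (1 - x) ^ (N - k)) * H * (of_nat (N choose k) * (fact k * fact (N - k)) / fact N)"
      using k by (subst sum_permutes_image) (auto simp: H_def Bernstein_def)
    also have "\<dots> = of_real (x ^ k * (1 - x) ^ (N - k)) * H" unfolding f by simp
    also have "\<dots> = (\<Sum>A | A \<in> Pow {..<N} \<and> card A = k. of_real (x ^ card A * (1 - x) ^ (N - card A)) * h A)"
      unfolding H_def sum_distrib_left by (rule sum.cong) auto
    finally show "(\<Sum>A | A \<in> Pow {..<N} \<and> card A = k. of_real (x ^ card A * (1 - x) ^ (N - card A)) * h A)
        = of_real (Bernstein N k x) * ((\<Sum>\<pi> | \<pi> permutes {..<N}. h (\<pi> ` {..<k})) / fact N)" by simp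
  qed
  finally show ?thesis by simp
qed

section \<open>Characteristic functions of Bernoulli samples and of samples without
  replacement\<close>

lemma iexp_sum: "iexp (\<Sum>j\<in>A. f j) = (\<Prod>j\<in>A. iexp (f j))"
  by (induction A rule: infinite_finite_induct) (simp_all add: exp_add distrib_left)

lemma bernoulli_subset_iexp:
  fixes a :: real
  shows "(\<Sum>A\<in>Pow {..<N}. of_real (x ^ card A * (1 - x) ^ (N - card A)) * iexp (a * (\<Sum>j\<in>A. c j)))
    = (\<Prod>j<N. of_real (1 - x) + of_real x * iexp (a * c j))"
proof -
  have "(\<Prod>j<N. of_real x * iexp (a * c j) + of_real (1 - x))
      = (\<Sum>A\<in>Pow {..<N}. (\<Prod>j\<in>A. of_real x * iexp (a * c j)) * (\<Prod>j\<in>{..<N} - A. of_real (1 - x)))"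
    by (rule prod_add) simp
  also have "\<dots> = (\<Sum>A\<in>Pow {..<N}. of_real (x ^ card A * (1 - x) ^ (N - card A)) * iexp (a * (\<Sum>j\<in>A. c j)))"
  proof (rule sum.cong[OF refl])
    fix A assume "A \<in> Pow {..<N}"
    then have "A \<subseteq> {..<N}" "finite A" by (auto intro: finite_subset)
    then show "(\<Prod>j\<in>A. of_real x * iexp (a * c j)) * (\<Prod>j\<in>{..<N} - A. of_real (1 - x))
        = of_real (x ^ card A * (1 - x) ^ (N - card A)) * iexp (a * (\<Sum>j\<in>A. c j))"
      unfolding sum_distrib_left iexp_sum prod.distrib by (simp add: card_Diff_subset)
  qed
  finally show ?thesis by (simp add: add.commute)
qed

text \<open>The first two terms form the characteristic function at \<open>u\<close> of a centred
  Bernoulli variable. Its mean is 0 and its variance x (1 - x), so the second-order expansions of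
  both sides are the same number 1 - w. The remainders contribute 1/6 and 1/4 of the cube of
  |u|.\<close>

lemma bernoulli_factor_approx:
  fixes x u :: real
  assumes x: "0 \<le> x" "x \<le> 1" and u: "\<bar>u\<bar> \<le> 1"
  shows "cmod (of_real (1 - x) * iexp (- (x * u)) + of_real x * iexp ((1 - x) * u)
      - of_real (exp (- (x * (1 - x) * u\<^sup>2 / 2)))) \<le> \<bar>u\<bar> ^ 3"
proof -
  have i2: "cmod (iexp y - (1 + \<i> * complex_of_real y - (complex_of_real y)\<^sup>2 / 2)) \<le> \<bar>y\<bar> ^ 3 / 6" for y :: real
  proof -
    have "(\<Sum>k\<le>2. (\<i> * complex_of_real y) ^ k / fact k) = 1 + \<i> * complex_of_real y - (complex_of_real y)\<^sup>2 / 2"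
      by (simp add: numeral_2_eq_2) (simp add: complex_eq_iff power2_eq_square)
    then show ?thesis using iexp_approx1[of y 2] by (simp add: fact_numeral eval_nat_numeral)
  qed
  define w where "w = x * (1 - x) * u\<^sup>2 / 2"
  have xx: "0 \<le> x * (1 - x)" "x * (1 - x) \<le> 1" using x by (auto intro: mult_le_one)
  have u2: "u\<^sup>2 \<le> 1" using u by (simp add: abs_square_le_1)
  have w: "0 \<le> w" "w \<le> u\<^sup>2 / 2" using xx by (auto simp: w_def intro!: divide_right_mono mult_left_le_one_le)
  have e: "\<bar>exp (- w) - (1 - w)\<bar> \<le> w\<^sup>2"
  proof -
    have "exp (- w) = 1 / exp w" by (simp add: exp_minus field_simps)
    also have "\<dots> \<le> 1 / (1 + w)"
      using w exp_ge_add_one_self[of w] by (intro divide_left_mono) auto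
    also have "\<dots> \<le> 1 - w + w\<^sup>2"
    proof -
      have "1 \<le> (1 - w + w\<^sup>2) * (1 + w)" using w by (simp add: algebra_simps power2_eq_square)
      then show ?thesis using w by (simp add: field_simps)
    qed
    finally have "exp (- w) \<le> 1 - w + w\<^sup>2" .
    moreover have "1 - w \<le> exp (- w)" using exp_ge_add_one_self[of "- w"] by simp
    ultimately show ?thesis by simp
  qed
  have "w\<^sup>2 \<le> \<bar>u\<bar> ^ 3 / 4"
  proof -
    have "w\<^sup>2 \<le> (u\<^sup>2 / 2)\<^sup>2" using w by (intro power_mono) auto
    also have "\<dots> = \<bar>u\<bar> ^ 3 * \<bar>u\<bar> / 4" by (simp add: power2_eq_square power3_eq_cube)
    also have "\<dots> \<le> \<bar>u\<bar> ^ 3 * 1 / 4" using u by (intro divide_right_mono mult_left_mono) auto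
    finally show ?thesis by simp
  qed
  with e have e: "\<bar>(1 - w) - exp (- w)\<bar> \<le> \<bar>u\<bar> ^ 3 / 4" by linarith
  have t1: "\<bar>- (x * u)\<bar> ^ 3 \<le> \<bar>u\<bar> ^ 3" "\<bar>(1 - x) * u\<bar> ^ 3 \<le> \<bar>u\<bar> ^ 3"
    using x by (auto intro!: power_mono simp: abs_mult mult_left_le_one_le)
  let ?p1 = "1 + \<i> * complex_of_real (- (x * u)) - (complex_of_real (- (x * u)))\<^sup>2 / 2"
  let ?p2 = "1 + \<i> * complex_of_real ((1 - x) * u) - (complex_of_real ((1 - x) * u))\<^sup>2 / 2"
  have alg: "of_real (1 - x) * ?p1 + of_real x * ?p2 = complex_of_real (1 - w)"
    by (simp add: w_def complex_eq_iff power2_eq_square field_simps)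
  have abs_x: "\<bar>1 - x\<bar> = 1 - x" "\<bar>x\<bar> = x" using x by auto
  have i2': "cmod (iexp y - (1 + \<i> * complex_of_real y - (complex_of_real y)\<^sup>2 / 2)) \<le> \<bar>u\<bar> ^ 3 / 6" if "\<bar>y\<bar> ^ 3 \<le> \<bar>u\<bar> ^ 3" for y :: real
    using i2[of y] that by linarith
  have "of_real (1 - x) * iexp (- (x * u)) + of_real x * iexp ((1 - x) * u) - of_real (exp (- w))
      = of_real (1 - x) * (iexp (- (x * u)) - ?p1) + of_real x * (iexp ((1 - x) * u) - ?p2)
        + of_real ((1 - w) - exp (- w))"
    using alg by (simp add: algebra_simps)
  also have "cmod \<dots> \<le> (1 - x) * (\<bar>u\<bar> ^ 3 / 6) + x * (\<bar>u\<bar> ^ 3 / 6) + \<bar>u\<bar> ^ 3 / 4"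
  proof (intro norm_triangle_mono)
    show "cmod (of_real (1 - x) * (iexp (- (x * u)) - ?p1)) \<le> (1 - x) * (\<bar>u\<bar> ^ 3 / 6)"
      unfolding norm_mult norm_of_real abs_x by (rule mult_left_mono[OF i2'[OF t1(1)]]) (use x in auto)
    show "cmod (of_real x * (iexp ((1 - x) * u) - ?p2)) \<le> x * (\<bar>u\<bar> ^ 3 / 6)"
      unfolding norm_mult norm_of_real abs_x by (rule mult_left_mono[OF i2'[OF t1(2)]]) (use x in auto)
    show "cmod (of_real ((1 - w) - exp (- w))) \<le> \<bar>u\<bar> ^ 3 / 4"
      using e by (simp only: norm_of_real real_norm_def)
  qed
  also have "\<dots> = \<bar>u\<bar> ^ 3 * (5/12)" by (simp add: field_simps)
  also have "\<dots> \<le> \<bar>u\<bar> ^ 3 * 1" by (intro mult_left_mono) auto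
  finally show ?thesis by (simp add: w_def)
qed

text \<open>Because the \<open>c j\<close> sum to 0, the centring phases
  \<open>iexp (- x * (a * c j))\<close> multiply to 1 and may be inserted freely. Products of
  numbers in the unit disc differ by at most the sum of the differences of their factors, and each
  cube is bounded by \<eta> times a square.\<close>

lemma bernoulli_product_approx:
  fixes x a \<eta> :: real and c :: "nat \<Rightarrow> real"
  assumes x: "0 \<le> x" "x \<le> 1" and c: "(\<Sum>j<N. c j) = 0"
    and \<eta>: "\<And>j. j < N \<Longrightarrow> \<bar>a * c j\<bar> \<le> \<eta>" "\<eta> \<le> 1"
  shows "cmod ((\<Prod>j<N. of_real (1 - x) + of_real x * iexp (a * c j))
      - of_real (exp (- (x * (1 - x) * a\<^sup>2 * (\<Sum>j<N. (c j)\<^sup>2) / 2)))) \<le> \<eta> * a\<^sup>2 * (\<Sum>j<N. (c j)\<^sup>2)"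
proof -
  define z where "z j = of_real (1 - x) * iexp (- (x * (a * c j))) + of_real x * iexp ((1 - x) * (a * c j))" for j
  define w where "w j = complex_of_real (exp (- (x * (1 - x) * (a * c j)\<^sup>2 / 2)))" for j
  have z_eq: "z j = iexp (- x * (a * c j)) * (of_real (1 - x) + of_real x * iexp (a * c j))" for j
    by (simp add: z_def algebra_simps exp_add[symmetric] flip: exp_add)
  have "(\<Prod>j<N. z j) = (\<Prod>j<N. iexp (- x * (a * c j))) * (\<Prod>j<N. of_real (1 - x) + of_real x * iexp (a * c j))"
    unfolding z_eq prod.distrib ..
  also have "(\<Prod>j<N. iexp (- x * (a * c j))) = iexp (\<Sum>j<N. - x * (a * c j))" by (rule iexp_sum[symmetric])
  also have "(\<Sum>j<N. - x * (a * c j)) = 0" using c by (simp flip: sum_distrib_left add: sum_negf)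
  finally have zprod: "(\<Prod>j<N. of_real (1 - x) + of_real x * iexp (a * c j)) = (\<Prod>j<N. z j)" by simp
  have "(\<Prod>j<N. w j) = of_real (exp (\<Sum>j<N. - (x * (1 - x) * (a * c j)\<^sup>2 / 2)))"
    unfolding w_def by (simp add: exp_sum)
  also have "(\<Sum>j<N. - (x * (1 - x) * (a * c j)\<^sup>2 / 2)) = - (x * (1 - x) * a\<^sup>2 * (\<Sum>j<N. (c j)\<^sup>2) / 2)"
    by (simp add: sum_distrib_left sum_negf sum_divide_distrib power_mult_distrib ac_simps)
  finally have wprod: "(\<Prod>j<N. w j) = of_real (exp (- (x * (1 - x) * a\<^sup>2 * (\<Sum>j<N. (c j)\<^sup>2) / 2)))" .
  have "cmod (prod z {..<N} - prod w {..<N}) \<le> (\<Sum>j<N. cmod (z j - w j))"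
  proof (rule norm_prod_diff)
    fix j
    have abs_x: "\<bar>1 - x\<bar> = 1 - x" "\<bar>x\<bar> = x" using x by auto
    have "cmod (z j) \<le> (1 - x) * 1 + x * 1"
      unfolding z_def by (intro norm_triangle_mono) (simp_all only: norm_mult norm_of_real abs_x norm_exp_i_times order_refl)
    then show "cmod (z j) \<le> 1" by simp
    show "cmod (w j) \<le> 1" using x by (simp add: w_def)
  qed
  also have "\<dots> \<le> (\<Sum>j<N. \<eta> * a\<^sup>2 * (c j)\<^sup>2)"
  proof (rule sum_mono)
    fix j assume "j \<in> {..<N}"
    then have j: "\<bar>a * c j\<bar> \<le> \<eta>" using \<eta> by simp
    have "cmod (z j - w j) \<le> \<bar>a * c j\<bar> ^ 3"
      unfolding z_def w_def using j \<eta> by (intro bernoulli_factor_approx x) auto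
    also have "\<dots> = \<bar>a * c j\<bar> * (a * c j)\<^sup>2" by (simp add: power3_eq_cube power2_eq_square)
    also have "\<dots> \<le> \<eta> * (a * c j)\<^sup>2" using j by (intro mult_right_mono) auto
    finally show "cmod (z j - w j) \<le> \<eta> * a\<^sup>2 * (c j)\<^sup>2" by (simp add: power_mult_distrib)
  qed
  also have "\<dots> = \<eta> * a\<^sup>2 * (\<Sum>j<N. (c j)\<^sup>2)" by (rule sum_distrib_left[symmetric])
  finally show ?thesis unfolding zprod wprod[symmetric] .
qed

lemma binomial_mean_abs_dev:
  assumes m: "0 < m" "m < N"
  shows "(\<Sum>k\<le>N. Bernstein N k (real m / real N) * \<bar>real k - real m\<bar>) \<le> sqrt (real N)"
proof -
  define x where "x = real m / real N"
  define s where "s = sqrt (real N)"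
  have x: "0 < x" "x < 1" "real N * x = real m" using m by (auto simp: x_def)
  have s: "s > 0" "s * s = real N" using m by (auto simp: s_def)
  \<comment> \<open>Stands in for Cauchy-Schwarz: with s = sqrt N the constant part and the variance
    part each contribute at most s / 2.\<close>
  have amgm: "\<bar>y\<bar> \<le> s / 2 + y\<^sup>2 / (2 * s)" for y :: real
  proof -
    have "0 \<le> (\<bar>y\<bar> - s)\<^sup>2" by simp
    then have "2 * \<bar>y\<bar> * s \<le> y\<^sup>2 + s * s"
      unfolding power2_diff power2_abs power2_eq_square[of s] by linarith
    then show ?thesis using s by (simp add: field_simps)
  qed
  have "(\<Sum>k\<le>N. Bernstein N k x * \<bar>real k - real m\<bar>)
      \<le> (\<Sum>k\<le>N. Bernstein N k x * (s / 2 + (real k - real m)\<^sup>2 / (2 * s)))"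
    using x by (intro sum_mono mult_left_mono amgm Bernstein_nonneg') auto
  also have "\<dots> = s / 2 * (\<Sum>k\<le>N. Bernstein N k x)
      + (\<Sum>k\<le>N. (real k - real N * x)\<^sup>2 * Bernstein N k x) / (2 * s)"
    unfolding x by (simp add: sum_distrib_left sum_divide_distrib sum.distrib algebra_simps del: sum_Bernstein)
  also have "\<dots> = s / 2 + real N * (x * (1 - x)) / (2 * s)"
    unfolding Bernstein_variance sum_Bernstein by (simp add: mult.assoc)
  also have "\<dots> \<le> s / 2 + real N * 1 / (2 * s)"
    using x s by (intro add_left_mono divide_right_mono mult_left_mono mult_le_one) auto
  also have "\<dots> = s" using s by (simp add: field_simps)
  finally show ?thesis by (simp add: x_def s_def)
qed

text \<open>Hajek's coupling: the sample \<open>\<pi> ` {..<m}\<close> without replacement is compared with the Bernoulli sample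
  \<open>\<pi> ` {..<K}\<close>; the two sums differ by \<open>\<bar>K - m\<bar>\<close> terms, that is, by order \<open>N powr (1/4)\<close>.\<close>

lemma permutation_char_approx:
  fixes c :: "nat \<Rightarrow> real" and a \<eta> \<delta> :: real
  assumes m: "0 < m" "m < N" and c: "(\<Sum>j<N. c j) = 0"
    and \<eta>: "\<And>j. j < N \<Longrightarrow> \<bar>a * c j\<bar> \<le> \<eta>" "\<eta> \<le> 1" and \<delta>: "\<delta> > 0"
  shows "cmod ((\<Sum>\<pi> | \<pi> permutes {..<N}. iexp (a * (\<Sum>i<m. c (\<pi> i)))) / fact N
      - of_real (exp (- (real m / real N * (1 - real m / real N) * a\<^sup>2 * (\<Sum>j<N. (c j)\<^sup>2) / 2))))
    \<le> \<eta> * a\<^sup>2 * (\<Sum>j<N. (c j)\<^sup>2) + (\<delta> + a\<^sup>2 * (\<Sum>j<N. (c j)\<^sup>2) / (sqrt (real N) * \<delta>))"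
proof -
  define x where "x = real m / real N"
  define V where "V = (\<Sum>j<N. (c j)\<^sup>2)"
  define Pm where "Pm = {\<pi>. \<pi> permutes {..<N}}"
  define \<phi> where "\<phi> k = (\<Sum>\<pi>\<in>Pm. iexp (a * (\<Sum>i<k. c (\<pi> i)))) / fact N" for k
  define b where "b k = Bernstein N k x" for k
  have x: "0 < x" "x < 1" using m by (auto simp: x_def)
  have N: "real N > 0" using m by simp
  have b: "b k \<ge> 0" "(\<Sum>k\<le>N. b k) = 1" for k using x by (auto simp: b_def Bernstein_nonneg')
  have V: "V \<ge> 0" by (auto simp: V_def intro: sum_nonneg)
  have cardP: "real (card Pm) = fact N" by (simp add: Pm_def card_permutations)
  have diff: "cmod (\<phi> m - \<phi> k) \<le> \<delta> + a\<^sup>2 / \<delta> * (V / real N) * \<bar>real k - real m\<bar>" if k: "k \<le> N" for k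
  proof -
    define I where "I = {min k m..<max k m}"
    have I: "I \<subseteq> {..<N}" "real (card I) = \<bar>real k - real m\<bar>" using k m by (auto simp: I_def)
    have "cmod (\<phi> m - \<phi> k) = cmod (\<Sum>\<pi>\<in>Pm. iexp (a * (\<Sum>i<m. c (\<pi> i))) - iexp (a * (\<Sum>i<k. c (\<pi> i)))) / fact N"
      by (simp add: \<phi>_def diff_divide_distrib[symmetric] sum_subtractf norm_divide)
    also have "\<dots> \<le> (\<Sum>\<pi>\<in>Pm. \<delta> + a\<^sup>2 / \<delta> * (\<Sum>i\<in>I. c (\<pi> i))\<^sup>2) / fact N"
    proof (intro divide_right_mono sum_norm_le)
      fix \<pi>
      define y where "y = \<bar>a * (\<Sum>i\<in>I. c (\<pi> i))\<bar>"
      have sub: "(\<Sum>i<u. c (\<pi> i)) - (\<Sum>i<v. c (\<pi> i)) = (\<Sum>i\<in>{v..<u}. c (\<pi> i))" if "v \<le> u" for u v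
        using that by (simp add: sum_diff_nat_ivl lessThan_atLeast0)
      have d: "\<bar>(\<Sum>i<m. c (\<pi> i)) - (\<Sum>i<k. c (\<pi> i))\<bar> = \<bar>\<Sum>i\<in>I. c (\<pi> i)\<bar>"
      proof (cases "k \<le> m")
        case True
        then show ?thesis using sub[of k m] by (simp add: I_def)
      next
        case False
        then have "\<bar>(\<Sum>i<k. c (\<pi> i)) - (\<Sum>i<m. c (\<pi> i))\<bar> = \<bar>\<Sum>i\<in>I. c (\<pi> i)\<bar>"
          using sub[of m k] by (simp add: I_def)
        then show ?thesis by (simp add: abs_minus_commute)
      qed
      have "cmod (iexp (a * (\<Sum>i<m. c (\<pi> i))) - iexp (a * (\<Sum>i<k. c (\<pi> i))))
          = cmod (iexp (a * (\<Sum>i<k. c (\<pi> i))) * (iexp (a * ((\<Sum>i<m. c (\<pi> i)) - (\<Sum>i<k. c (\<pi> i)))) - 1))"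
        by (simp add: algebra_simps flip: exp_add)
      also have "\<dots> = cmod (iexp (a * ((\<Sum>i<m. c (\<pi> i)) - (\<Sum>i<k. c (\<pi> i)))) - 1)" by (simp add: norm_mult)
      also have "\<dots> \<le> \<bar>a * ((\<Sum>i<m. c (\<pi> i)) - (\<Sum>i<k. c (\<pi> i)))\<bar>"
        using iexp_approx1[of "a * ((\<Sum>i<m. c (\<pi> i)) - (\<Sum>i<k. c (\<pi> i)))" 0] by simp
      also have "\<dots> = y" using d by (simp add: y_def abs_mult)
      \<comment> \<open>Either y <= \<delta> or y <= y^2 / \<delta>. This trades the Lipschitz bound
        for a second moment, which \<open>sum_permutes_square_le\<close> controls; the free
        threshold is later taken to be N^(-1/4).\<close>
      also have "y \<le> \<delta> + y\<^sup>2 / \<delta>"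
      proof (cases "y \<le> \<delta>")
        case False
        then have "y * \<delta> \<le> y * y" using \<delta> by (intro mult_left_mono) auto
        then show ?thesis using \<delta> by (simp add: field_simps power2_eq_square add_increasing)
      qed (use \<delta> in \<open>simp add: add_increasing2\<close>)
      also have "y\<^sup>2 / \<delta> = a\<^sup>2 / \<delta> * (\<Sum>i\<in>I. c (\<pi> i))\<^sup>2" by (simp add: y_def power_mult_distrib)
      finally show "cmod (iexp (a * (\<Sum>i<m. c (\<pi> i))) - iexp (a * (\<Sum>i<k. c (\<pi> i)))) \<le> \<delta> + a\<^sup>2 / \<delta> * (\<Sum>i\<in>I. c (\<pi> i))\<^sup>2" .
    qed simp
    also have "\<dots> = \<delta> + a\<^sup>2 / \<delta> * ((\<Sum>\<pi>\<in>Pm. (\<Sum>i\<in>I. c (\<pi> i))\<^sup>2) / fact N)"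
      unfolding sum.distrib sum_distrib_left[symmetric] by (simp add: cardP add_divide_distrib)
    also have "\<dots> \<le> \<delta> + a\<^sup>2 / \<delta> * (real (card I) * (V / real N))"
      using sum_permutes_square_le[OF I(1) c] \<delta>
      by (intro add_left_mono mult_left_mono) (auto simp: Pm_def V_def divide_le_eq ac_simps)
    finally show ?thesis by (simp add: I ac_simps)
  qed
  have mix: "(\<Sum>k\<le>N. of_real (b k) * \<phi> k) = (\<Prod>j<N. of_real (1 - x) + of_real x * iexp (a * c j))"
  proof -
    have "(\<Sum>\<pi>\<in>Pm. iexp (a * (\<Sum>j\<in>\<pi> ` {..<k}. c j))) = (\<Sum>\<pi>\<in>Pm. iexp (a * (\<Sum>i<k. c (\<pi> i))))" for k
    proof (rule sum.cong[OF refl])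
      fix \<pi> assume "\<pi> \<in> Pm"
      then have "inj_on \<pi> {..<k}" by (auto simp: Pm_def intro: permutes_inj_on)
      then show "iexp (a * (\<Sum>j\<in>\<pi> ` {..<k}. c j)) = iexp (a * (\<Sum>i<k. c (\<pi> i)))" by (simp add: sum.reindex)
    qed
    then show ?thesis
      using binomial_prefix_average[of N x "\<lambda>A. iexp (a * (\<Sum>j\<in>A. c j))"]
      unfolding bernoulli_subset_iexp by (simp add: b_def \<phi>_def Pm_def)
  qed
  have "\<phi> m = (\<Sum>k\<le>N. of_real (b k) * \<phi> m)"
    using b(2) by (simp flip: sum_distrib_right of_real_sum)
  then have "cmod (\<phi> m - (\<Sum>k\<le>N. of_real (b k) * \<phi> k)) = cmod (\<Sum>k\<le>N. of_real (b k) * (\<phi> m - \<phi> k))"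
    by (simp add: sum_subtractf right_diff_distrib)
  also have "\<dots> \<le> (\<Sum>k\<le>N. b k * (\<delta> + a\<^sup>2 / \<delta> * (V / real N) * \<bar>real k - real m\<bar>))"
  proof (rule sum_norm_le)
    fix k assume "k \<in> {..N}"
    then show "cmod (of_real (b k) * (\<phi> m - \<phi> k)) \<le> b k * (\<delta> + a\<^sup>2 / \<delta> * (V / real N) * \<bar>real k - real m\<bar>)"
      using b diff[of k] by (simp add: norm_mult mult_left_mono)
  qed
  also have "\<dots> = \<delta> * (\<Sum>k\<le>N. b k) + a\<^sup>2 / \<delta> * (V / real N) * (\<Sum>k\<le>N. b k * \<bar>real k - real m\<bar>)"
    by (simp add: sum_distrib_left sum.distrib distrib_left ac_simps)
  also have "\<dots> \<le> \<delta> * 1 + a\<^sup>2 / \<delta> * (V / real N) * sqrt (real N)"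
    using binomial_mean_abs_dev[OF m] \<delta> V b
    by (intro add_mono mult_left_mono) (auto simp: b_def x_def)
  also have "\<dots> = \<delta> + a\<^sup>2 * V / (sqrt (real N) * \<delta>)"
  proof -
    have "sqrt (real N) / real N = 1 / sqrt (real N)" using N by (simp add: real_div_sqrt field_simps)
    then show ?thesis by (metis (no_types, lifting) mult.commute mult.right_neutral times_divide_eq_right divide_divide_eq_left times_divide_times_eq)
  qed
  finally have 1: "cmod (\<phi> m - (\<Prod>j<N. of_real (1 - x) + of_real x * iexp (a * c j)))
      \<le> \<delta> + a\<^sup>2 * V / (sqrt (real N) * \<delta>)" by (simp only: mix)
  have 2: "cmod ((\<Prod>j<N. of_real (1 - x) + of_real x * iexp (a * c j))
      - of_real (exp (- (x * (1 - x) * a\<^sup>2 * V / 2)))) \<le> \<eta> * a\<^sup>2 * V"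
    unfolding V_def using x by (intro bernoulli_product_approx c \<eta>) auto
  show ?thesis
    using norm_triangle_mono[OF 1 2] by (simp add: \<phi>_def Pm_def x_def V_def algebra_simps)
qed

section \<open>Uniform convergence of distribution functions\<close>

lemma continuous_cdf_std_normal: "isCont (cdf std_normal_distribution) x"
proof -
  interpret real_distribution std_normal_distribution by (rule real_dist_normal_dist)
  have "emeasure std_normal_distribution {x} = 0"
    by (subst emeasure_density) (auto simp: nn_integral_null_set)
  then show ?thesis unfolding isCont_cdf by (simp add: measure_def)
qed

text \<open>Polya: compare at finitely many quantiles of the limit.\<close>

lemma weak_conv_m_imp_uniform_cdf:
  assumes M: "\<And>k. real_distribution (M k)" and M': "real_distribution M'"
    and conv: "weak_conv_m M M'" and cont: "\<And>x. isCont (cdf M') x" and \<epsilon>: "\<epsilon> > 0"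
  shows "eventually (\<lambda>k. \<forall>t. \<bar>cdf (M k) t - cdf M' t\<bar> \<le> \<epsilon>) sequentially"
proof -
  interpret M: real_distribution "M k" for k by (rule M)
  interpret M': real_distribution M' by (rule M')
  define F where "F = cdf M'"
  have F01: "0 \<le> F t" "F t \<le> 1" for t by (simp_all add: F_def M'.cdf_nonneg M'.cdf_bounded_prob)
  have mono: "s \<le> t \<Longrightarrow> F s \<le> F t" for s t by (simp add: F_def M'.cdf_nondecreasing)
  have quantile: "\<exists>x. F x = y" if y: "0 < y" "y < 1" for y
  proof -
    obtain a where a: "F a < y"
      using order_tendstoD(2)[OF M'.cdf_lim_at_bot y(1)] by (auto simp: F_def eventually_at_bot_linorder)
    obtain b where b: "F b > y"
      using order_tendstoD(1)[OF M'.cdf_lim_at_top_prob y(2)] by (auto simp: F_def eventually_at_top_linorder)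
    have "a \<le> b" using a b mono[of b a] by linarith
    then show ?thesis using IVT[of F a y b] a b cont by (auto simp: F_def)
  qed
  obtain K :: nat where K: "K > 0" "3 / real K \<le> \<epsilon>"
  proof -
    obtain K :: nat where K: "3 / \<epsilon> < real K" using reals_Archimedean2 by blast
    have "0 < 3 / \<epsilon>" using \<epsilon> by simp
    with K have "0 < real K" by linarith
    then show ?thesis using \<epsilon> K by (intro that[of K]) (auto simp: field_simps)
  qed
  have K3: "3 / real K = 1 / real K + 1 / real K + 1 / real K" "1 / real K \<ge> 0" by simp_all
  \<comment> \<open>Quantiles at the interior levels only: levels 0 and 1 need not be attained, and
    the two ends are treated by the trivial bounds 0 and 1 for distribution functions.\<close>
  define x where "x i = (SOME x. F x = real i / real K)" for i :: nat
  have x: "F (x i) = real i / real K" if "0 < i" "i < K" for i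
    unfolding x_def using quantile[of "real i / real K"] that by (intro someI_ex[of "\<lambda>x. F x = _"]) auto
  have "eventually (\<lambda>k. \<forall>i\<in>{0<..<K}. \<bar>cdf (M k) (x i) - F (x i)\<bar> < 1 / real K) sequentially"
  proof (intro eventually_ball_finite ballI)
    fix i
    have "(\<lambda>k. cdf (M k) (x i)) \<longlonglongrightarrow> F (x i)"
      using conv cont by (simp add: weak_conv_m_def weak_conv_def F_def)
    from tendstoD[OF this, of "1 / real K"] K
    show "eventually (\<lambda>k. \<bar>cdf (M k) (x i) - F (x i)\<bar> < 1 / real K) sequentially"
      by (simp add: dist_real_def)
  qed simp
  then show ?thesis
  proof eventually_elim
    case (elim k)
    show ?case
    proof
      fix t
      have G01: "0 \<le> cdf (M k) t" "cdf (M k) t \<le> 1" by (simp_all add: M.cdf_nonneg M.cdf_bounded_prob)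
      have Gmono: "r \<le> s \<Longrightarrow> cdf (M k) r \<le> cdf (M k) s" for r s by (simp add: M.cdf_nondecreasing)
      have KF: "0 \<le> real K * F t" "real K * F t \<le> real K" using F01[of t] K by (auto simp: mult_left_le)
      have up: "cdf (M k) t \<le> F t + 3 / real K"
      proof -
        \<comment> \<open>The first level strictly above \<open>F t\<close>. Strictness matters:
          \<open>F t < F (x j)\<close> forces \<open>t \<le> x j\<close>, which equality would not.
          If this level is not below 1, then \<open>F t\<close> is within 1 / K of 1.\<close>
        define j where "j = nat \<lfloor>real K * F t\<rfloor> + 1"
        have j: "real K * F t < real j" "real j \<le> real K * F t + 1" using KF by (auto simp: j_def) linarith
        show ?thesis
        proof (cases "j < K")
          case True
          have "0 < j" by (simp add: j_def)
          then have xj: "F (x j) = real j / real K" "\<bar>cdf (M k) (x j) - F (x j)\<bar> < 1 / real K"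
            using x elim True by auto
          have "F t < F (x j)" using j K by (simp add: xj field_simps)
          then have "t \<le> x j" using mono[of "x j" t] by linarith
          then have "cdf (M k) t \<le> F (x j) + 1 / real K" using Gmono[of t "x j"] xj by linarith
          also have "F (x j) \<le> (real K * F t + 1) / real K"
            unfolding xj using j by (intro divide_right_mono) auto
          also have "\<dots> = F t + 1 / real K" using K by (simp add: add_divide_distrib)
          finally show ?thesis using K3 by linarith
        next
          case False
          then have "1 \<le> F t + 1 / real K" using j K by (simp add: field_simps)
          also have "\<dots> \<le> F t + 3 / real K" by (simp add: divide_right_mono)
          finally show ?thesis using G01 by linarith
        qed
      qed
      have lo: "F t - 3 / real K \<le> cdf (M k) t"
      proof -
        define j where "j = nat (\<lceil>real K * F t\<rceil> - 1)"
        show ?thesis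
        proof (cases "real K * F t \<le> 1")
          case True
          then have "F t \<le> 1 / real K" using K by (simp add: field_simps)
          also have "\<dots> \<le> 3 / real K" by (simp add: divide_right_mono)
          finally show ?thesis using G01 by linarith
        next
          case False
          then have j: "real j < real K * F t" "real K * F t \<le> real j + 1" "0 < j"
            by (auto simp: j_def; linarith)+
          then have "j < K" using KF by linarith
          then have xj: "F (x j) = real j / real K" "\<bar>cdf (M k) (x j) - F (x j)\<bar> < 1 / real K"
            using x elim j by auto
          have "F (x j) < F t" using j K by (simp add: xj field_simps)
          then have "x j \<le> t" using mono[of t "x j"] by linarith
          then have "F (x j) - 1 / real K \<le> cdf (M k) t" using Gmono[of "x j" t] xj by linarith
          moreover have "F (x j) \<ge> (real K * F t - 1) / real K"
            unfolding xj using j by (intro divide_right_mono) auto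
          moreover have "(real K * F t - 1) / real K = F t - 1 / real K" using K by (simp add: diff_divide_distrib)
          ultimately show ?thesis using K3 by linarith
        qed
      qed
      show "\<bar>cdf (M k) t - cdf M' t\<bar> \<le> \<epsilon>" using up lo K by (simp add: F_def abs_le_iff)
    qed
  qed
qed

text \<open>Under the uniform law on \<open>A k\<close>, the two kinds of averages are the
  characteristic function and the distribution function of \<open>T k\<close>.\<close>

lemma finite_average_clt:
  fixes T :: "nat \<Rightarrow> 'a \<Rightarrow> real" and A :: "nat \<Rightarrow> 'a set"
  assumes A: "\<And>k. finite (A k)" "\<And>k. A k \<noteq> {}"
    and conv: "\<And>s. (\<lambda>k. (\<Sum>x\<in>A k. iexp (s * T k x)) / card (A k)) \<longlonglongrightarrow> of_real (exp (- s\<^sup>2 / 2))"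
    and \<epsilon>: "\<epsilon> > 0"
  shows "eventually (\<lambda>k. \<forall>t. \<bar>(\<Sum>x\<in>A k. if T k x \<le> t then 1 else 0) / card (A k)
    - cdf std_normal_distribution t\<bar> \<le> \<epsilon>) sequentially"
proof -
  define M where "M k = distr (measure_pmf (pmf_of_set (A k))) borel (T k)" for k
  have M: "real_distribution (M k)" for k
    unfolding M_def by (intro prob_space.real_distribution_distr) (auto simp: measure_pmf.prob_space_axioms)
  have "char (M k) s = (\<Sum>x\<in>A k. iexp (s * T k x)) / card (A k)" for k s
  proof -
    have "char (M k) s = (LINT x|measure_pmf (pmf_of_set (A k)). iexp (s * T k x))"
      unfolding M_def char_def by (subst integral_distr) auto
    also have "\<dots> = (\<Sum>x\<in>A k. pmf (pmf_of_set (A k)) x *\<^sub>R iexp (s * T k x))"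
      using A[of k] by (intro integral_measure_pmf) (auto simp: set_pmf_of_set)
    finally show ?thesis using A[of k] by (simp add: scaleR_conv_of_real sum_divide_distrib)
  qed
  then have "weak_conv_m M std_normal_distribution"
    using conv by (intro levy_continuity M real_dist_normal_dist) (simp add: char_std_normal_distribution)
  then have "eventually (\<lambda>k. \<forall>t. \<bar>cdf (M k) t - cdf std_normal_distribution t\<bar> \<le> \<epsilon>) sequentially"
    by (intro weak_conv_m_imp_uniform_cdf M real_dist_normal_dist continuous_cdf_std_normal \<epsilon>)
  moreover have "cdf (M k) t = (\<Sum>x\<in>A k. if T k x \<le> t then 1 else 0) / card (A k)" for k t
  proof -
    have "cdf (M k) t = measure (measure_pmf (pmf_of_set (A k))) {x. T k x \<le> t}"
      unfolding M_def cdf_def by (subst measure_distr) (auto intro!: arg_cong2[where f = measure])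
    also have "\<dots> = card (A k \<inter> {x. T k x \<le> t}) / card (A k)" using A[of k] by (rule measure_pmf_of_set[rotated])
    also have "real (card (A k \<inter> {x. T k x \<le> t})) = (\<Sum>x\<in>A k. if T k x \<le> t then 1 else 0)"
      using A[of k] by (simp add: sum.If_cases Int_def)
    finally show ?thesis .
  qed
  ultimately show ?thesis by simp
qed

section \<open>A permutation central limit theorem\<close>

text \<open>The form that \<open>two_sample_stat\<close> takes when each estimator is replaced by
  the mean of the influence function over its block; \<open>u i\<close> is the value at position
  \<open>i\<close> of the pooled sample.\<close>

definition mean_contrast :: "nat \<Rightarrow> nat \<Rightarrow> (nat \<Rightarrow> real) \<Rightarrow> real" where
  "mean_contrast m n u = sqrt (real (m + n)) * ((\<Sum>i<m. u i) / real m - (\<Sum>j<n. u (m + j)) / real n)"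

text \<open>The total is invariant under permutation, so the second mean is determined by the first.
  The contrast becomes a multiple of a centred sum over the first \<open>m\<close> positions, the
  form treated by \<open>permutation_char_approx\<close>.\<close>

lemma mean_contrast_permuted:
  assumes mn: "0 < m" "0 < n" and \<pi>: "\<pi> permutes {..<m + n}"
  shows "mean_contrast m n (\<lambda>i. g (\<pi> i))
    = sqrt (real (m + n)) * real (m + n) / (real m * real n)
        * (\<Sum>i<m. g (\<pi> i) - (\<Sum>j<m + n. g j) / real (m + n))"
proof -
  define A B where "A = (\<Sum>i<m. g (\<pi> i))" and "B = (\<Sum>j<n. g (\<pi> (m + j)))"
  have "(\<Sum>j<m + n. g j) = (\<Sum>i<m + n. g (\<pi> i))" by (rule sum_permutes_total[OF \<pi>, symmetric])
  also have "\<dots> = A + B" unfolding A_def B_def by (induction n) (simp_all add: add.assoc)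
  finally have S: "(\<Sum>j<m + n. g j) = A + B" .
  have "A / real m - B / real n = real (m + n) / (real m * real n) * (A - real m * ((A + B) / real (m + n)))"
    using mn by (simp add: divide_simps) (simp add: algebra_simps)
  then show ?thesis
    unfolding mean_contrast_def S by (simp add: A_def B_def sum_subtractf)
qed

text \<open>Hajek's estimate for the centred scores \<open>c k\<close>, at the scale
  \<open>a k\<close> supplied by \<open>mean_contrast_permuted\<close>. The Bernoulli variance
  contributes x (1 - x) and the squared scale its inverse square, which leaves 1 / (p (1 - p)) in
  the limit.\<close>

lemma permutation_clt_char:
  fixes m n :: "nat \<Rightarrow> nat" and g :: "nat \<Rightarrow> nat \<Rightarrow> real" and b :: "nat \<Rightarrow> real" and p \<sigma>2 s :: real
  assumes N: "filterlim (\<lambda>k. m k + n k) at_top sequentially"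
    and p: "0 < p" "p < 1" and x: "(\<lambda>k. real (m k) / real (m k + n k)) \<longlonglongrightarrow> p"
    and g1: "(\<lambda>k. (\<Sum>j<m k + n k. g k j) / real (m k + n k)) \<longlonglongrightarrow> 0"
    and g2: "(\<lambda>k. (\<Sum>j<m k + n k. (g k j)\<^sup>2) / real (m k + n k)) \<longlonglongrightarrow> \<sigma>2"
    and gb: "\<And>k j. j < m k + n k \<Longrightarrow> \<bar>g k j\<bar> \<le> b k * sqrt (real (m k + n k))" and b: "b \<longlonglongrightarrow> 0"
  shows "(\<lambda>k. (\<Sum>\<pi> | \<pi> permutes {..<m k + n k}. iexp (s * mean_contrast (m k) (n k) (\<lambda>i. g k (\<pi> i))))
      / fact (m k + n k)) \<longlonglongrightarrow> of_real (exp (- (s\<^sup>2 * \<sigma>2 / (2 * (p * (1 - p))))))"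
proof -
  define N where "N k = m k + n k" for k
  define x where "x k = real (m k) / real (N k)" for k
  define \<mu> where "\<mu> k = (\<Sum>j<N k. g k j) / real (N k)" for k
  define S where "S k = (\<Sum>j<N k. (g k j)\<^sup>2) / real (N k)" for k
  define a where "a k = s * (sqrt (real (N k)) * real (N k) / (real (m k) * real (n k)))" for k
  define c where "c k j = g k j - \<mu> k" for k j
  \<comment> \<open>Closed form, valid for all large \<open>k\<close> by \<open>aV\<close>, of the
    squared scale times the centred sum of squares; it involves only quantities whose limits are
    known.\<close>
  define A where "A k = s\<^sup>2 * (S k - (\<mu> k)\<^sup>2) / (x k * (1 - x k))\<^sup>2" for k
  \<comment> \<open>The 2 pays for centring: the mean of the scores obeys the same bound as the
    scores themselves.\<close>
  define \<eta> where "\<eta> k = 2 * \<bar>s\<bar> * b k / (x k * (1 - x k))" for k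
  \<comment> \<open>The fourth root of \<open>N\<close> balances the two error terms of the
    coupling: with \<delta> = 1 / r they are 1 / r and A / (sqrt N / r) = A / r.\<close>
  define r where "r k = sqrt (sqrt (real (N k)))" for k
  define \<phi> where "\<phi> k = (\<Sum>\<pi> | \<pi> permutes {..<N k}. iexp (s * mean_contrast (m k) (n k) (\<lambda>i. g k (\<pi> i)))) / fact (N k)" for k
  have x_lim: "x \<longlonglongrightarrow> p" using x by (simp add: x_def[abs_def] N_def)
  have \<mu>_lim: "\<mu> \<longlonglongrightarrow> 0" using g1 by (simp add: \<mu>_def[abs_def] N_def)
  have S_lim: "S \<longlonglongrightarrow> \<sigma>2" using g2 by (simp add: S_def[abs_def] N_def)
  have pq: "p * (1 - p) \<noteq> 0" using p by simp
  have A_lim: "A \<longlonglongrightarrow> s\<^sup>2 * (\<sigma>2 - 0\<^sup>2) / (p * (1 - p))\<^sup>2"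
    unfolding A_def using pq by (intro tendsto_intros x_lim \<mu>_lim S_lim) simp
  have \<eta>_lim: "\<eta> \<longlonglongrightarrow> 2 * \<bar>s\<bar> * 0 / (p * (1 - p))"
    unfolding \<eta>_def using pq by (intro tendsto_intros x_lim b)
  have r_lim: "filterlim r at_top sequentially"
  proof -
    have "filterlim (\<lambda>k. real (N k)) at_top sequentially"
      unfolding N_def by (rule filterlim_compose[OF filterlim_real_sequentially N])
    then show ?thesis unfolding r_def by (intro filterlim_compose[OF sqrt_at_top])
  qed
  then have r_inv: "(\<lambda>k. 1 / r k) \<longlonglongrightarrow> 0"
    by (simp add: tendsto_inverse_0_at_top flip: inverse_eq_divide)
  have e_lim: "(\<lambda>k. complex_of_real (exp (- (x k * (1 - x k) * A k / 2))))
      \<longlonglongrightarrow> of_real (exp (- (p * (1 - p) * (s\<^sup>2 * (\<sigma>2 - 0\<^sup>2) / (p * (1 - p))\<^sup>2) / 2)))"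
    by (intro tendsto_intros x_lim A_lim) simp
  have err_lim: "(\<lambda>k. \<eta> k * A k + (1 / r k + A k * (1 / r k))) \<longlonglongrightarrow> 0"
    using tendsto_add[OF tendsto_mult[OF \<eta>_lim A_lim] tendsto_add[OF r_inv tendsto_mult[OF A_lim r_inv]]] by simp
  have ev: "eventually (\<lambda>k. cmod (\<phi> k - of_real (exp (- (x k * (1 - x k) * A k / 2))))
      \<le> \<eta> k * A k + (1 / r k + A k * (1 / r k))) sequentially"
    using order_tendstoD(1)[OF x_lim p(1)] order_tendstoD(2)[OF x_lim p(2)]
      order_tendstoD(2)[OF \<eta>_lim, of 1, simplified] filterlim_at_top_dense[THEN iffD1, OF r_lim, rule_format, of 0]
  proof eventually_elim
    case (elim k)
    then have mN: "0 < m k" "m k < N k"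
      by (auto simp: x_def divide_simps zero_less_divide_iff split: if_splits)
    then have n: "0 < n k" "real (n k) = real (N k) - real (m k)" by (auto simp: N_def)
    have Npos: "real (N k) > 0" using mN by simp
    have m_eq: "real (m k) = real (N k) * x k" using Npos by (simp add: x_def)
    then have n_eq: "real (n k) = real (N k) * (1 - x k)" unfolding n(2) by (simp add: algebra_simps)
    define R where "R = sqrt (real (N k))"
    have R: "R > 0" "real (N k) = R * R" using Npos by (auto simp: R_def)
    have a_eq: "a k = s / (R * (x k * (1 - x k)))"
      using elim R(1) unfolding a_def n_eq m_eq R_def[symmetric] R(2) by (simp add: divide_simps)
    have c0: "(\<Sum>j<N k. c k j) = 0" using Npos by (simp add: c_def \<mu>_def sum_subtractf)
    have V: "(\<Sum>j<N k. (c k j)\<^sup>2) = real (N k) * (S k - (\<mu> k)\<^sup>2)"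
    proof -
      have "(\<Sum>j<N k. (c k j)\<^sup>2) = (\<Sum>j<N k. (g k j)\<^sup>2) - 2 * \<mu> k * (\<Sum>j<N k. g k j) + real (N k) * (\<mu> k)\<^sup>2"
        by (simp add: c_def power2_diff sum.distrib sum_subtractf sum_distrib_left ac_simps)
      also have "(\<Sum>j<N k. (g k j)\<^sup>2) = real (N k) * S k" using Npos by (simp add: S_def)
      also have "(\<Sum>j<N k. g k j) = real (N k) * \<mu> k" using Npos by (simp add: \<mu>_def)
      finally show ?thesis by (simp add: algebra_simps power2_eq_square)
    qed
    have aV: "(a k)\<^sup>2 * (\<Sum>j<N k. (c k j)\<^sup>2) = A k"
      unfolding a_eq V A_def R(2) using R elim by (simp add: power_divide power_mult_distrib power2_eq_square mult.assoc)
    have bound: "\<bar>a k * c k j\<bar> \<le> \<eta> k" if "j < N k" for j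
    proof -
      have g: "\<bar>g k i\<bar> \<le> b k * R" if "i < N k" for i using gb[of i k] that by (simp add: N_def R_def)
      have "\<bar>\<mu> k\<bar> \<le> (\<Sum>i<N k. b k * R) / real (N k)"
        unfolding \<mu>_def abs_divide abs_of_nat
        by (intro divide_right_mono order_trans[OF sum_abs] sum_mono g) auto
      also have "\<dots> = b k * R" using Npos by simp
      finally have "\<bar>c k j\<bar> \<le> 2 * (b k * R)" using g[OF that] unfolding c_def by linarith
      then have "\<bar>a k\<bar> * \<bar>c k j\<bar> \<le> \<bar>a k\<bar> * (2 * (b k * R))" by (rule mult_left_mono) simp
      also have "\<dots> = \<eta> k"
        unfolding a_eq \<eta>_def using R elim by (simp add: abs_mult)
      finally show ?thesis by (simp add: abs_mult)
    qed
    have rr: "sqrt (real (N k)) * (1 / r k) = r k"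
      using elim by (simp add: r_def real_div_sqrt)
    have "\<phi> k = (\<Sum>\<pi> | \<pi> permutes {..<N k}. iexp (a k * (\<Sum>i<m k. c k (\<pi> i)))) / fact (N k)"
      unfolding \<phi>_def
    proof (intro arg_cong2[where f = "(/)"] sum.cong refl)
      fix \<pi> assume "\<pi> \<in> {\<pi>. \<pi> permutes {..<N k}}"
      then have "\<pi> permutes {..<m k + n k}" by (simp add: N_def)
      from mean_contrast_permuted[OF mN(1) n(1) this, of "g k"]
      show "iexp (s * mean_contrast (m k) (n k) (\<lambda>i. g k (\<pi> i))) = iexp (a k * (\<Sum>i<m k. c k (\<pi> i)))"
        unfolding a_def c_def \<mu>_def N_def by (simp only: mult.assoc)
    qed
    then have "cmod (\<phi> k - of_real (exp (- (x k * (1 - x k) * (a k)\<^sup>2 * (\<Sum>j<N k. (c k j)\<^sup>2) / 2))))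
        \<le> \<eta> k * (a k)\<^sup>2 * (\<Sum>j<N k. (c k j)\<^sup>2) + (1 / r k + (a k)\<^sup>2 * (\<Sum>j<N k. (c k j)\<^sup>2) / (sqrt (real (N k)) * (1 / r k)))"
      unfolding x_def using elim by (simp only:) (intro permutation_char_approx[OF mN c0 bound], auto)

    note this[unfolded mult.assoc aV rr]
    then show ?case by (simp add: mult.assoc)
  qed
  have "(\<lambda>k. \<phi> k - of_real (exp (- (x k * (1 - x k) * A k / 2)))) \<longlonglongrightarrow> 0"
    by (rule Lim_null_comparison[OF ev err_lim])
  from tendsto_add[OF this e_lim]
  have "\<phi> \<longlonglongrightarrow> of_real (exp (- (p * (1 - p) * (s\<^sup>2 * (\<sigma>2 - 0\<^sup>2) / (p * (1 - p))\<^sup>2) / 2)))" by simp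
  moreover have "w * (s\<^sup>2 * (\<sigma>2 - 0\<^sup>2) / w\<^sup>2) / 2 = s\<^sup>2 * \<sigma>2 / (2 * w)" if "w \<noteq> 0" for w
    using that by (simp add: power2_eq_square field_simps)
  note this[OF pq]
  ultimately show ?thesis unfolding \<phi>_def[abs_def] N_def by (simp only:)
qed

lemma iexp_diff_le: "cmod (iexp y - iexp z) \<le> min 2 \<bar>y - z\<bar>"
proof -
  have "cmod (iexp y - iexp z) = cmod (iexp z * (iexp (y - z) - 1))"
    by (simp add: algebra_simps flip: exp_add)
  also have "\<dots> = cmod (iexp (y - z) - 1)" by (simp add: norm_mult)
  also have "\<dots> \<le> min 2 \<bar>y - z\<bar>"
    using iexp_approx1[of "y - z" 0] iexp_approx2[of "y - z" 0] by simp
  finally show ?thesis .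
qed

text \<open>The limit theorem as an inequality for a single data set. Were there no such \<delta>,
  counterexamples for the tolerances 1 / (k + 1) would form an array contradicting
  \<open>permutation_clt_char\<close>. The actual statistic \<open>T\<close> need only be close to
  the contrast in the mean of a truncated difference, since this already forces their characteristic
  functions together.\<close>

lemma permutation_clt_uniform:
  fixes p \<sigma>2 \<epsilon> :: real
  assumes p: "0 < p" "p < 1" and \<sigma>2: "\<sigma>2 > 0" and \<epsilon>: "\<epsilon> > 0"
  obtains \<delta> where "\<delta> > 0" and
    "\<And>m n g T t. \<lbrakk>1 / \<delta> < real (m + n); \<bar>real m / real (m + n) - p\<bar> < \<delta>;
      \<bar>(\<Sum>j<m + n. g j) / real (m + n)\<bar> < \<delta>; \<bar>(\<Sum>j<m + n. (g j)\<^sup>2) / real (m + n) - \<sigma>2\<bar> < \<delta>;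
      \<And>j. j < m + n \<Longrightarrow> \<bar>g j\<bar> \<le> \<delta> * sqrt (real (m + n));
      (\<Sum>\<pi> | \<pi> permutes {..<m + n}. min 1 \<bar>T \<pi> - mean_contrast m n (\<lambda>i. g (\<pi> i))\<bar>) / fact (m + n) < \<delta>\<rbrakk>
      \<Longrightarrow> \<bar>(\<Sum>\<pi> | \<pi> permutes {..<m + n}. if T \<pi> \<le> t then 1 else 0) / fact (m + n)
          - cdf std_normal_distribution (t / sqrt (1 / (p * (1 - p)) * \<sigma>2))\<bar> \<le> \<epsilon>"
proof -
  define \<tau> where "\<tau> = sqrt (1 / (p * (1 - p)) * \<sigma>2)"
  have \<tau>: "\<tau> > 0" "\<tau>\<^sup>2 = \<sigma>2 / (p * (1 - p))" using p \<sigma>2 by (auto simp: \<tau>_def)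
  define H where "H \<delta> m n g T \<longleftrightarrow> 1 / \<delta> < real (m + n) \<and> \<bar>real m / real (m + n) - p\<bar> < \<delta> \<and>
      \<bar>(\<Sum>j<m + n. g j) / real (m + n)\<bar> < \<delta> \<and> \<bar>(\<Sum>j<m + n. (g j)\<^sup>2) / real (m + n) - \<sigma>2\<bar> < \<delta> \<and>
      (\<forall>j<m + n. \<bar>g j\<bar> \<le> \<delta> * sqrt (real (m + n))) \<and>
      (\<Sum>\<pi> | \<pi> permutes {..<m + n}. min 1 \<bar>T \<pi> - mean_contrast m n (\<lambda>i. g (\<pi> i))\<bar>) / fact (m + n) < \<delta>"
    for \<delta> m n g T
  define E where "E m n T t = \<bar>(\<Sum>\<pi> | \<pi> permutes {..<m + n}. if T \<pi> \<le> t then 1 else 0) / fact (m + n)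
          - cdf std_normal_distribution (t / \<tau>)\<bar>" for m n :: nat and T :: "(nat \<Rightarrow> nat) \<Rightarrow> real" and t
  have "\<exists>\<delta>>0. \<forall>m n g T t. H \<delta> m n g T \<longrightarrow> E m n T t \<le> \<epsilon>"
  proof (rule ccontr)
    assume neg: "\<not> ?thesis"
    \<comment> \<open>The tolerance of the \<open>k\<close>-th counterexample; it also serves as the
      null sequence \<open>b\<close> of \<open>permutation_clt_char\<close>.\<close>
    define d where "d k = 1 / real (Suc k)" for k
    have "\<exists>m n g T t. H (d k) m n g T \<and> \<not> E m n T t \<le> \<epsilon>" for k
      using neg[simplified, rule_format, of "d k"] by (simp add: d_def not_le)
    then obtain m n g T t where H: "\<And>k. H (d k) (m k) (n k) (g k) (T k)"
      and E: "\<And>k. \<not> E (m k) (n k) (T k) (t k) \<le> \<epsilon>" by metis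
    have d_lim: "d \<longlonglongrightarrow> 0" unfolding d_def by (rule LIMSEQ_Suc[OF lim_1_over_n])
    have dnull: "u \<longlonglongrightarrow> l" if "\<And>k. \<bar>u k - l\<bar> < d k" for u :: "nat \<Rightarrow> real" and l
    proof -
      have "(\<lambda>k. u k - l) \<longlonglongrightarrow> 0"
        by (rule Lim_null_comparison[OF _ d_lim]) (use that in \<open>auto intro!: always_eventually less_imp_le\<close>)
      then show ?thesis by (simp add: LIM_zero_iff)
    qed
    define A where "A k = {\<pi>. \<pi> permutes {..<m k + n k}}" for k
    have cardA: "card (A k) = fact (m k + n k)" for k by (simp add: A_def card_permutations)
    have A: "finite (A k)" "A k \<noteq> {}" for k using cardA[of k] by (auto simp: card_eq_0_iff intro: card_ge_0_finite)
    define L where "L k \<pi> = mean_contrast (m k) (n k) (\<lambda>i. g k (\<pi> i))" for k \<pi>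
    define D where "D k = (\<Sum>\<pi>\<in>A k. min 1 \<bar>T k \<pi> - L k \<pi>\<bar>) / fact (m k + n k)" for k
    have D_lim: "D \<longlonglongrightarrow> 0"
    proof (rule dnull)
      fix k
      have "D k \<ge> 0" unfolding D_def by (intro divide_nonneg_nonneg sum_nonneg) auto
      moreover have "D k < d k" using H[of k] by (simp add: H_def D_def A_def L_def)
      ultimately show "\<bar>D k - 0\<bar> < d k" by simp
    qed
    have N_lim: "filterlim (\<lambda>k. m k + n k) at_top sequentially"
    proof (rule filterlim_at_top_mono[OF filterlim_Suc])
      have "real (Suc k) < real (m k + n k)" for k using H[of k] by (simp add: H_def d_def)
      then show "eventually (\<lambda>k. Suc k \<le> m k + n k) sequentially"
        by (intro always_eventually allI) (metis of_nat_less_iff less_imp_le)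
    qed
    have L_lim: "(\<lambda>k. (\<Sum>\<pi>\<in>A k. iexp (s * L k \<pi>)) / fact (m k + n k))
        \<longlonglongrightarrow> of_real (exp (- (s\<^sup>2 * \<sigma>2 / (2 * (p * (1 - p))))))" for s
      unfolding A_def L_def
      using H by (intro permutation_clt_char[where b = d] N_lim p d_lim dnull) (auto simp: H_def)
    have "(\<lambda>k. (\<Sum>\<pi>\<in>A k. iexp (s * (T k \<pi> / \<tau>))) / card (A k)) \<longlonglongrightarrow> of_real (exp (- s\<^sup>2 / 2))" for s
    proof -
      define u where "u = s / \<tau>"
      have le: "cmod ((\<Sum>\<pi>\<in>A k. iexp (u * T k \<pi>)) / fact (m k + n k) - (\<Sum>\<pi>\<in>A k. iexp (u * L k \<pi>)) / fact (m k + n k))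
          \<le> (2 + \<bar>u\<bar>) * D k" for k
      proof -
        have "cmod ((\<Sum>\<pi>\<in>A k. iexp (u * T k \<pi>)) / fact (m k + n k) - (\<Sum>\<pi>\<in>A k. iexp (u * L k \<pi>)) / fact (m k + n k))
            = cmod (\<Sum>\<pi>\<in>A k. iexp (u * T k \<pi>) - iexp (u * L k \<pi>)) / fact (m k + n k)"
          by (simp add: diff_divide_distrib[symmetric] sum_subtractf norm_divide)
        also have "\<dots> \<le> (\<Sum>\<pi>\<in>A k. (2 + \<bar>u\<bar>) * min 1 \<bar>T k \<pi> - L k \<pi>\<bar>) / fact (m k + n k)"
        proof (intro divide_right_mono sum_norm_le)
          fix \<pi>
          define y where "y = \<bar>T k \<pi> - L k \<pi>\<bar>"
          have "cmod (iexp (u * T k \<pi>) - iexp (u * L k \<pi>)) \<le> min 2 \<bar>u * T k \<pi> - u * L k \<pi>\<bar>"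
            by (rule iexp_diff_le)
          also have "\<bar>u * T k \<pi> - u * L k \<pi>\<bar> = \<bar>u\<bar> * y" by (simp add: y_def right_diff_distrib[symmetric] abs_mult)
          also have "min 2 (\<bar>u\<bar> * y) \<le> (2 + \<bar>u\<bar>) * min 1 y"
          proof (cases "y \<le> 1")
            case True
            then show ?thesis by (auto simp: y_def min_le_iff_disj distrib_right)
          qed auto
          finally show "cmod (iexp (u * T k \<pi>) - iexp (u * L k \<pi>)) \<le> (2 + \<bar>u\<bar>) * min 1 \<bar>T k \<pi> - L k \<pi>\<bar>"
            by (simp add: y_def)
        qed simp
        also have "\<dots> = (2 + \<bar>u\<bar>) * D k" by (simp add: D_def sum_distrib_left[symmetric])
        finally show ?thesis .
      qed
      have "(\<lambda>k. (\<Sum>\<pi>\<in>A k. iexp (u * T k \<pi>)) / fact (m k + n k) - (\<Sum>\<pi>\<in>A k. iexp (u * L k \<pi>)) / fact (m k + n k)) \<longlonglongrightarrow> 0"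
        by (rule Lim_null_comparison[OF always_eventually, OF allI, OF le]) (use tendsto_mult_right_zero[OF D_lim] in simp)
      from tendsto_add[OF this L_lim[of u]]
      have lim: "(\<lambda>k. (\<Sum>\<pi>\<in>A k. iexp (u * T k \<pi>)) / fact (m k + n k)) \<longlonglongrightarrow> of_real (exp (- (u\<^sup>2 * \<sigma>2 / (2 * (p * (1 - p))))))"
        by simp
      have "u\<^sup>2 * \<sigma>2 / (2 * (p * (1 - p))) = s\<^sup>2 / 2"
        using p \<sigma>2 by (simp add: u_def power_divide \<tau>(2))
      from lim[unfolded this] show ?thesis by (simp add: u_def cardA)
    qed
    from finite_average_clt[OF A this \<epsilon>]
    have "eventually (\<lambda>k. \<forall>t. \<bar>(\<Sum>\<pi>\<in>A k. if T k \<pi> / \<tau> \<le> t then 1 else 0) / card (A k)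
        - cdf std_normal_distribution t\<bar> \<le> \<epsilon>) sequentially" .
    then obtain k where "\<forall>t. \<bar>(\<Sum>\<pi>\<in>A k. if T k \<pi> / \<tau> \<le> t then 1 else 0) / card (A k)
        - cdf std_normal_distribution t\<bar> \<le> \<epsilon>" by (auto simp: eventually_sequentially)
    \<comment> \<open>The offending point \<open>t k\<close> moves with \<open>k\<close>, so
      pointwise convergence of the distribution functions would not yield the contradiction.\<close>
    from this[rule_format, of "t k / \<tau>"] have "E (m k) (n k) (T k) (t k) \<le> \<epsilon>"
      using \<tau>(1) by (simp add: E_def A_def card_permutations divide_le_cancel)
    then show False using E by blast
  qed
  then obtain \<delta> where "\<delta> > 0" and *: "\<And>m n g T t. H \<delta> m n g T \<Longrightarrow> E m n T t \<le> \<epsilon>" by blast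
  have "E m n T t \<le> \<epsilon>"
    if "1 / \<delta> < real (m + n)" "\<bar>real m / real (m + n) - p\<bar> < \<delta>"
      "\<bar>(\<Sum>j<m + n. g j) / real (m + n)\<bar> < \<delta>" "\<bar>(\<Sum>j<m + n. (g j)\<^sup>2) / real (m + n) - \<sigma>2\<bar> < \<delta>"
      "\<And>j. j < m + n \<Longrightarrow> \<bar>g j\<bar> \<le> \<delta> * sqrt (real (m + n))"
      "(\<Sum>\<pi> | \<pi> permutes {..<m + n}. min 1 \<bar>T \<pi> - mean_contrast m n (\<lambda>i. g (\<pi> i))\<bar>) / fact (m + n) < \<delta>"
    for m n g T t
    by (rule *[of m n g]) (use that in \<open>simp add: H_def\<close>)
  then show ?thesis
    unfolding E_def \<tau>_def by (rule that[OF \<open>\<delta> > 0\<close>])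
qed

section \<open>Domination of the permuted sample\<close>

lemma prob_space_mixture:
  assumes "prob_space P" "prob_space Q" and Q: "sets Q = sets P" and p: "0 \<le> p" "p \<le> 1"
  shows "prob_space (mixture p P Q)"
proof
  have "space Q = space P" using Q by (rule sets_eq_imp_space_eq)
  then show "emeasure (mixture p P Q) (space (mixture p P Q)) = 1"
    using prob_space.emeasure_space_1[OF assms(1)] prob_space.emeasure_space_1[OF assms(2)] p
    by (simp add: emeasure_mixture[OF Q] flip: ennreal_plus)
qed

lemma nn_integral_mixture:
  assumes Q: "sets Q = sets P" and f: "f \<in> borel_measurable P"
  shows "(\<integral>\<^sup>+x. f x \<partial>mixture p P Q) = ennreal p * (\<integral>\<^sup>+x. f x \<partial>P) + ennreal (1 - p) * (\<integral>\<^sup>+x. f x \<partial>Q)"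
  using f
proof (induction rule: borel_measurable_induct)
  case (cong f g)
  have "space Q = space P" using Q by (rule sets_eq_imp_space_eq)
  then have "(\<integral>\<^sup>+x. f x \<partial>mixture p P Q) = (\<integral>\<^sup>+x. g x \<partial>mixture p P Q)" "(\<integral>\<^sup>+x. f x \<partial>P) = (\<integral>\<^sup>+x. g x \<partial>P)"
    "(\<integral>\<^sup>+x. f x \<partial>Q) = (\<integral>\<^sup>+x. g x \<partial>Q)"
    using cong(3) by (auto intro!: nn_integral_cong)
  then show ?case using cong(4) by simp
next
  case (set A)
  then show ?case using Q by (simp add: emeasure_mixture)
next
  case (mult u c)
  note [measurable] = mult(2)
  have [measurable]: "u \<in> borel_measurable Q" using mult(2) measurable_cong_sets[OF Q refl] by blast
  show ?case using mult(4) by (simp add: nn_integral_cmult distrib_left ac_simps)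
next
  case (add u v)
  note [measurable] = add.hyps(1,3)
  have [measurable]: "u \<in> borel_measurable Q" "v \<in> borel_measurable Q"
    using add.hyps(1,3) by (simp_all add: measurable_cong_sets[OF Q refl])
  show ?case by (simp add: nn_integral_add add.IH distrib_left ac_simps)
next
  case (seq U)
  note [measurable] = seq(1)
  have UQ[measurable]: "U i \<in> borel_measurable Q" for i using seq(1) by (simp add: measurable_cong_sets[OF Q refl])
  have eq: "(\<integral>\<^sup>+x. (SUP i. U i) x \<partial>R) = (SUP i. \<integral>\<^sup>+x. U i x \<partial>R)" if "\<And>i. U i \<in> borel_measurable R" for R
    using that seq.hyps(3) by (simp add: image_comp nn_integral_monotone_convergence_SUP)
  have inc: "incseq (\<lambda>i. ennreal a * \<integral>\<^sup>+x. U i x \<partial>R)" for a R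
    using seq.hyps(3) by (auto simp: incseq_def le_fun_def intro!: mult_left_mono nn_integral_mono)
  have "(\<integral>\<^sup>+x. (SUP i. U i) x \<partial>mixture p P Q) = (SUP i. \<integral>\<^sup>+x. U i x \<partial>mixture p P Q)" by (rule eq) simp
  also have "\<dots> = (SUP i. ennreal p * (\<integral>\<^sup>+x. U i x \<partial>P) + ennreal (1 - p) * (\<integral>\<^sup>+x. U i x \<partial>Q))"
    using seq.IH by simp
  also have "\<dots> = (SUP i. ennreal p * (\<integral>\<^sup>+x. U i x \<partial>P)) + (SUP i. ennreal (1 - p) * (\<integral>\<^sup>+x. U i x \<partial>Q))"
    by (rule ennreal_SUP_add[OF inc inc])
  also have "\<dots> = ennreal p * (\<integral>\<^sup>+x. (SUP i. U i) x \<partial>P) + ennreal (1 - p) * (\<integral>\<^sup>+x. (SUP i. U i) x \<partial>Q)"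
    by (subst (1 2) eq) (simp_all only: SUP_mult_left_ennreal seq.hyps(1) UQ)
  finally show ?case .
qed

text \<open>Sampling from the mixture amounts to tossing a \<open>p\<close>-coin for each coordinate
  and then drawing from \<open>P\<close> or \<open>Q\<close>; \<open>A\<close> collects the heads.
  The induction generalizes over \<open>h\<close>, because its hypothesis is applied to
  \<open>p * a + (1 - p) * b\<close>, what remains after integrating out the new coordinate; the
  terms \<open>a\<close> and \<open>b\<close> yield the subsets with and without it.\<close>

lemma nn_integral_PiM_mixture:
  fixes P Q :: "'a measure" and I :: "'i set"
  assumes P: "prob_space P" and Q: "prob_space Q" and sets: "sets Q = sets P" and p: "0 \<le> p" "p \<le> 1"
    and I: "finite I" and h: "h \<in> borel_measurable (\<Pi>\<^sub>M i\<in>I. P)"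
  shows "(\<integral>\<^sup>+x. h x \<partial>(\<Pi>\<^sub>M i\<in>I. mixture p P Q))
    = (\<Sum>A\<in>Pow I. ennreal (p ^ card A * (1 - p) ^ (card I - card A))
        * (\<integral>\<^sup>+x. h x \<partial>(\<Pi>\<^sub>M i\<in>I. if i \<in> A then P else Q)))"
  using I h
proof (induction I arbitrary: h rule: finite_induct)
  case empty
  then show ?case by (simp add: PiM_empty)
next
  case (insert i I)
  define R where "R A = (\<lambda>i::'i. if i \<in> A then P else Q)" for A
  interpret P: prob_space P by (rule P)
  interpret Q: prob_space Q by (rule Q)
  interpret mix: prob_space "mixture p P Q" by (rule prob_space_mixture[OF P Q sets p])
  have psf: "product_sigma_finite (R A)" for A
    unfolding product_sigma_finite_def R_def by (auto intro: P.sigma_finite_measure_axioms Q.sigma_finite_measure_axioms)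
  have psf_mix: "product_sigma_finite (\<lambda>_. mixture p P Q)"
    unfolding product_sigma_finite_def by (auto intro: mix.sigma_finite_measure_axioms)
  have sets_R: "sets (PiM J (R A)) = sets (\<Pi>\<^sub>M i\<in>J. P)" for A J
    by (intro sets_PiM_cong) (auto simp: R_def sets)
  have sets_mix: "sets (\<Pi>\<^sub>M i\<in>J. mixture p P Q) = sets (\<Pi>\<^sub>M i\<in>J. P)" for J :: "'i set"
    by (intro sets_PiM_cong) auto
  note [measurable] = insert.prems
  define a where "a x = (\<integral>\<^sup>+y. h (x(i := y)) \<partial>P)" for x
  define b where "b x = (\<integral>\<^sup>+y. h (x(i := y)) \<partial>Q)" for x
  have [measurable]: "a \<in> borel_measurable (\<Pi>\<^sub>M i\<in>I. P)" unfolding a_def by measurable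
  have [measurable_cong]: "sets Q = sets P" by (rule sets)
  have [measurable]: "b \<in> borel_measurable (\<Pi>\<^sub>M i\<in>I. P)" unfolding b_def by measurable
  have hR: "h \<in> borel_measurable (PiM (insert i I) (R A))" for A
    using insert.prems measurable_cong_sets[OF sets_R refl] by blast
  have a_int: "(\<integral>\<^sup>+x. a x \<partial>PiM I (R A)) = (\<integral>\<^sup>+x. h x \<partial>PiM (insert i I) (R (insert i A)))" for A
  proof -
    have "PiM I (R (insert i A)) = PiM I (R A)"
      using insert.hyps by (intro PiM_cong) (auto simp: R_def)
    moreover have "R (insert i A) i = P" by (simp add: R_def)
    ultimately show ?thesis
      using product_sigma_finite.product_nn_integral_insert[OF psf insert.hyps hR, of "insert i A"]
      by (simp add: a_def)
  qed
  have b_int: "(\<integral>\<^sup>+x. b x \<partial>PiM I (R A)) = (\<integral>\<^sup>+x. h x \<partial>PiM (insert i I) (R A))" if "A \<subseteq> I" for A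
  proof -
    have "R A i = Q" using that insert.hyps by (auto simp: R_def)
    then show ?thesis
      using product_sigma_finite.product_nn_integral_insert[OF psf insert.hyps hR, of A]
      by (simp add: b_def)
  qed
  have "(\<integral>\<^sup>+x. h x \<partial>(\<Pi>\<^sub>M i\<in>insert i I. mixture p P Q))
      = (\<integral>\<^sup>+x. \<integral>\<^sup>+y. h (x(i := y)) \<partial>mixture p P Q \<partial>(\<Pi>\<^sub>M i\<in>I. mixture p P Q))"
    using insert.prems by (intro product_sigma_finite.product_nn_integral_insert[OF psf_mix insert.hyps])
      (simp cong: measurable_cong_sets add: measurable_cong_sets[OF sets_mix refl])
  also have "\<dots> = (\<integral>\<^sup>+x. ennreal p * a x + ennreal (1 - p) * b x \<partial>(\<Pi>\<^sub>M i\<in>I. mixture p P Q))"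
  proof (rule nn_integral_cong)
    fix x assume "x \<in> space (\<Pi>\<^sub>M i\<in>I. mixture p P Q)"
    then have [measurable]: "x \<in> space (\<Pi>\<^sub>M i\<in>I. P)" by (simp add: space_PiM)
    have "(\<lambda>y. h (x(i := y))) \<in> borel_measurable P" by measurable
    then show "(\<integral>\<^sup>+y. h (x(i := y)) \<partial>mixture p P Q) = ennreal p * a x + ennreal (1 - p) * b x"
      unfolding a_def b_def by (rule nn_integral_mixture[OF sets])
  qed
  also have "\<dots> = (\<Sum>A\<in>Pow I. ennreal (p ^ card A * (1 - p) ^ (card I - card A))
      * (\<integral>\<^sup>+x. ennreal p * a x + ennreal (1 - p) * b x \<partial>PiM I (R A)))"
    unfolding R_def by (rule insert.IH) measurable
  also have "\<dots> = (\<Sum>A\<in>Pow I.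
        ennreal (p ^ card A * (1 - p) ^ (card (insert i I) - card A)) * (\<integral>\<^sup>+x. h x \<partial>PiM (insert i I) (R A))
      + ennreal (p ^ card (insert i A) * (1 - p) ^ (card (insert i I) - card (insert i A)))
        * (\<integral>\<^sup>+x. h x \<partial>PiM (insert i I) (R (insert i A))))"
  proof (rule sum.cong[OF refl])
    fix A assume "A \<in> Pow I"
    then have A: "A \<subseteq> I" "finite A" "i \<notin> A" "card A \<le> card I"
      using insert.hyps by (auto intro: finite_subset card_mono)
    have m: "a \<in> borel_measurable (PiM I (R A))" "b \<in> borel_measurable (PiM I (R A))"
      using measurable_cong_sets[OF sets_R[of I A] refl] \<open>a \<in> _\<close> \<open>b \<in> _\<close> by blast+
    have "(\<integral>\<^sup>+x. ennreal p * a x + ennreal (1 - p) * b x \<partial>PiM I (R A))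
        = ennreal p * (\<integral>\<^sup>+x. h x \<partial>PiM (insert i I) (R (insert i A))) + ennreal (1 - p) * (\<integral>\<^sup>+x. h x \<partial>PiM (insert i I) (R A))"
      using m by (simp add: nn_integral_add nn_integral_cmult a_int b_int[OF A(1)])
    moreover have "ennreal (p ^ card A * (1 - p) ^ (card I - card A)) * ennreal p
        = ennreal (p ^ card (insert i A) * (1 - p) ^ (card (insert i I) - card (insert i A)))"
      using A insert.hyps p by (simp add: ennreal_mult[symmetric] ac_simps)
    moreover have "ennreal (p ^ card A * (1 - p) ^ (card I - card A)) * ennreal (1 - p)
        = ennreal (p ^ card A * (1 - p) ^ (card (insert i I) - card A))"
      using A insert.hyps p by (simp add: ennreal_mult[symmetric] Suc_diff_le ac_simps)
    ultimately show "ennreal (p ^ card A * (1 - p) ^ (card I - card A))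
          * (\<integral>\<^sup>+x. ennreal p * a x + ennreal (1 - p) * b x \<partial>PiM I (R A))
        = ennreal (p ^ card A * (1 - p) ^ (card (insert i I) - card A)) * (\<integral>\<^sup>+x. h x \<partial>PiM (insert i I) (R A))
          + ennreal (p ^ card (insert i A) * (1 - p) ^ (card (insert i I) - card (insert i A)))
            * (\<integral>\<^sup>+x. h x \<partial>PiM (insert i I) (R (insert i A)))"
      by (simp only: distrib_left mult.assoc[symmetric]) (rule add.commute)
  qed
  also have "\<dots> = (\<Sum>A\<in>Pow (insert i I). ennreal (p ^ card A * (1 - p) ^ (card (insert i I) - card A))
      * (\<integral>\<^sup>+x. h x \<partial>PiM (insert i I) (R A)))"
  proof -
    have inj: "inj_on (insert i) (Pow I)" using insert.hyps by (auto simp: inj_on_def)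
    have "Pow I \<inter> insert i ` Pow I = {}" using insert.hyps by auto
    then show ?thesis
      unfolding Pow_insert sum.distrib using insert.hyps
      by (subst sum.union_disjoint) (auto simp: sum.reindex[OF inj])
  qed
  finally show ?case unfolding R_def .
qed

text \<open>Serves three reindexings: a block of a permuted sample, either sample within the joint
  family, and the pooled sample.\<close>

lemma (in prob_space) indep_vars_reindex_inj:
  assumes e: "inj_on e J" and ind: "indep_vars M' X (e ` J)"
  shows "indep_vars (\<lambda>i. M' (e i)) (\<lambda>i. X (e i)) J"
  unfolding indep_vars_def2 indep_sets_def
proof (intro conjI ballI allI impI)
  fix j assume "j \<in> J"
  then show "random_variable (M' (e j)) (X (e j))" using ind by (auto simp: indep_vars_def2)
next
  fix j assume "j \<in> J"
  then show "{X (e j) -` A \<inter> space M |A. A \<in> sets (M' (e j))} \<subseteq> events"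
    using ind by (auto simp: indep_vars_def2)
next
  fix K A assume K: "K \<subseteq> J" "K \<noteq> {}" "finite K" and A: "A \<in> (\<Pi> i\<in>K. {X (e i) -` A \<inter> space M |A. A \<in> sets (M' (e i))})"
  have eK: "inj_on e K" using e K(1) by (rule inj_on_subset)
  define B where "B = A \<circ> inv_into K e"
  have B: "B (e i) = A i" if "i \<in> K" for i using eK that by (simp add: B_def)
  have "prob (\<Inter>j\<in>e ` K. B j) = (\<Prod>j\<in>e ` K. prob (B j))"
    using ind K A by (intro indep_setsD[of "\<lambda>i. {X i -` A \<inter> space M |A. A \<in> sets (M' i)}" "e ` J"])
      (auto simp: indep_vars_def2 B Pi_iff)
  then show "prob (\<Inter>j\<in>K. A j) = (\<Prod>j\<in>K. prob (A j))"
    using eK B by (simp add: prod.reindex)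
qed

lemma (in prob_space) nn_integral_permuted_sample:
  assumes W: "indep_vars (\<lambda>_. S) W {..<N}" and dist: "\<And>i. i < N \<Longrightarrow> distr M S (W i) = R i"
    and e: "inj_on e {..<r}" "e ` {..<r} \<subseteq> {..<N}" and r: "r > 0"
    and h: "h \<in> borel_measurable (\<Pi>\<^sub>M i\<in>{..<r}. S)"
  shows "(\<integral>\<^sup>+\<omega>. h (\<lambda>i\<in>{..<r}. W (e i) \<omega>) \<partial>M) = (\<integral>\<^sup>+x. h x \<partial>(\<Pi>\<^sub>M i\<in>{..<r}. R (e i)))"
proof -
  have ind: "indep_vars (\<lambda>_. S) (\<lambda>i. W (e i)) {..<r}"
    using indep_vars_reindex_inj[OF e(1) indep_vars_subset[OF W e(2)]] .
  have rv: "W (e i) \<in> measurable M S" if "i \<in> {..<r}" for i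
    using ind that by (auto simp: indep_vars_def2)
  have [measurable]: "(\<lambda>\<omega>. \<lambda>i\<in>{..<r}. W (e i) \<omega>) \<in> measurable M (\<Pi>\<^sub>M i\<in>{..<r}. S)"
    using rv by (intro measurable_restrict) auto
  have "(\<integral>\<^sup>+\<omega>. h (\<lambda>i\<in>{..<r}. W (e i) \<omega>) \<partial>M)
      = (\<integral>\<^sup>+x. h x \<partial>distr M (\<Pi>\<^sub>M i\<in>{..<r}. S) (\<lambda>\<omega>. \<lambda>i\<in>{..<r}. W (e i) \<omega>))"
    using h by (subst nn_integral_distr) auto
  also have "distr M (\<Pi>\<^sub>M i\<in>{..<r}. S) (\<lambda>\<omega>. \<lambda>i\<in>{..<r}. W (e i) \<omega>) = (\<Pi>\<^sub>M i\<in>{..<r}. distr M S (W (e i)))"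
    by (rule indep_vars_iff_distr_eq_PiM'[THEN iffD1, OF _ rv ind]) (use r in auto)
  also have "\<dots> = (\<Pi>\<^sub>M i\<in>{..<r}. R (e i))"
    using e by (intro PiM_cong refl dist) auto
  finally show ?thesis .
qed

text \<open>\<open>H\<close> depends on the permutation only through the set of block positions
  filled by indices below \<open>m\<close>. This set has hypergeometric weights, which
  \<open>le\<close> compares termwise with \<open>w\<close>; in the application \<open>w\<close> is
  the Bernoulli weight of a pattern with \<open>a\<close> successes.\<close>

lemma sum_permutes_trace_le:
  fixes H :: "nat set \<Rightarrow> ennreal"
  assumes m: "m \<le> N" and e: "inj_on e {..<r}" "e ` {..<r} \<subseteq> {..<N}" and C: "C \<ge> 0"
    and w: "\<And>a. a \<le> r \<Longrightarrow> 0 \<le> w a"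
    and le: "\<And>a. a \<le> r \<Longrightarrow> a \<le> m \<Longrightarrow> real ((N - r) choose (m - a)) / real (N choose m) \<le> C * w a"
  shows "(\<Sum>\<pi> | \<pi> permutes {..<N}. H {i\<in>{..<r}. \<pi> (e i) < m})
    \<le> ennreal (fact N * C) * (\<Sum>A\<in>Pow {..<r}. ennreal (w (card A)) * H A)"
proof -
  define I where "I = e ` {..<r}"
  have I: "I \<subseteq> {..<N}" "card I = r" using e by (auto simp: I_def card_image)
  define H' where "H' B = H {i\<in>{..<r}. e i \<in> B}" for B
  have H'_Int: "H' (B \<inter> I) = H' B" for B
    unfolding H'_def by (rule arg_cong[where f = H]) (auto simp: I_def)
  have "(\<Sum>\<pi> | \<pi> permutes {..<N}. H {i\<in>{..<r}. \<pi> (e i) < m})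
      = (\<Sum>\<pi> | \<pi> permutes {..<N}. H' {x\<in>{..<N}. \<pi> x \<in> {..<m}})"
    unfolding H'_def using e(2) by (intro sum.cong refl arg_cong[where f = H]) auto
  also have "\<dots> = of_nat (fact m * fact (N - m)) * (\<Sum>B | B \<subseteq> {..<N} \<and> card B = m. H' B)"
    using sum_permutes_vimage[of "{..<N}" "{..<m}" H'] m by simp
  also have "(\<Sum>B | B \<subseteq> {..<N} \<and> card B = m. H' B) = (\<Sum>B | B \<subseteq> {..<N} \<and> card B = m. H' (B \<inter> I))"
    by (simp add: H'_Int)
  also have "\<dots> = (\<Sum>A\<in>Pow I. of_nat (if card A \<le> m then (N - r) choose (m - card A) else 0) * H' A)"
    using sum_subsets_trace[of "{..<N}" I H' m] I(1) unfolding I(2) card_lessThan by simp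
  also have "of_nat (fact m * fact (N - m)) * \<dots> \<le> (\<Sum>A\<in>Pow I. ennreal (fact N * C) * (ennreal (w (card A)) * H' A))"
    unfolding sum_distrib_left
  proof (rule sum_mono)
    fix A assume "A \<in> Pow I"
    then have A: "card A \<le> r" using I card_mono[of I A] finite_subset[OF I(1)] by auto
    define c where "c = (if card A \<le> m then (N - r) choose (m - card A) else 0)"
    have "real (fact m * fact (N - m) * c) \<le> fact N * C * w (card A)"
    proof (cases "card A \<le> m")
      case True
      have f: "fact m * fact (N - m) * real (N choose m) = fact N"
        using binomial_fact_lemma[OF m] by (metis of_nat_fact of_nat_mult)
      have "real (N choose m) > 0" using m by simp
      then have "real c \<le> C * w (card A) * real (N choose m)"
        using le[OF A True] True by (simp add: c_def divide_le_eq)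
      then have "fact m * fact (N - m) * real c \<le> fact m * fact (N - m) * (C * w (card A) * real (N choose m))"
        by (intro mult_left_mono) auto
      also have "\<dots> = fact N * C * w (card A)" unfolding f[symmetric] by (simp add: ac_simps)
      finally show ?thesis by simp
    qed (use C w[OF A] in \<open>simp add: c_def\<close>)
    then have "of_nat (fact m * fact (N - m) * c) \<le> ennreal (fact N * C * w (card A))"
      by (subst ennreal_of_nat_eq_real_of_nat) (rule ennreal_leI)
    then have "of_nat (fact m * fact (N - m) * c) * H' A \<le> ennreal (fact N * C * w (card A)) * H' A"
      by (rule mult_right_mono) simp
    also have "ennreal (fact N * C * w (card A)) = ennreal (fact N * C) * ennreal (w (card A))"
      using C w[OF A] by (intro ennreal_mult) auto
    finally show "of_nat (fact m * fact (N - m)) * (of_nat (if card A \<le> m then (N - r) choose (m - card A) else 0) * H' A)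
        \<le> ennreal (fact N * C) * (ennreal (w (card A)) * H' A)"
      by (simp add: c_def mult.assoc)
  qed
  also have "\<dots> = ennreal (fact N * C) * (\<Sum>A\<in>Pow I. ennreal (w (card A)) * H' A)"
    by (rule sum_distrib_left[symmetric])
  also have "(\<Sum>A\<in>Pow I. ennreal (w (card A)) * H' A) = (\<Sum>A\<in>Pow {..<r}. ennreal (w (card A)) * H A)"
  proof -
    have "bij_betw (image e) (Pow {..<r}) (Pow I)"
      unfolding I_def using e(1) by (intro bij_betw_Pow) (rule inj_on_imp_bij_betw)
    then have "(\<Sum>A\<in>Pow I. ennreal (w (card A)) * H' A) = (\<Sum>A\<in>Pow {..<r}. ennreal (w (card (e ` A))) * H' (e ` A))"
      by (rule sum.reindex_bij_betw[symmetric])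
    also have "(\<Sum>A\<in>Pow {..<r}. ennreal (w (card (e ` A))) * H' (e ` A)) = (\<Sum>A\<in>Pow {..<r}. ennreal (w (card A)) * H A)"
    proof (rule sum.cong[OF refl])
      fix A assume A: "A \<in> Pow {..<r}"
      have "card (e ` A) = card A" using e(1) A by (auto intro!: card_image intro: inj_on_subset)
      moreover have "{i\<in>{..<r}. e i \<in> e ` A} = A" using e(1) A by (auto simp: inj_on_def)
      ultimately show "ennreal (w (card (e ` A))) * H' (e ` A) = ennreal (w (card A)) * H A"
        by (simp add: H'_def)
    qed
    finally show ?thesis .
  qed
  finally show ?thesis .
qed

text \<open>Each block of the permuted pooled sample has a law dominated by a multiple of that of an i.i.d. sample from
  the mixture, since its hypergeometric number of \<open>P\<close>-observations is dominated by the binomial one.\<close>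

lemma (in prob_space) permuted_sample_dominated:
  assumes W: "indep_vars (\<lambda>_. S) W {..<N}" and dist: "\<And>i. i < N \<Longrightarrow> distr M S (W i) = (if i < m then P else Q)"
    and PQ: "prob_space P" "prob_space Q" "sets P = sets S" "sets Q = sets S"
    and e: "inj_on e {..<r}" "e ` {..<r} \<subseteq> {..<N}" and r: "0 < r" "r < N" and m: "0 < m" "m < N"
    and p: "0 < p" "p < 1" and c: "\<bar>real m / real N - p\<bar> \<le> c / sqrt (real N)"
    and h: "h \<in> borel_measurable (\<Pi>\<^sub>M i\<in>{..<r}. S)"
  shows "(\<Sum>\<pi> | \<pi> permutes {..<N}. \<integral>\<^sup>+\<omega>. h (\<lambda>i\<in>{..<r}. W (\<pi> (e i)) \<omega>) \<partial>M)
    \<le> ennreal (fact N * (12 * exp (c\<^sup>2 / (p * (1 - p))) / sqrt (p * (1 - p)) * sqrt (real N / real (N - r))))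
      * (\<integral>\<^sup>+x. h x \<partial>(\<Pi>\<^sub>M i\<in>{..<r}. mixture p P Q))"
proof -
  define C where "C = 12 * exp (c\<^sup>2 / (p * (1 - p))) / sqrt (p * (1 - p)) * sqrt (real N / real (N - r))"
  define H where "H A = (\<integral>\<^sup>+x. h x \<partial>(\<Pi>\<^sub>M i\<in>{..<r}. if i \<in> A then P else Q))" for A
  have hP: "h \<in> borel_measurable (\<Pi>\<^sub>M i\<in>{..<r}. P)"
    using h measurable_cong_sets[OF sets_PiM_cong[OF refl PQ(3)] refl] by blast
  have "(\<integral>\<^sup>+\<omega>. h (\<lambda>i\<in>{..<r}. W (\<pi> (e i)) \<omega>) \<partial>M) = H {i\<in>{..<r}. \<pi> (e i) < m}"
    if \<pi>: "\<pi> permutes {..<N}" for \<pi>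
  proof -
    have "inj_on (\<pi> \<circ> e) {..<r}"
      using e(1) permutes_inj[OF \<pi>] by (intro comp_inj_on) (auto intro: inj_on_subset)
    moreover have "(\<pi> \<circ> e) ` {..<r} \<subseteq> {..<N}"
      using e(2) permutes_in_image[OF \<pi>] by auto
    ultimately have inj: "inj_on (\<pi> \<circ> e) {..<r}" and ran: "(\<pi> \<circ> e) ` {..<r} \<subseteq> {..<N}" by auto
    have "(\<integral>\<^sup>+\<omega>. h (\<lambda>i\<in>{..<r}. W ((\<pi> \<circ> e) i) \<omega>) \<partial>M)
        = (\<integral>\<^sup>+x. h x \<partial>(\<Pi>\<^sub>M i\<in>{..<r}. if (\<pi> \<circ> e) i < m then P else Q))"
      by (rule nn_integral_permuted_sample[OF W _ inj ran r(1) h]) (rule dist)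
    also have "(\<Pi>\<^sub>M i\<in>{..<r}. if (\<pi> \<circ> e) i < m then P else Q)
        = (\<Pi>\<^sub>M i\<in>{..<r}. if i \<in> {i\<in>{..<r}. \<pi> (e i) < m} then P else Q)"
      by (rule PiM_cong) auto
    finally show ?thesis unfolding H_def comp_def .
  qed
  then have "(\<Sum>\<pi> | \<pi> permutes {..<N}. \<integral>\<^sup>+\<omega>. h (\<lambda>i\<in>{..<r}. W (\<pi> (e i)) \<omega>) \<partial>M)
      = (\<Sum>\<pi> | \<pi> permutes {..<N}. H {i\<in>{..<r}. \<pi> (e i) < m})" by (intro sum.cong) auto
  also have "\<dots> \<le> ennreal (fact N * C) * (\<Sum>A\<in>Pow {..<r}. ennreal (p ^ card A * (1 - p) ^ (r - card A)) * H A)"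
  proof (rule sum_permutes_trace_le[OF less_imp_le[OF m(2)] e])
    show "C \<ge> 0" using p by (simp add: C_def)
    show "real ((N - r) choose (m - a)) / real (N choose m) \<le> C * (p ^ a * (1 - p) ^ (r - a))"
      if "a \<le> r" "a \<le> m" for a
      unfolding C_def by (rule hypergeometric_le_binomial[OF m r(2) that p c])
  qed (use p in auto)
  also have "(\<Sum>A\<in>Pow {..<r}. ennreal (p ^ card A * (1 - p) ^ (r - card A)) * H A)
      = (\<integral>\<^sup>+x. h x \<partial>(\<Pi>\<^sub>M i\<in>{..<r}. mixture p P Q))"
    unfolding H_def using nn_integral_PiM_mixture[OF PQ(1,2), of p "{..<r}" h] PQ p hP by simp
  finally show ?thesis unfolding C_def .
qed

section \<open>Weak law of large numbers\<close>

text \<open>The cross terms vanish, so the mean has second moment at most B^2 / m. The inequality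
  |z| <= 1 / s + s z^2 with s = sqrt m turns this into a first-moment bound.\<close>

lemma (in prob_space) indep_bounded_mean_L1:
  fixes u :: "nat \<Rightarrow> 'a \<Rightarrow> real"
  assumes ind: "indep_vars (\<lambda>_. borel) u UNIV" and B: "\<And>i \<omega>. \<bar>u i \<omega>\<bar> \<le> B"
    and mean: "\<And>i. expectation (u i) = 0" and m: "m > 0"
  shows "expectation (\<lambda>\<omega>. \<bar>(\<Sum>i<m. u i \<omega>) / real m\<bar>) \<le> (1 + B\<^sup>2) / sqrt (real m)"
proof -
  have [measurable]: "u i \<in> borel_measurable M" for i using ind by (auto simp: indep_vars_def2)
  have B0: "B \<ge> 0" using order_trans[OF abs_ge_zero B] .
  have int: "integrable M (u i)" for i
    by (rule integrable_const_bound[where B = B]) (use B in auto)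
  have bnd: "\<bar>u i \<omega> * u j \<omega>\<bar> \<le> B\<^sup>2" for i j \<omega>
    unfolding abs_mult power2_eq_square using B B0 by (intro mult_mono) auto
  have int2: "integrable M (\<lambda>\<omega>. u i \<omega> * u j \<omega>)" for i j
    by (rule integrable_const_bound[where B = "B\<^sup>2"]) (use bnd in auto)
  have cross: "expectation (\<lambda>\<omega>. u i \<omega> * u j \<omega>) = 0" if "i \<noteq> j" for i j
  proof -
    have "expectation (\<lambda>\<omega>. \<Prod>k\<in>{i, j}. u k \<omega>) = (\<Prod>k\<in>{i, j}. expectation (u k))"
      using int by (intro indep_vars_lebesgue_integral indep_vars_subset[OF ind]) auto
    then show ?thesis using that mean by simp
  qed
  have diag: "expectation (\<lambda>\<omega>. u i \<omega> * u i \<omega>) \<le> B\<^sup>2" for i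
  proof -
    have "expectation (\<lambda>\<omega>. u i \<omega> * u i \<omega>) \<le> expectation (\<lambda>\<omega>. B\<^sup>2)"
      using bnd int2 by (intro integral_mono) (auto intro: order_trans[OF abs_ge_self])
    then show ?thesis by (simp add: prob_space)
  qed
  define y where "y \<omega> = (\<Sum>i<m. u i \<omega>) / real m" for \<omega>
  have y2: "(y \<omega>)\<^sup>2 = (\<Sum>i<m. \<Sum>j<m. u i \<omega> * u j \<omega>) / (real m)\<^sup>2" for \<omega>
    by (simp add: y_def power_divide power2_eq_square sum_product)
  have int_y2: "integrable M (\<lambda>\<omega>. (y \<omega>)\<^sup>2)" unfolding y2 using int2 by auto
  have "expectation (\<lambda>\<omega>. (y \<omega>)\<^sup>2) = (\<Sum>i<m. \<Sum>j<m. expectation (\<lambda>\<omega>. u i \<omega> * u j \<omega>)) / (real m)\<^sup>2"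
    unfolding y2 using int2 by (simp add: integral_sum)
  also have "\<dots> \<le> (\<Sum>i<m. B\<^sup>2) / (real m)\<^sup>2"
  proof (intro divide_right_mono sum_mono)
    fix i assume i: "i \<in> {..<m}"
    have "(\<Sum>j<m. expectation (\<lambda>\<omega>. u i \<omega> * u j \<omega>)) = expectation (\<lambda>\<omega>. u i \<omega> * u i \<omega>)"
      using i cross by (subst sum.remove[of _ i]) auto
    then show "(\<Sum>j<m. expectation (\<lambda>\<omega>. u i \<omega> * u j \<omega>)) \<le> B\<^sup>2" using diag by simp
  qed simp
  also have "\<dots> = B\<^sup>2 / real m" using m by (simp add: power2_eq_square)
  finally have Ey2: "expectation (\<lambda>\<omega>. (y \<omega>)\<^sup>2) \<le> B\<^sup>2 / real m" .
  define s where "s = sqrt (real m)"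
  have s: "s > 0" "s * s = real m" using m by (auto simp: s_def)
  have amgm: "\<bar>z\<bar> \<le> 1 / s + s * z\<^sup>2" for z :: real
  proof -
    have "0 \<le> (\<bar>z\<bar> * s - 1)\<^sup>2" by simp
    then have "2 * (\<bar>z\<bar> * s) \<le> z\<^sup>2 * (s * s) + 1"
      unfolding power2_diff power_mult_distrib power2_abs by (simp add: power2_eq_square)
    moreover have "0 \<le> \<bar>z\<bar> * s" using s by simp
    moreover have "(1 / s + s * z\<^sup>2) * s = 1 + z\<^sup>2 * (s * s)" using s(1) by (simp add: algebra_simps)
    ultimately have "\<bar>z\<bar> * s \<le> (1 / s + s * z\<^sup>2) * s" by linarith
    then show ?thesis using s by simp
  qed
  have "expectation (\<lambda>\<omega>. \<bar>y \<omega>\<bar>) \<le> expectation (\<lambda>\<omega>. 1 / s + s * (y \<omega>)\<^sup>2)"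
    using int int_y2 unfolding y_def[abs_def]
    by (intro integral_mono amgm[unfolded y_def]) (auto intro!: integrable_abs)
  also have "\<dots> = 1 / s + s * expectation (\<lambda>\<omega>. (y \<omega>)\<^sup>2)" using int_y2 by (simp add: prob_space)
  also have "\<dots> \<le> 1 / s + s * (B\<^sup>2 / real m)" using Ey2 s by (intro add_left_mono mult_left_mono) auto
  also have "\<dots> = (1 + B\<^sup>2) / s" unfolding s(2)[symmetric] using s(1) by (simp add: add_divide_distrib)
  finally show ?thesis by (simp add: y_def s_def)
qed

text \<open>This tail controls both the truncation error in \<open>weak_law_L1\<close> and the union
  bound in \<open>max_negligible\<close>.\<close>

lemma truncation_L1:
  fixes h :: "'a \<Rightarrow> real"
  assumes h: "integrable P h"
  shows "(\<lambda>K. LINT x|P. \<bar>h x\<bar> * indicator {x. \<bar>h x\<bar> > real K} x) \<longlonglongrightarrow> 0"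
proof -
  have [measurable]: "h \<in> borel_measurable P" using h by auto
  have "(\<lambda>K. LINT x|P. \<bar>h x\<bar> * indicator {x. \<bar>h x\<bar> > real K} x) \<longlonglongrightarrow> (LINT x|P. 0)"
  proof (rule integral_dominated_convergence[where w = "\<lambda>x. \<bar>h x\<bar>"])
    show "AE x in P. (\<lambda>K. \<bar>h x\<bar> * indicator {x. \<bar>h x\<bar> > real K} x) \<longlonglongrightarrow> 0"
    proof (rule AE_I2)
      fix x
      obtain K0 where "\<bar>h x\<bar> \<le> real K0" using real_arch_simple by blast
      then have "eventually (\<lambda>K. \<bar>h x\<bar> * indicator {x. \<bar>h x\<bar> > real K} x = (0::real)) sequentially"
        unfolding eventually_sequentially
        by (intro exI[of _ K0]) (auto simp: indicator_def not_less intro: order_trans)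
      then show "(\<lambda>K. \<bar>h x\<bar> * indicator {x. \<bar>h x\<bar> > real K} x) \<longlonglongrightarrow> (0::real)" by (rule tendsto_eventually)
    qed
  qed (use h in \<open>auto simp: indicator_def\<close>)
  then show ?thesis by simp
qed

text \<open>Only a first moment may be assumed, as the law is applied to the square of the influence
  function; hence truncation before the variance argument. Convergence of means, rather than in
  probability, lets the errors of the two samples be added before a single use of Markov's
  inequality.\<close>

lemma (in prob_space) weak_law_L1:
  fixes X :: "nat \<Rightarrow> 'a \<Rightarrow> 'b" and h :: "'b \<Rightarrow> real"
  assumes ind: "indep_vars (\<lambda>_. S) X UNIV" and dist: "\<And>i. distr M S (X i) = P" and h: "integrable P h"
  shows "(\<lambda>m. expectation (\<lambda>\<omega>. \<bar>(\<Sum>i<m. h (X i \<omega>)) / real m - (LINT x|P. h x)\<bar>)) \<longlonglongrightarrow> 0"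
proof (rule LIMSEQ_I)
  fix \<epsilon> :: real assume \<epsilon>: "\<epsilon> > 0"
  have X[measurable]: "X i \<in> measurable M S" for i using ind by (auto simp: indep_vars_def2)
  have sets_P[measurable_cong]: "sets P = sets S" using dist[of 0] by (metis sets_distr)
  interpret P: prob_space P using prob_space_distr[OF X[of 0]] by (simp add: dist)
  have [measurable]: "h \<in> borel_measurable S" using h measurable_cong_sets[OF sets_P refl] by blast
  define err where "err K = (LINT x|P. \<bar>h x\<bar> * indicator {x. \<bar>h x\<bar> > real K} x)" for K
  \<comment> \<open>The tail is paid twice, once for replacing \<open>h\<close> by \<open>t\<close>
    in the sample and once for the shift from \<mu> to \<nu>, so a quarter leaves half of \<epsilon>
    for the variance term.\<close>
  obtain K where K: "err K < \<epsilon> / 4"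
    using order_tendstoD(2)[OF truncation_L1[OF h], of "\<epsilon> / 4", folded err_def] \<epsilon>
    by (auto simp: eventually_sequentially)
  define t where "t x = h x * indicator {x. \<bar>h x\<bar> \<le> real K} x" for x
  have [measurable]: "t \<in> borel_measurable S" unfolding t_def by measurable
  define \<mu> where "\<mu> = (LINT x|P. h x)"
  define \<nu> where "\<nu> = (LINT x|P. t x)"
  have t_bound: "\<bar>t x\<bar> \<le> real K" for x by (auto simp: t_def indicator_def)
  have t_int: "integrable P t"
    by (rule P.integrable_const_bound[where B = "real K"]) (use t_bound in auto)
  have diff: "\<bar>h x - t x\<bar> = \<bar>h x\<bar> * indicator {x. \<bar>h x\<bar> > real K} x" for x
    by (auto simp: t_def indicator_def)
  have err_eq: "(LINT x|P. \<bar>h x - t x\<bar>) = err K" unfolding err_def diff ..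
  have \<mu>\<nu>: "\<bar>\<nu> - \<mu>\<bar> \<le> err K"
  proof -
    have "\<mu> - \<nu> = (LINT x|P. h x - t x)" unfolding \<mu>_def \<nu>_def using h t_int by simp
    also have "\<bar>\<dots>\<bar> \<le> (LINT x|P. \<bar>h x - t x\<bar>)" by (rule integral_abs_bound)
    finally show ?thesis by (simp add: err_eq abs_minus_commute)
  qed
  have \<nu>: "\<bar>\<nu>\<bar> \<le> real K"
  proof -
    have "\<bar>\<nu>\<bar> \<le> (LINT x|P. \<bar>t x\<bar>)" unfolding \<nu>_def by (rule integral_abs_bound)
    also have "\<dots> \<le> (LINT x|P. real K)" using t_bound t_int by (intro integral_mono) auto
    finally show ?thesis by (simp add: P.prob_space)
  qed
  have int_X: "integrable M (\<lambda>\<omega>. g (X i \<omega>))" "expectation (\<lambda>\<omega>. g (X i \<omega>)) = (LINT x|P. g x)"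
    if "integrable P g" for g :: "'b \<Rightarrow> real" and i
    using that X[of i] borel_measurable_integrable[OF that] measurable_cong_sets[OF sets_P refl]
    unfolding dist[of i, symmetric] by (auto simp: integrable_distr_eq integral_distr)
  define u where "u i \<omega> = t (X i \<omega>) - \<nu>" for i \<omega>
  have u_ind: "indep_vars (\<lambda>_. borel) u UNIV"
    unfolding u_def[abs_def] by (rule indep_vars_compose2[OF ind, of "\<lambda>_ x. t x - \<nu>"]) measurable
  have u_bound: "\<bar>u i \<omega>\<bar> \<le> 2 * real K" for i \<omega>
    using t_bound[of "X i \<omega>"] \<nu> unfolding u_def by linarith
  have u_mean: "expectation (u i) = 0" for i
    using int_X[OF t_int, of i] by (simp add: u_def[abs_def] prob_space \<nu>_def)
  define C where "C = 1 + (2 * real K)\<^sup>2"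
  have bound: "expectation (\<lambda>\<omega>. \<bar>(\<Sum>i<m. h (X i \<omega>)) / real m - \<mu>\<bar>) \<le> 2 * err K + C / sqrt (real m)"
    if m: "m > 0" for m
  proof -
    have iu: "integrable M (u i)" for i
      unfolding u_def[abs_def] using int_X(1)[OF t_int] by auto
    have id: "integrable M (\<lambda>\<omega>. \<bar>h (X i \<omega>) - t (X i \<omega>)\<bar>)" for i
      using int_X(1)[OF h] int_X(1)[OF t_int] by auto
    have "expectation (\<lambda>\<omega>. \<bar>(\<Sum>i<m. h (X i \<omega>)) / real m - \<mu>\<bar>)
        \<le> expectation (\<lambda>\<omega>. (\<Sum>i<m. \<bar>h (X i \<omega>) - t (X i \<omega>)\<bar>) / real m + \<bar>(\<Sum>i<m. u i \<omega>) / real m\<bar> + err K)"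
    proof (rule integral_mono)
      fix \<omega>
      have "(\<Sum>i<m. h (X i \<omega>)) / real m - \<mu>
          = (\<Sum>i<m. h (X i \<omega>) - t (X i \<omega>)) / real m + (\<Sum>i<m. u i \<omega>) / real m + (\<nu> - \<mu>)"
      proof -
        have "(\<Sum>i<m. u i \<omega>) = (\<Sum>i<m. t (X i \<omega>)) - real m * \<nu>" by (simp add: u_def sum_subtractf)
        then show ?thesis unfolding sum_subtractf using m by (simp add: field_simps)
      qed
      moreover have "\<bar>(\<Sum>i<m. h (X i \<omega>) - t (X i \<omega>)) / real m\<bar> \<le> (\<Sum>i<m. \<bar>h (X i \<omega>) - t (X i \<omega>)\<bar>) / real m"
        by (simp add: divide_right_mono sum_abs)
      ultimately show "\<bar>(\<Sum>i<m. h (X i \<omega>)) / real m - \<mu>\<bar>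
          \<le> (\<Sum>i<m. \<bar>h (X i \<omega>) - t (X i \<omega>)\<bar>) / real m + \<bar>(\<Sum>i<m. u i \<omega>) / real m\<bar> + err K"
        using \<mu>\<nu> by linarith
    qed (use int_X(1)[OF h] id iu in auto)
    also have "\<dots> = (\<Sum>i<m. expectation (\<lambda>\<omega>. \<bar>h (X i \<omega>) - t (X i \<omega>)\<bar>)) / real m
        + expectation (\<lambda>\<omega>. \<bar>(\<Sum>i<m. u i \<omega>) / real m\<bar>) + err K"
    proof -
      have "integrable M (\<lambda>\<omega>. (\<Sum>i<m. \<bar>h (X i \<omega>) - t (X i \<omega>)\<bar>) / real m)"
        "integrable M (\<lambda>\<omega>. \<bar>(\<Sum>i<m. u i \<omega>) / real m\<bar>)" using id iu by auto
      then show ?thesis using id by (simp add: prob_space integral_sum)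
    qed
    also have "(\<Sum>i<m. expectation (\<lambda>\<omega>. \<bar>h (X i \<omega>) - t (X i \<omega>)\<bar>)) = (\<Sum>i<m. err K)"
    proof (rule sum.cong[OF refl])
      fix i
      have "integrable P (\<lambda>x. \<bar>h x - t x\<bar>)" using h t_int by auto
      then show "expectation (\<lambda>\<omega>. \<bar>h (X i \<omega>) - t (X i \<omega>)\<bar>) = err K"
        using int_X(2)[of "\<lambda>x. \<bar>h x - t x\<bar>" i] by (simp only: err_eq)
    qed
    also have "(\<Sum>i<m. err K) / real m = err K" using m by simp
    also have "expectation (\<lambda>\<omega>. \<bar>(\<Sum>i<m. u i \<omega>) / real m\<bar>) \<le> C / sqrt (real m)"
      unfolding C_def by (rule indep_bounded_mean_L1[OF u_ind u_bound u_mean m])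
    finally show ?thesis by simp
  qed
  have "(\<lambda>m. C / sqrt (real m)) \<longlonglongrightarrow> 0"
    by (intro tendsto_divide_0[OF tendsto_const] filterlim_at_top_imp_at_infinity
        filterlim_compose[OF sqrt_at_top filterlim_real_sequentially])
  from order_tendstoD(2)[OF this, of "\<epsilon> / 2"] \<epsilon>
  obtain m0 where m0: "\<And>m. m \<ge> m0 \<Longrightarrow> C / sqrt (real m) < \<epsilon> / 2"
    by (auto simp: eventually_sequentially)
  show "\<exists>m0. \<forall>m\<ge>m0. norm (expectation (\<lambda>\<omega>. \<bar>(\<Sum>i<m. h (X i \<omega>)) / real m - (LINT x|P. h x)\<bar>) - 0) < \<epsilon>"
  proof (intro exI[of _ "max m0 1"] allI impI)
    fix m assume "max m0 1 \<le> m"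
    then have "m0 \<le> m" "0 < m" by auto
    then have "expectation (\<lambda>\<omega>. \<bar>(\<Sum>i<m. h (X i \<omega>)) / real m - \<mu>\<bar>) < \<epsilon>"
      using bound[of m] m0[of m] K by linarith
    then show "norm (expectation (\<lambda>\<omega>. \<bar>(\<Sum>i<m. h (X i \<omega>)) / real m - (LINT x|P. h x)\<bar>) - 0) < \<epsilon>"
      by (simp add: \<mu>_def integral_nonneg_AE)
  qed
qed

text \<open>The union bound gives m P(|g| > m), which is at most the mean of |g| on that event and
  hence a tail of a convergent integral. With \<open>h\<close> the square of the influence function,
  this says that the maximum of the latter is o(sqrt m).\<close>

lemma (in prob_space) max_negligible:
  fixes X :: "nat \<Rightarrow> 'a \<Rightarrow> 'b" and h :: "'b \<Rightarrow> real"
  assumes X: "\<And>i. X i \<in> measurable M S" and dist: "\<And>i. distr M S (X i) = P" and h: "integrable P h"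
    and c: "c > 0"
  shows "(\<lambda>m. prob {\<omega>\<in>space M. \<exists>i<m. \<bar>h (X i \<omega>)\<bar> > c * real m}) \<longlonglongrightarrow> 0"
proof -
  note [measurable] = X
  have sets_P[measurable_cong]: "sets P = sets S" using dist[of 0] by (metis sets_distr)
  interpret P: prob_space P using prob_space_distr[OF X[of 0]] by (simp add: dist)
  have [measurable]: "h \<in> borel_measurable S" using h measurable_cong_sets[OF sets_P refl] by blast
  \<comment> \<open>Rescaling turns the threshold \<open>c * m\<close> into the integer level at
    which \<open>truncation_L1\<close> is stated.\<close>
  define g where "g x = h x / c" for x
  have g: "integrable P g" unfolding g_def using h by auto
  have [measurable]: "g \<in> borel_measurable S" unfolding g_def by measurable
  have "prob {\<omega>\<in>space M. \<exists>i<m. \<bar>h (X i \<omega>)\<bar> > c * real m}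
      \<le> (LINT x|P. \<bar>g x\<bar> * indicator {x. \<bar>g x\<bar> > real m} x)" for m
  proof -
    have gh: "\<bar>h x\<bar> > c * real m \<longleftrightarrow> \<bar>g x\<bar> > real m" for x using c by (simp add: g_def field_simps)
    define A where "A = {x\<in>space P. \<bar>g x\<bar> > real m}"
    have [measurable]: "A \<in> sets P" unfolding A_def by measurable
    have A_space: "A \<inter> space P = A" by (auto simp: A_def)
    have "prob {\<omega>\<in>space M. \<exists>i<m. \<bar>h (X i \<omega>)\<bar> > c * real m}
        = prob (\<Union>i<m. {\<omega>\<in>space M. \<bar>g (X i \<omega>)\<bar> > real m})"
      unfolding gh by (rule arg_cong[where f = prob]) auto
    also have "\<dots> \<le> (\<Sum>i<m. prob {\<omega>\<in>space M. \<bar>g (X i \<omega>)\<bar> > real m})"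
      by (rule finite_measure_subadditive_finite) auto
    also have "\<dots> = (\<Sum>i<m. P.prob {x\<in>space P. \<bar>g x\<bar> > real m})"
    proof (rule sum.cong[OF refl])
      fix i
      have "space P = space S" by (rule sets_eq_imp_space_eq[OF sets_P])
      moreover have "measure (distr M S (X i)) {x\<in>space S. \<bar>g x\<bar> > real m} = prob {\<omega>\<in>space M. \<bar>g (X i \<omega>)\<bar> > real m}"
        using measurable_space[OF X[of i]] by (subst measure_distr) (auto intro!: arg_cong[where f = prob])
      ultimately show "prob {\<omega>\<in>space M. \<bar>g (X i \<omega>)\<bar> > real m} = P.prob {x\<in>space P. \<bar>g x\<bar> > real m}"
        by (simp only: dist)
    qed
    also have "\<dots> = real m * P.prob A" by (simp add: A_def)
    also have "\<dots> = (LINT x|P. real m * indicator A x)" by (simp add: A_space)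
    also have "\<dots> \<le> (LINT x|P. \<bar>g x\<bar> * indicator {x. \<bar>g x\<bar> > real m} x)"
    proof (rule integral_mono)
      show "integrable P (\<lambda>x. real m * indicator A x)"
        by (rule P.integrable_const_bound[where B = "real m"]) (auto simp: indicator_def)
      show "integrable P (\<lambda>x. \<bar>g x\<bar> * indicator {x. \<bar>g x\<bar> > real m} x)"
        by (rule Bochner_Integration.integrable_bound[OF g]) (auto simp: indicator_def)
    qed (auto simp: indicator_def A_def)
    finally show ?thesis .
  qed
  then show ?thesis
    by (intro tendsto_sandwich[OF _ _ tendsto_const truncation_L1[OF g]] always_eventually allI) auto
qed

section \<open>The two-sample statistic\<close>

lemma integral_mixture:
  fixes h :: "'a \<Rightarrow> real"
  assumes Q: "sets Q = sets P" and p: "0 < p" "p < 1" and h: "integrable (mixture p P Q) h"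
  shows "integrable P h" "integrable Q h"
    and "(LINT x|mixture p P Q. h x) = p * (LINT x|P. h x) + (1 - p) * (LINT x|Q. h x)"
proof -
  have m: "h \<in> borel_measurable P"
    using borel_measurable_integrable[OF h] by (simp add: measurable_cong_sets[OF sets_mixture refl])
  then have mQ: "h \<in> borel_measurable Q" by (simp add: measurable_cong_sets[OF Q refl])
  note [measurable] = m mQ
  have nn: "(\<integral>\<^sup>+x. ennreal (u x) \<partial>mixture p P Q) = ennreal p * (\<integral>\<^sup>+x. ennreal (u x) \<partial>P) + ennreal (1 - p) * (\<integral>\<^sup>+x. ennreal (u x) \<partial>Q)"
    if "u \<in> borel_measurable P" for u
    using that by (intro nn_integral_mixture Q) simp
  have "(\<integral>\<^sup>+x. ennreal \<bar>h x\<bar> \<partial>mixture p P Q) < \<infinity>" using h by (simp add: integrable_iff_bounded)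
  then have fin: "(\<integral>\<^sup>+x. ennreal \<bar>h x\<bar> \<partial>P) < \<infinity>" "(\<integral>\<^sup>+x. ennreal \<bar>h x\<bar> \<partial>Q) < \<infinity>"
    using p by (auto simp: nn ennreal_mult_less_top less_top[symmetric] ennreal_mult_eq_top_iff)
  then show P: "integrable P h" and "integrable Q h" by (simp_all add: integrable_iff_bounded)
  have fin': "(\<integral>\<^sup>+x. ennreal (s * h x) \<partial>R) < \<infinity>" if "(\<integral>\<^sup>+x. ennreal \<bar>h x\<bar> \<partial>R) < \<infinity>" "\<bar>s\<bar> = 1" for s R
    using that(2) by (intro le_less_trans[OF nn_integral_mono that(1)] ennreal_leI) (auto simp: abs_if split: if_splits)
  \<comment> \<open>Since \<open>ennreal\<close> sends negative numbers to 0, s = 1 and s = -1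
    select the positive and the negative part of \<open>h\<close>.\<close>
  have e: "enn2real (\<integral>\<^sup>+x. ennreal (s * h x) \<partial>mixture p P Q)
      = p * enn2real (\<integral>\<^sup>+x. ennreal (s * h x) \<partial>P) + (1 - p) * enn2real (\<integral>\<^sup>+x. ennreal (s * h x) \<partial>Q)" if "\<bar>s\<bar> = 1" for s
    using p fin'[OF fin(1) that] fin'[OF fin(2) that]
    by (subst nn) (auto simp: enn2real_plus enn2real_mult ennreal_mult_less_top)
  show "(LINT x|mixture p P Q. h x) = p * (LINT x|P. h x) + (1 - p) * (LINT x|Q. h x)"
    using e[of 1] e[of "-1"] h \<open>integrable P h\<close> \<open>integrable Q h\<close>
    by (simp add: real_lebesgue_integral_def algebra_simps)
qed

text \<open>Puts smallness in probability into the form of a bounded nonnegative integral, to which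
  the domination of laws applies directly.\<close>

lemma converges_in_prob_truncated_mean:
  assumes M: "prob_space M" and Z: "converges_in_prob M Z 0"
  shows "(\<lambda>r. LINT \<omega>|M. min 1 \<bar>Z r \<omega>\<bar>) \<longlonglongrightarrow> 0"
proof (rule LIMSEQ_I)
  interpret prob_space M by (rule M)
  fix \<epsilon> :: real assume \<epsilon>: "\<epsilon> > 0"
  have [measurable]: "Z r \<in> borel_measurable M" for r using Z by (simp add: converges_in_prob_def)
  have "(\<lambda>r. prob {\<omega>\<in>space M. \<bar>Z r \<omega>\<bar> > \<epsilon> / 2}) \<longlonglongrightarrow> 0"
    using Z[unfolded converges_in_prob_def, THEN conjunct2, rule_format, of "\<epsilon> / 2"] \<epsilon> by simp
  from order_tendstoD(2)[OF this, of "\<epsilon> / 2"] \<epsilon>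
  obtain r0 where r0: "\<And>r. r \<ge> r0 \<Longrightarrow> prob {\<omega>\<in>space M. \<bar>Z r \<omega>\<bar> > \<epsilon> / 2} < \<epsilon> / 2"
    by (auto simp: eventually_sequentially)
  have "norm ((LINT \<omega>|M. min 1 \<bar>Z r \<omega>\<bar>) - 0) < \<epsilon>" if "r \<ge> r0" for r
  proof -
    define A where "A = {\<omega>\<in>space M. \<bar>Z r \<omega>\<bar> > \<epsilon> / 2}"
    have [measurable]: "A \<in> sets M" unfolding A_def by measurable
    have A_space: "A \<inter> space M = A" by (auto simp: A_def)
    have int_A: "integrable M (indicat_real A)"
      by (rule integrable_const_bound[where B = 1]) (auto simp: indicator_def)
    have "(LINT \<omega>|M. min 1 \<bar>Z r \<omega>\<bar>) \<le> (LINT \<omega>|M. \<epsilon> / 2 + indicator A \<omega>)"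
    proof (rule integral_mono)
      show "integrable M (\<lambda>\<omega>. min 1 \<bar>Z r \<omega>\<bar>)" by (rule integrable_const_bound[where B = 1]) auto
      show "integrable M (\<lambda>\<omega>. \<epsilon> / 2 + indicator A \<omega>)" using int_A by simp
    qed (use \<epsilon> in \<open>auto simp: A_def indicator_def\<close>)
    also have "\<dots> = \<epsilon> / 2 + prob A" by (subst Bochner_Integration.integral_add) (auto simp: prob_space A_space int_A)
    also have "\<dots> < \<epsilon>" using r0[OF that] by (simp add: A_def)
    finally show ?thesis by (simp add: integral_nonneg_AE)
  qed
  then show "\<exists>r0. \<forall>r\<ge>r0. norm ((LINT \<omega>|M. min 1 \<bar>Z r \<omega>\<bar>) - 0) < \<epsilon>" by blast
qed

lemma (in prob_space) prob_ge_tendsto_zero: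
  fixes F :: "nat \<Rightarrow> 'a \<Rightarrow> real"
  assumes int: "\<And>k. integrable M (F k)" and nn: "\<And>k \<omega>. F k \<omega> \<ge> 0"
    and lim: "(\<lambda>k. expectation (F k)) \<longlonglongrightarrow> 0" and \<delta>: "\<delta> > 0"
  shows "(\<lambda>k. prob {\<omega>\<in>space M. F k \<omega> \<ge> \<delta>}) \<longlonglongrightarrow> 0"
proof (rule tendsto_sandwich[OF _ _ tendsto_const])
  show "eventually (\<lambda>k. prob {\<omega>\<in>space M. F k \<omega> \<ge> \<delta>} \<le> expectation (F k) / \<delta>) sequentially"
    using int nn \<delta> by (intro always_eventually allI integral_Markov_inequality_measure[where A = "{}"]) auto
  show "(\<lambda>k. expectation (F k) / \<delta>) \<longlonglongrightarrow> 0" using tendsto_divide[OF lim tendsto_const[of \<delta>]] \<delta> by simp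
qed simp

text \<open>\<open>converges_in_prob\<close> demands measurability, and a supremum over all reals is
  uncountable. Right continuity reduces it to the rationals: a value above the rational supremum
  would persist on an interval to the right. The bound \<open>B\<close> makes the conditional
  suprema genuine ones.\<close>

lemma borel_measurable_cSUP_right_continuous:
  fixes F :: "'a \<Rightarrow> real \<Rightarrow> real"
  assumes meas: "\<And>t. (\<lambda>\<omega>. F \<omega> t) \<in> borel_measurable M"
    and cont: "\<And>\<omega> t. continuous (at_right t) (F \<omega>)" and B: "\<And>\<omega> t. F \<omega> t \<le> B"
  shows "(\<lambda>\<omega>. SUP t. F \<omega> t) \<in> borel_measurable M"
proof -
  have bdd: "bdd_above (F \<omega> ` A)" for \<omega> A using B by (auto intro!: bdd_aboveI2)
  have "(SUP t. F \<omega> t) = (SUP t\<in>\<rat>. F \<omega> t)" for \<omega>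
  proof (rule antisym)
    show "(SUP t\<in>\<rat>. F \<omega> t) \<le> (SUP t. F \<omega> t)"
      by (rule cSUP_subset_mono) (auto intro: bdd Rats_0)
    show "(SUP t. F \<omega> t) \<le> (SUP t\<in>\<rat>. F \<omega> t)"
    proof (rule cSUP_least)
      fix t
      show "F \<omega> t \<le> (SUP t\<in>\<rat>. F \<omega> t)"
      proof (rule ccontr)
        assume "\<not> ?thesis"
        then have less: "(SUP t\<in>\<rat>. F \<omega> t) < F \<omega> t" by simp
        have "(F \<omega> \<longlongrightarrow> F \<omega> t) (at_right t)" using cont by (simp add: continuous_within)
        from order_tendstoD(1)[OF this less] obtain b where b: "b > t" "\<And>y. t < y \<Longrightarrow> y < b \<Longrightarrow> (SUP t\<in>\<rat>. F \<omega> t) < F \<omega> y"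
          by (auto simp: eventually_at_right_field)
        obtain q where "q \<in> \<rat>" "t < q" "q < b" using Rats_dense_in_real[OF b(1)] by auto
        then have "F \<omega> q \<le> (SUP t\<in>\<rat>. F \<omega> t)" by (intro cSUP_upper bdd)
        then show False using b(2)[of q] \<open>t < q\<close> \<open>q < b\<close> by simp
      qed
    qed simp
  qed
  then show ?thesis using meas bdd by (simp add: borel_measurable_cSUP countable_rat)
qed

lemma continuous_at_right_step: "continuous (at_right t) (\<lambda>t. if c \<le> t then 1 else 0 :: real)" for t c :: real
proof (cases "c \<le> t")
  case True
  then have "eventually (\<lambda>x. (if c \<le> x then 1 else 0) = (1::real)) (at_right t)"
    by (auto simp: eventually_at_right_field intro!: exI[of _ "t + 1"])
  then show ?thesis using True by (simp add: continuous_within tendsto_eventually)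
next
  case False
  then have "eventually (\<lambda>x. (if c \<le> x then 1 else 0) = (0::real)) (at_right t)"
    by (auto simp: eventually_at_right_field intro!: exI[of _ c])
  then show ?thesis using False by (simp add: continuous_within tendsto_eventually)
qed

lemma continuous_at_right_permutation_cdf: "continuous (at_right t) (permutation_cdf N T z)"
  unfolding permutation_cdf_def[abs_def]
  by (intro continuous_mult continuous_const continuous_sum continuous_at_right_step)

lemma permutation_cdf_bounds: "0 \<le> permutation_cdf N T z t" "permutation_cdf N T z t \<le> 1"
proof -
  have "(\<Sum>\<pi> | \<pi> permutes {..<N}. if T (\<lambda>i. z (\<pi> i)) \<le> t then 1 else 0) \<le> (\<Sum>\<pi> | \<pi> permutes {..<N}. 1 :: real)"
    by (intro sum_mono) auto
  then show "permutation_cdf N T z t \<le> 1" by (simp add: permutation_cdf_def card_permutations)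
  show "0 \<le> permutation_cdf N T z t" unfolding permutation_cdf_def by (intro mult_nonneg_nonneg sum_nonneg) auto
qed

definition linearization_error ::
  "(nat \<Rightarrow> (nat \<Rightarrow> 'a) \<Rightarrow> real) \<Rightarrow> real \<Rightarrow> ('a \<Rightarrow> real) \<Rightarrow> nat \<Rightarrow> (nat \<Rightarrow> 'a) \<Rightarrow> real" where
  "linearization_error est t g r v = sqrt (real r) * (est r v - t) - 1 / sqrt (real r) * (\<Sum>i<r. g (v i))"

text \<open>The centering constant \<open>t\<close> cancels in the two-sample difference, so the value of the parameter is irrelevant.\<close>

lemma two_sample_stat_linearization:
  assumes mn: "0 < m" "0 < n"
  shows "two_sample_stat est m n z - mean_contrast m n (\<lambda>i. g (z i))
    = sqrt (real (m + n) / real m) * linearization_error est t g m (\<lambda>i\<in>{..<m}. z i)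
      - sqrt (real (m + n) / real n) * linearization_error est t g n (\<lambda>j\<in>{..<n}. z (m + j))"
proof -
  have lin: "sqrt (c / real r) * linearization_error est t g r v = sqrt c * (est r v - t - (\<Sum>i<r. g (v i)) / real r)"
    if "r > 0" for c r v
  proof -
    have "sqrt (real r) > 0" "sqrt (real r) * sqrt (real r) = real r" using that by auto
    then have scale: "sqrt (c / real r) * (1 / sqrt (real r)) = sqrt c / real r" "sqrt (c / real r) * sqrt (real r) = sqrt c"
      by (simp_all add: real_sqrt_divide)
    moreover have "a * (s * d - i * S) = (a * s) * d - (a * i) * S" for a s d i S :: real
      by (simp add: algebra_simps)
    ultimately show ?thesis
      unfolding linearization_error_def by (simp only:) (simp add: algebra_simps)
  qed
  have sums: "(\<Sum>i<m. g ((\<lambda>i\<in>{..<m}. z i) i)) = (\<Sum>i<m. g (z i))"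
    "(\<Sum>j<n. g ((\<lambda>j\<in>{..<n}. z (m + j)) j)) = (\<Sum>j<n. g (z (m + j)))"
    by (auto intro: sum.cong)
  show ?thesis
    unfolding lin[OF mn(1)] lin[OF mn(2)] two_sample_stat_def mean_contrast_def sums
    by (simp add: algebra_simps)
qed

text \<open>If |x| or |y| exceeds 1, the coefficients being at least 1 makes the right side at least
  1; otherwise this is the triangle inequality. The coefficients will be sqrt (N / m) and sqrt (N /
  n).\<close>

lemma min_one_diff_le:
  fixes a b x y :: real
  assumes "1 \<le> a" "1 \<le> b"
  shows "min 1 \<bar>a * x - b * y\<bar> \<le> a * min 1 \<bar>x\<bar> + b * min 1 \<bar>y\<bar>"
proof (cases "\<bar>x\<bar> \<le> 1 \<and> \<bar>y\<bar> \<le> 1")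
  case True
  have "min 1 \<bar>a * x - b * y\<bar> \<le> \<bar>a * x\<bar> + \<bar>b * y\<bar>" by linarith
  also have "\<dots> = a * min 1 \<bar>x\<bar> + b * min 1 \<bar>y\<bar>" using assms True by (simp add: abs_mult)
  finally show ?thesis .
next
  case False
  have "0 \<le> a * min 1 \<bar>x\<bar>" "0 \<le> b * min 1 \<bar>y\<bar>" using assms by auto
  moreover have "1 \<le> a * min 1 \<bar>x\<bar> \<or> 1 \<le> b * min 1 \<bar>y\<bar>" using False assms by auto
  ultimately show ?thesis by linarith
qed

section \<open>The pooled sample\<close>

text \<open>A single independent family indexed by a sum type expresses independence within each
  sample and between the two.\<close>

locale two_sample =
  fixes S P Q :: "'a measure" and M :: "'w measure" and X Y :: "nat \<Rightarrow> 'w \<Rightarrow> 'a" and p :: real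
  assumes M: "prob_space M" and ind: "prob_space.indep_vars M (\<lambda>_. S) (case_sum X Y) UNIV"
    and dist_X: "\<And>i. distr M S (X i) = P" and dist_Y: "\<And>j. distr M S (Y j) = Q"
    and p: "0 < p" "p < 1"
begin

sublocale prob_space M by (rule M)

lemma rv: "case_sum X Y i \<in> measurable M S"
  using ind by (auto simp: indep_vars_def2)

lemma rv_X [measurable]: "X i \<in> measurable M S" and rv_Y [measurable]: "Y i \<in> measurable M S"
  using rv[of "Inl i"] rv[of "Inr i"] by auto

lemma P: "prob_space P" "sets P = sets S" and Q: "prob_space Q" "sets Q = sets S"
  using prob_space_distr[OF rv_X[of 0]] prob_space_distr[OF rv_Y[of 0]] dist_X[of 0] dist_Y[of 0] sets_distr by metis+

lemma sets_QP: "sets Q = sets P" by (simp add: P Q)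

abbreviation "Pbar \<equiv> mixture p P Q"

lemma indep_X: "indep_vars (\<lambda>_. S) X UNIV" and indep_Y: "indep_vars (\<lambda>_. S) Y UNIV"
  using indep_vars_reindex_inj[of Inl UNIV "\<lambda>_. S" "case_sum X Y"] indep_vars_reindex_inj[of Inr UNIV "\<lambda>_. S" "case_sum X Y"]
    indep_vars_subset[OF ind] by (auto simp: inj_on_def)

lemma rv_pooled [measurable]: "(\<lambda>\<omega>. pooled_sample m X Y \<omega> i) \<in> measurable M S"
  by (cases "i < m") (simp_all add: pooled_sample_def)

lemma indep_pooled: "indep_vars (\<lambda>_. S) (\<lambda>i \<omega>. pooled_sample m X Y \<omega> i) {..<N}"
proof -
  define e where "e i = (if i < m then Inl i else Inr (i - m))" for i :: nat
  have "inj_on e {..<N}" by (auto simp: inj_on_def e_def split: if_splits)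
  from indep_vars_reindex_inj[OF this indep_vars_subset[OF ind]]
  have "indep_vars (\<lambda>_. S) (\<lambda>i. case_sum X Y (e i)) {..<N}" by simp
  moreover have "(\<lambda>i. case_sum X Y (e i)) = (\<lambda>i \<omega>. pooled_sample m X Y \<omega> i)"
    by (auto simp: fun_eq_iff e_def pooled_sample_def)
  ultimately show ?thesis by simp
qed

lemma dist_pooled: "distr M S (\<lambda>\<omega>. pooled_sample m X Y \<omega> i) = (if i < m then P else Q)"
  by (cases "i < m") (simp_all add: pooled_sample_def dist_X dist_Y)

lemma sum_pooled: "(\<Sum>j<m + n. h (pooled_sample m X Y \<omega> j)) = (\<Sum>i<m. h (X i \<omega>)) + (\<Sum>j<n. h (Y j \<omega>))"
proof -
  have "(\<Sum>j<m + n. h (pooled_sample m X Y \<omega> j))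
      = (\<Sum>j<m. h (pooled_sample m X Y \<omega> j)) + (\<Sum>j<n. h (pooled_sample m X Y \<omega> (m + j)))"
    by (induction n) (simp_all add: add.assoc)
  then show ?thesis by (simp add: pooled_sample_def)
qed

lemma integrable_comp:
  fixes h :: "'a \<Rightarrow> real"
  assumes "integrable Pbar h"
  shows "integrable M (\<lambda>\<omega>. h (X i \<omega>))" "integrable M (\<lambda>\<omega>. h (Y i \<omega>))"
proof -
  have "integrable P h" "integrable Q h" using integral_mixture[OF sets_QP p assms] by auto
  moreover have "h \<in> borel_measurable S"
    using borel_measurable_integrable[OF assms] by (simp add: measurable_cong_sets[OF P(2) refl] measurable_cong_sets[OF sets_mixture refl])
  ultimately show "integrable M (\<lambda>\<omega>. h (X i \<omega>))" "integrable M (\<lambda>\<omega>. h (Y i \<omega>))"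
    by (simp_all add: integrable_distr_eq flip: dist_X[of i] dist_Y[of i])
qed

text \<open>The pooled mean is the average of the two sample means with weights x = m / N and 1 - x,
  so its error consists of their two errors and of x - p times the difference of the two
  expectations.\<close>

lemma pooled_weak_law:
  fixes h :: "'a \<Rightarrow> real" and m n :: "nat \<Rightarrow> nat"
  assumes m: "filterlim m at_top sequentially" and n: "filterlim n at_top sequentially"
    and x: "(\<lambda>k. real (m k) / real (m k + n k)) \<longlonglongrightarrow> p" and h: "integrable Pbar h" and \<delta>: "\<delta> > 0"
  shows "(\<lambda>k. prob {\<omega>\<in>space M. \<bar>(\<Sum>j<m k + n k. h (pooled_sample (m k) X Y \<omega> j)) / real (m k + n k) - (LINT x|Pbar. h x)\<bar> \<ge> \<delta>})
    \<longlonglongrightarrow> 0"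
proof -
  define A where "A k \<omega> = (\<Sum>i<m k. h (X i \<omega>)) / real (m k) - (LINT x|P. h x)" for k \<omega>
  define B where "B k \<omega> = (\<Sum>i<n k. h (Y i \<omega>)) / real (n k) - (LINT x|Q. h x)" for k \<omega>
  define d where "d k = \<bar>real (m k) / real (m k + n k) - p\<bar> * (\<bar>LINT x|P. h x\<bar> + \<bar>LINT x|Q. h x\<bar>)" for k
  define F where "F k \<omega> = (\<Sum>j<m k + n k. h (pooled_sample (m k) X Y \<omega> j)) / real (m k + n k) - (LINT x|Pbar. h x)" for k \<omega>
  note mix = integral_mixture[OF sets_QP p h]
  note int = integrable_comp[OF h]
  have A_lim: "(\<lambda>k. expectation (\<lambda>\<omega>. \<bar>A k \<omega>\<bar>)) \<longlonglongrightarrow> 0"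
    unfolding A_def by (rule filterlim_compose[OF weak_law_L1[OF indep_X dist_X mix(1)] m])
  have B_lim: "(\<lambda>k. expectation (\<lambda>\<omega>. \<bar>B k \<omega>\<bar>)) \<longlonglongrightarrow> 0"
    unfolding B_def by (rule filterlim_compose[OF weak_law_L1[OF indep_Y dist_Y mix(2)] n])
  have "d \<longlonglongrightarrow> \<bar>p - p\<bar> * (\<bar>LINT x|P. h x\<bar> + \<bar>LINT x|Q. h x\<bar>)"
    unfolding d_def by (intro tendsto_intros x)
  then have d_lim: "d \<longlonglongrightarrow> 0" by simp
  have intA: "integrable M (A k)" and intB: "integrable M (B k)" for k
    unfolding A_def[abs_def] B_def[abs_def] using int by auto
  have intF: "integrable M (F k)" for k
    unfolding F_def[abs_def] sum_pooled using int by auto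
  have le: "\<bar>F k \<omega>\<bar> \<le> \<bar>A k \<omega>\<bar> + \<bar>B k \<omega>\<bar> + d k" if mn: "m k > 0" "n k > 0" for k \<omega>
  proof -
    define x where "x = real (m k) / real (m k + n k)"
    have x1: "1 - x = real (n k) / real (m k + n k)" using mn by (simp add: x_def field_simps)
    have x01: "0 \<le> x" "x \<le> 1" using mn by (auto simp: x_def)
    have "F k \<omega> = x * ((\<Sum>i<m k. h (X i \<omega>)) / real (m k)) + (1 - x) * ((\<Sum>i<n k. h (Y i \<omega>)) / real (n k))
        - (p * (LINT x|P. h x) + (1 - p) * (LINT x|Q. h x))"
      unfolding F_def sum_pooled mix(3) x1 using mn by (simp add: x_def add_divide_distrib)
    also have "\<dots> = x * A k \<omega> + (1 - x) * B k \<omega> + (x - p) * ((LINT x|P. h x) - (LINT x|Q. h x))"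
      unfolding A_def B_def by (simp add: algebra_simps)
    also have "\<bar>\<dots>\<bar> \<le> \<bar>x * A k \<omega>\<bar> + \<bar>(1 - x) * B k \<omega>\<bar> + \<bar>(x - p) * ((LINT x|P. h x) - (LINT x|Q. h x))\<bar>" by linarith
    also have "\<dots> \<le> \<bar>A k \<omega>\<bar> + \<bar>B k \<omega>\<bar> + d k"
      unfolding abs_mult d_def x_def[symmetric] using x01
      by (intro add_mono mult_left_mono mult_left_le_one_le) auto
    finally show ?thesis .
  qed
  have "(\<lambda>k. expectation (\<lambda>\<omega>. \<bar>F k \<omega>\<bar>)) \<longlonglongrightarrow> 0"
  proof (rule tendsto_sandwich[OF _ _ tendsto_const])
    show "eventually (\<lambda>k. expectation (\<lambda>\<omega>. \<bar>F k \<omega>\<bar>) \<le> expectation (\<lambda>\<omega>. \<bar>A k \<omega>\<bar>) + expectation (\<lambda>\<omega>. \<bar>B k \<omega>\<bar>) + d k) sequentially"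
      using eventually_compose_filterlim[OF eventually_gt_at_top[of 0] m] eventually_compose_filterlim[OF eventually_gt_at_top[of 0] n]
    proof eventually_elim
      case (elim k)
      have "expectation (\<lambda>\<omega>. \<bar>F k \<omega>\<bar>) \<le> expectation (\<lambda>\<omega>. \<bar>A k \<omega>\<bar> + \<bar>B k \<omega>\<bar> + d k)"
        using intA intB intF elim le by (intro integral_mono) auto
      also have "\<dots> = expectation (\<lambda>\<omega>. \<bar>A k \<omega>\<bar>) + expectation (\<lambda>\<omega>. \<bar>B k \<omega>\<bar>) + d k"
        using intA[of k] intB[of k] by (simp add: prob_space)
      finally show ?case .
    qed
    show "(\<lambda>k. expectation (\<lambda>\<omega>. \<bar>A k \<omega>\<bar>) + expectation (\<lambda>\<omega>. \<bar>B k \<omega>\<bar>) + d k) \<longlonglongrightarrow> 0"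
      using tendsto_add[OF tendsto_add[OF A_lim B_lim] d_lim] by simp
    show "eventually (\<lambda>k. 0 \<le> expectation (\<lambda>\<omega>. \<bar>F k \<omega>\<bar>)) sequentially"
      by (rule always_eventually, rule allI, rule integral_nonneg_AE) simp
  qed
  then have "(\<lambda>k. prob {\<omega>\<in>space M. \<bar>F k \<omega>\<bar> \<ge> \<delta>}) \<longlonglongrightarrow> 0"
    using intF \<delta> by (intro prob_ge_tendsto_zero) auto
  then show ?thesis by (simp only: F_def)
qed

text \<open>Squaring turns the threshold into \<delta>^2 N, which is at least \<delta>^2 times the
  size of either sample, so \<open>max_negligible\<close> applies to each of them.\<close>

lemma pooled_max_negligible:
  fixes g :: "'a \<Rightarrow> real" and m n :: "nat \<Rightarrow> nat"
  assumes m: "filterlim m at_top sequentially" and n: "filterlim n at_top sequentially"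
    and g: "g \<in> borel_measurable S" and g2: "integrable Pbar (\<lambda>x. (g x)\<^sup>2)" and \<delta>: "\<delta> > 0"
  shows "(\<lambda>k. prob {\<omega>\<in>space M. \<exists>j<m k + n k. \<bar>g (pooled_sample (m k) X Y \<omega> j)\<bar> > \<delta> * sqrt (real (m k + n k))})
    \<longlonglongrightarrow> 0"
proof -
  note [measurable] = g
  note mix = integral_mixture[OF sets_QP p g2]
  define A where "A m = {\<omega>\<in>space M. \<exists>i<m. \<bar>(g (X i \<omega>))\<^sup>2\<bar> > \<delta>\<^sup>2 * real m}" for m
  define B where "B n = {\<omega>\<in>space M. \<exists>i<n. \<bar>(g (Y i \<omega>))\<^sup>2\<bar> > \<delta>\<^sup>2 * real n}" for n
  have [measurable]: "A m \<in> sets M" "B n \<in> sets M" for m n unfolding A_def B_def by measurable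
  have A_lim: "(\<lambda>k. prob (A (m k))) \<longlonglongrightarrow> 0"
    unfolding A_def using \<delta> by (intro filterlim_compose[OF max_negligible[OF rv_X dist_X mix(1)] m]) simp
  have B_lim: "(\<lambda>k. prob (B (n k))) \<longlonglongrightarrow> 0"
    unfolding B_def using \<delta> by (intro filterlim_compose[OF max_negligible[OF rv_Y dist_Y mix(2)] n]) simp
  have sq: "\<delta>\<^sup>2 * real r < \<bar>z\<^sup>2\<bar>" if "\<delta> * sqrt N < \<bar>z\<bar>" "real r \<le> N" for r N z
  proof -
    have "(\<delta> * sqrt N)\<^sup>2 < \<bar>z\<bar>\<^sup>2" using that \<delta> by (intro power_strict_mono) auto
    moreover have "\<delta>\<^sup>2 * real r \<le> \<delta>\<^sup>2 * N" using that by (intro mult_left_mono) auto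
    ultimately show ?thesis using that by (simp add: power_mult_distrib)
  qed
  have "prob {\<omega>\<in>space M. \<exists>j<m k + n k. \<bar>g (pooled_sample (m k) X Y \<omega> j)\<bar> > \<delta> * sqrt (real (m k + n k))}
      \<le> prob (A (m k)) + prob (B (n k))" for k
  proof -
    have "{\<omega>\<in>space M. \<exists>j<m k + n k. \<bar>g (pooled_sample (m k) X Y \<omega> j)\<bar> > \<delta> * sqrt (real (m k + n k))} \<subseteq> A (m k) \<union> B (n k)"
    proof safe
      fix \<omega> j assume \<omega>: "\<omega> \<in> space M" "\<omega> \<notin> B (n k)" and j: "j < m k + n k"
        and gt: "\<delta> * sqrt (real (m k + n k)) < \<bar>g (pooled_sample (m k) X Y \<omega> j)\<bar>"
      show "\<omega> \<in> A (m k)"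
      proof (cases "j < m k")
        case True
        then show ?thesis using \<omega> sq[OF gt, of "m k"] by (auto simp: A_def pooled_sample_def)
      next
        case False
        then have "\<omega> \<in> B (n k)" using \<omega> j sq[OF gt, of "n k"]
          by (auto simp: B_def pooled_sample_def intro!: exI[of _ "j - m k"])
        then show ?thesis using \<omega> by blast
      qed
    qed
    then have "prob {\<omega>\<in>space M. \<exists>j<m k + n k. \<bar>g (pooled_sample (m k) X Y \<omega> j)\<bar> > \<delta> * sqrt (real (m k + n k))} \<le> prob (A (m k) \<union> B (n k))"
      by (intro finite_measure_mono) auto
    also have "\<dots> \<le> prob (A (m k)) + prob (B (n k))" by (rule measure_Un_le) auto
    finally show ?thesis .
  qed
  note le = this
  have lim: "(\<lambda>k. prob (A (m k)) + prob (B (n k))) \<longlonglongrightarrow> 0"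
    using tendsto_add[OF A_lim B_lim] by simp
  show ?thesis
    by (rule tendsto_sandwich[OF _ always_eventually[OF allI[OF le]] tendsto_const lim]) simp
qed

end

section \<open>The linearization gap\<close>

context two_sample
begin

lemma measurable_S:
  fixes h :: "'a \<Rightarrow> real"
  assumes "h \<in> borel_measurable Pbar"
  shows "h \<in> borel_measurable S"
  using assms by (simp add: measurable_cong_sets[OF P(2) refl] measurable_cong_sets[OF sets_mixture refl])

lemma prob_space_Pbar: "prob_space Pbar"
  using prob_space_mixture[OF P(1) Q(1) sets_QP] p by simp

lemma sets_PiM_Pbar: "sets (\<Pi>\<^sub>M i\<in>I. Pbar) = sets (\<Pi>\<^sub>M i\<in>I. S)"
  by (intro sets_PiM_cong) (auto simp: P)

lemma linearization_error_measurable: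
  assumes est: "est r \<in> borel_measurable (\<Pi>\<^sub>M i\<in>{..<r}. S)" and g: "g \<in> borel_measurable S"
  shows "linearization_error est t g r \<in> borel_measurable (\<Pi>\<^sub>M i\<in>{..<r}. S)"
proof -
  note [measurable] = est g
  show ?thesis unfolding linearization_error_def[abs_def] by measurable
qed

lemma permuted_pooled_measurable:
  "(\<lambda>\<omega>. \<lambda>i\<in>I. pooled_sample m X Y \<omega> (f i)) \<in> measurable M (\<Pi>\<^sub>M i\<in>I. S)"
  by (intro measurable_restrict rv_pooled)

text \<open>Real-valued form of the domination for a function bounded by 1. The map \<open>e\<close>
  will be the identity for the first block and the shift by \<open>m\<close> for the second.\<close>

lemma block_error_le:
  assumes est: "est r \<in> borel_measurable (\<Pi>\<^sub>M i\<in>{..<r}. S)" and g: "g \<in> borel_measurable S"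
    and e: "inj_on e {..<r}" "e ` {..<r} \<subseteq> {..<N}" and r: "0 < r" "r < N" and m: "0 < m" "m < N"
    and c: "\<bar>real m / real N - p\<bar> \<le> c / sqrt (real N)"
  shows "(\<Sum>\<pi> | \<pi> permutes {..<N}. expectation (\<lambda>\<omega>. min 1 \<bar>linearization_error est t g r (\<lambda>i\<in>{..<r}. pooled_sample m X Y \<omega> (\<pi> (e i)))\<bar>))
    \<le> fact N * (12 * exp (c\<^sup>2 / (p * (1 - p))) / sqrt (p * (1 - p)) * sqrt (real N / real (N - r)))
      * (LINT v|(\<Pi>\<^sub>M i\<in>{..<r}. Pbar). min 1 \<bar>linearization_error est t g r v\<bar>)"
    (is "?L \<le> ?K * ?R")
proof -
  define u where "u v = min 1 \<bar>linearization_error est t g r v\<bar>" for v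
  have u: "u \<in> borel_measurable (\<Pi>\<^sub>M i\<in>{..<r}. S)"
    using linearization_error_measurable[where est = est, OF est g] unfolding u_def[abs_def] by measurable
  then have u': "u \<in> borel_measurable (\<Pi>\<^sub>M i\<in>{..<r}. Pbar)"
    by (simp add: measurable_cong_sets[OF sets_PiM_Pbar refl])
  have u01: "0 \<le> u v" "u v \<le> 1" for v by (auto simp: u_def)
  have uM: "(\<lambda>\<omega>. u (\<lambda>i\<in>{..<r}. pooled_sample m X Y \<omega> (\<pi> (e i)))) \<in> borel_measurable M" for \<pi>
    by (rule measurable_compose[OF permuted_pooled_measurable u])
  interpret Pi: prob_space "\<Pi>\<^sub>M i\<in>{..<r}. Pbar" by (intro prob_space_PiM prob_space_Pbar)
  have K: "?K \<ge> 0" using p by simp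
  have "ennreal ?L = (\<Sum>\<pi> | \<pi> permutes {..<N}. ennreal (expectation (\<lambda>\<omega>. u (\<lambda>i\<in>{..<r}. pooled_sample m X Y \<omega> (\<pi> (e i))))))"
    unfolding u_def[symmetric] by (rule sum_ennreal[symmetric], rule integral_nonneg_AE) (simp add: u01)
  also have "\<dots> = (\<Sum>\<pi> | \<pi> permutes {..<N}. \<integral>\<^sup>+\<omega>. ennreal (u (\<lambda>i\<in>{..<r}. pooled_sample m X Y \<omega> (\<pi> (e i)))) \<partial>M)"
    using u01 uM by (intro sum.cong refl nn_integral_eq_integral[symmetric] integrable_const_bound[where B = 1]) auto
  also have "\<dots> \<le> ennreal ?K * (\<integral>\<^sup>+v. ennreal (u v) \<partial>(\<Pi>\<^sub>M i\<in>{..<r}. Pbar))"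
    using u by (intro permuted_sample_dominated[OF indep_pooled dist_pooled P(1) Q(1) P(2) Q(2) e r m p c]) auto
  also have "(\<integral>\<^sup>+v. ennreal (u v) \<partial>(\<Pi>\<^sub>M i\<in>{..<r}. Pbar)) = ennreal ?R"
    unfolding u_def[symmetric] using u01 u'
    by (intro nn_integral_eq_integral Pi.integrable_const_bound[where B = 1]) auto
  also have "ennreal ?K * ennreal ?R = ennreal (?K * ?R)"
    using K by (intro ennreal_mult[symmetric]) (auto intro!: integral_nonneg_AE)
  finally have "ennreal ?L \<le> ennreal (?K * ?R)" .
  moreover have "0 \<le> ?K * ?R" by (rule mult_nonneg_nonneg[OF K]) (rule integral_nonneg_AE, simp)
  ultimately show ?thesis using ennreal_le_iff by blast
qed

text \<open>The conditional mean, given the data, of the truncated difference between the permuted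
  statistic and its linearization: the quantity in the last hypothesis of
  \<open>permutation_clt_uniform\<close>.\<close>

definition linear_gap ::
  "(nat \<Rightarrow> (nat \<Rightarrow> 'a) \<Rightarrow> real) \<Rightarrow> ('a \<Rightarrow> real) \<Rightarrow> nat \<Rightarrow> nat \<Rightarrow> 'w \<Rightarrow> real" where
  "linear_gap est g m n \<omega> = (\<Sum>\<pi> | \<pi> permutes {..<m + n}.
     min 1 \<bar>two_sample_stat est m n (\<lambda>i. pooled_sample m X Y \<omega> (\<pi> i))
       - mean_contrast m n (\<lambda>i. g (pooled_sample m X Y \<omega> (\<pi> i)))\<bar>) / fact (m + n)"

lemma two_sample_stat_measurable:
  assumes est: "\<And>r. est r \<in> borel_measurable (\<Pi>\<^sub>M i\<in>{..<r}. S)"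
  shows "(\<lambda>\<omega>. two_sample_stat est m n (\<lambda>i. pooled_sample l X Y \<omega> (\<pi> i))) \<in> borel_measurable M"
  unfolding two_sample_stat_def
  by (intro borel_measurable_times borel_measurable_diff borel_measurable_const
      measurable_compose[OF permuted_pooled_measurable est])

lemma linear_gap_measurable:
  assumes est: "\<And>r. est r \<in> borel_measurable (\<Pi>\<^sub>M i\<in>{..<r}. S)" and g: "g \<in> borel_measurable S"
  shows "linear_gap est g m n \<in> borel_measurable M"
proof -
  note [measurable] = g two_sample_stat_measurable[OF est]
  show ?thesis unfolding linear_gap_def[abs_def] mean_contrast_def by measurable
qed

lemma linear_gap_bounds: "0 \<le> linear_gap est g m n \<omega>" "linear_gap est g m n \<omega> \<le> 1"
proof -
  show "0 \<le> linear_gap est g m n \<omega>" unfolding linear_gap_def by (intro divide_nonneg_nonneg sum_nonneg) auto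
  have "(\<Sum>\<pi> | \<pi> permutes {..<m + n}. min 1 \<bar>two_sample_stat est m n (\<lambda>i. pooled_sample m X Y \<omega> (\<pi> i))
      - mean_contrast m n (\<lambda>i. g (pooled_sample m X Y \<omega> (\<pi> i)))\<bar>) \<le> (\<Sum>\<pi> | \<pi> permutes {..<m + n}. 1)"
    by (intro sum_mono) auto
  then show "linear_gap est g m n \<omega> \<le> 1" by (simp add: linear_gap_def card_permutations)
qed

text \<open>The first block carries sqrt (N / m) from the scaling of its error and sqrt (N / (N -
  m)) = sqrt (N / n) from the domination; for the second block the roles are exchanged. Both thus
  get the same product.\<close>

lemma expectation_linear_gap_le:
  assumes est: "\<And>r. est r \<in> borel_measurable (\<Pi>\<^sub>M i\<in>{..<r}. S)" and g: "g \<in> borel_measurable S"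
    and mn: "0 < m" "0 < n" and c: "\<bar>real m / real (m + n) - p\<bar> \<le> c / sqrt (real (m + n))"
  shows "expectation (linear_gap est g m n)
    \<le> 12 * exp (c\<^sup>2 / (p * (1 - p))) / sqrt (p * (1 - p)) * (sqrt (real (m + n) / real m) * sqrt (real (m + n) / real n))
      * ((LINT v|(\<Pi>\<^sub>M i\<in>{..<m}. Pbar). min 1 \<bar>linearization_error est t g m v\<bar>)
        + (LINT v|(\<Pi>\<^sub>M i\<in>{..<n}. Pbar). min 1 \<bar>linearization_error est t g n v\<bar>))"
proof -
  define N where "N = m + n"
  define K where "K = 12 * exp (c\<^sup>2 / (p * (1 - p))) / sqrt (p * (1 - p))"
  define a where "a = sqrt (real N / real m)"
  define b where "b = sqrt (real N / real n)"
  define Em where "Em = (LINT v|(\<Pi>\<^sub>M i\<in>{..<m}. Pbar). min 1 \<bar>linearization_error est t g m v\<bar>)"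
  define En where "En = (LINT v|(\<Pi>\<^sub>M i\<in>{..<n}. Pbar). min 1 \<bar>linearization_error est t g n v\<bar>)"
  define U1 where "U1 \<pi> \<omega> = min 1 \<bar>linearization_error est t g m (\<lambda>i\<in>{..<m}. pooled_sample m X Y \<omega> (\<pi> i))\<bar>" for \<pi> \<omega>
  define U2 where "U2 \<pi> \<omega> = min 1 \<bar>linearization_error est t g n (\<lambda>j\<in>{..<n}. pooled_sample m X Y \<omega> (\<pi> (m + j)))\<bar>" for \<pi> \<omega>
  have N: "m < N" "n < N" "N - m = n" "N - n = m" using mn by (auto simp: N_def)
  have ab: "1 \<le> a" "1 \<le> b" using mn N by (auto simp: a_def b_def)
  have "U1 \<pi> \<in> borel_measurable M" "U2 \<pi> \<in> borel_measurable M" for \<pi>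
    unfolding U1_def[abs_def] U2_def[abs_def]
    by (intro borel_measurable_min borel_measurable_abs borel_measurable_const
        measurable_compose[OF permuted_pooled_measurable linearization_error_measurable[where est = est, OF est g]])+
  then have int: "integrable M (U1 \<pi>)" "integrable M (U2 \<pi>)" for \<pi>
    by (auto intro!: integrable_const_bound[where B = 1] simp: U1_def U2_def)
  have "linear_gap est g m n \<omega> \<le> (\<Sum>\<pi> | \<pi> permutes {..<N}. a * U1 \<pi> \<omega> + b * U2 \<pi> \<omega>) / fact N" for \<omega>
    unfolding linear_gap_def N_def[symmetric]
  proof (intro divide_right_mono sum_mono)
    fix \<pi>
    show "min 1 \<bar>two_sample_stat est m n (\<lambda>i. pooled_sample m X Y \<omega> (\<pi> i))
       - mean_contrast m n (\<lambda>i. g (pooled_sample m X Y \<omega> (\<pi> i)))\<bar> \<le> a * U1 \<pi> \<omega> + b * U2 \<pi> \<omega>"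
      using two_sample_stat_linearization[OF mn, of est "\<lambda>i. pooled_sample m X Y \<omega> (\<pi> i)" g t] min_one_diff_le[OF ab]
      by (simp only: U1_def U2_def a_def b_def N_def)
  qed simp
  then have "expectation (linear_gap est g m n) \<le> expectation (\<lambda>\<omega>. (\<Sum>\<pi> | \<pi> permutes {..<N}. a * U1 \<pi> \<omega> + b * U2 \<pi> \<omega>) / fact N)"
    using int linear_gap_measurable[OF est g] linear_gap_bounds
    by (intro integral_mono integrable_const_bound[where B = 1 and f = "linear_gap est g m n"]) auto
  also have "\<dots> = (a * (\<Sum>\<pi> | \<pi> permutes {..<N}. expectation (U1 \<pi>)) + b * (\<Sum>\<pi> | \<pi> permutes {..<N}. expectation (U2 \<pi>))) / fact N"
    using int by (simp add: integral_sum sum.distrib sum_distrib_left)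
  also have "\<dots> \<le> (a * (fact N * (K * b) * Em) + b * (fact N * (K * a) * En)) / fact N"
  proof (intro divide_right_mono add_mono mult_left_mono)
    have "(\<Sum>\<pi> | \<pi> permutes {..<N}. expectation (U1 \<pi>)) \<le> fact N * (K * sqrt (real N / real (N - m))) * Em"
      unfolding U1_def K_def Em_def
      by (rule block_error_le[where est = est, OF est g, where e = "\<lambda>i. i"]) (use mn c in \<open>auto simp: N_def\<close>)
    then show "(\<Sum>\<pi> | \<pi> permutes {..<N}. expectation (U1 \<pi>)) \<le> fact N * (K * b) * Em" by (simp add: b_def N)
    have "(\<Sum>\<pi> | \<pi> permutes {..<N}. expectation (U2 \<pi>)) \<le> fact N * (K * sqrt (real N / real (N - n))) * En"
      unfolding U2_def K_def En_def
      by (rule block_error_le[where est = est, OF est g, where e = "\<lambda>j. m + j"]) (use mn c in \<open>auto simp: N_def\<close>)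
    then show "(\<Sum>\<pi> | \<pi> permutes {..<N}. expectation (U2 \<pi>)) \<le> fact N * (K * a) * En" by (simp add: a_def N)
  qed (use ab in auto)
  also have "\<dots> = K * (a * b) * (Em + En)" by (simp add: field_simps)
  finally show ?thesis by (simp only: K_def a_def b_def N_def Em_def En_def)
qed

text \<open>Asymptotic linearity is stated on the infinite product, the domination on finite ones;
  restriction to the first \<open>r\<close> coordinates carries the former law to the
  latter.\<close>

lemma mean_linearization_error_tendsto:
  assumes est: "\<And>r. est r \<in> borel_measurable (\<Pi>\<^sub>M i\<in>{..<r}. S)" and al: "asymptotically_linear est \<theta> Pbar g"
  shows "(\<lambda>r. LINT v|(\<Pi>\<^sub>M i\<in>{..<r}. Pbar). min 1 \<bar>linearization_error est (\<theta> Pbar) g r v\<bar>) \<longlonglongrightarrow> 0"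
proof -
  interpret Pb: prob_space Pbar by (rule prob_space_Pbar)
  interpret pp: product_prob_space "\<lambda>_. Pbar" "UNIV :: nat set" ..
  define Z where "Z r V = sqrt (real r) * (est r (restrict V {..<r}) - \<theta> Pbar)
               - 1 / sqrt (real r) * (\<Sum>i<r. g (V i))" for r V
  have g: "g \<in> borel_measurable S" using al by (intro measurable_S) (simp add: asymptotically_linear_def)
  have "(LINT v|(\<Pi>\<^sub>M i\<in>{..<r}. Pbar). min 1 \<bar>linearization_error est (\<theta> Pbar) g r v\<bar>)
      = (LINT V|(\<Pi>\<^sub>M i\<in>UNIV. Pbar). min 1 \<bar>Z r V\<bar>)" for r
  proof -
    have meas: "linearization_error est (\<theta> Pbar) g r \<in> borel_measurable (\<Pi>\<^sub>M i\<in>{..<r}. Pbar)"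
      using linearization_error_measurable[where est = est, OF est g] by (simp add: measurable_cong_sets[OF sets_PiM_Pbar refl])
    have "(\<Pi>\<^sub>M i\<in>{..<r}. Pbar) = distr (\<Pi>\<^sub>M i\<in>UNIV. Pbar) (\<Pi>\<^sub>M i\<in>{..<r}. Pbar) (\<lambda>V. restrict V {..<r})"
      by (rule pp.distr_PiM_restrict_finite[symmetric]) auto
    then have "(LINT v|(\<Pi>\<^sub>M i\<in>{..<r}. Pbar). min 1 \<bar>linearization_error est (\<theta> Pbar) g r v\<bar>)
        = (LINT v|distr (\<Pi>\<^sub>M i\<in>UNIV. Pbar) (\<Pi>\<^sub>M i\<in>{..<r}. Pbar) (\<lambda>V. restrict V {..<r}). min 1 \<bar>linearization_error est (\<theta> Pbar) g r v\<bar>)"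
      by simp
    also have "\<dots> = (LINT V|(\<Pi>\<^sub>M i\<in>UNIV. Pbar). min 1 \<bar>linearization_error est (\<theta> Pbar) g r (restrict V {..<r})\<bar>)"
      using meas by (intro integral_distr measurable_restrict_subset) auto
    also have "\<dots> = (LINT V|(\<Pi>\<^sub>M i\<in>UNIV. Pbar). min 1 \<bar>Z r V\<bar>)"
      by (simp add: linearization_error_def Z_def)
    finally show ?thesis .
  qed
  moreover have "converges_in_prob (\<Pi>\<^sub>M i\<in>UNIV. Pbar) Z 0"
    using al unfolding asymptotically_linear_def Z_def[abs_def] by blast
  then have "(\<lambda>r. LINT V|(\<Pi>\<^sub>M i\<in>UNIV. Pbar). min 1 \<bar>Z r V\<bar>) \<longlonglongrightarrow> 0"
    by (intro converges_in_prob_truncated_mean pp.prob_space_axioms)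
  ultimately show ?thesis by simp
qed

lemma linear_gap_negligible:
  fixes m n :: "nat \<Rightarrow> nat"
  assumes est: "\<And>r. est r \<in> borel_measurable (\<Pi>\<^sub>M i\<in>{..<r}. S)" and al: "asymptotically_linear est \<theta> Pbar g"
    and m: "filterlim m at_top sequentially" and n: "filterlim n at_top sequentially"
    and x: "(\<lambda>k. real (m k) / real (m k + n k)) \<longlonglongrightarrow> p"
    and rate: "(\<lambda>k. real (m k) / real (m k + n k) - p) \<in> O(\<lambda>k. 1 / sqrt (real (m k + n k)))" and \<delta>: "\<delta> > 0"
  shows "(\<lambda>k. prob {\<omega>\<in>space M. linear_gap est g (m k) (n k) \<omega> \<ge> \<delta>}) \<longlonglongrightarrow> 0"
proof (rule prob_ge_tendsto_zero[OF _ linear_gap_bounds(1) _ \<delta>])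
  have g: "g \<in> borel_measurable S" using al by (intro measurable_S) (simp add: asymptotically_linear_def)
  show "integrable M (linear_gap est g (m k) (n k))" for k
    using linear_gap_measurable[OF est g] linear_gap_bounds by (intro integrable_const_bound[where B = 1]) auto
  \<comment> \<open>The rate supplies one \<open>c\<close> for all large \<open>k\<close>, so the
    constant \<open>K\<close> in the domination does not depend on \<open>k\<close>.\<close>
  obtain c where c: "eventually (\<lambda>k. norm (real (m k) / real (m k + n k) - p) \<le> c * norm (1 / sqrt (real (m k + n k)))) sequentially"
    using rate by (rule landau_o.bigE)
  define E where "E r = (LINT v|(\<Pi>\<^sub>M i\<in>{..<r}. Pbar). min 1 \<bar>linearization_error est (\<theta> Pbar) g r v\<bar>)" for r
  have E: "E \<longlonglongrightarrow> 0" unfolding E_def by (rule mean_linearization_error_tendsto[OF est al])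
  define K where "K = 12 * exp (c\<^sup>2 / (p * (1 - p))) / sqrt (p * (1 - p))"
  define x where "x k = real (m k) / real (m k + n k)" for k
  have x_lim: "x \<longlonglongrightarrow> p" using x by (simp only: x_def[abs_def])
  have m0: "eventually (\<lambda>k. 0 < m k) sequentially" by (rule eventually_compose_filterlim[OF eventually_gt_at_top m])
  have n0: "eventually (\<lambda>k. 0 < n k) sequentially" by (rule eventually_compose_filterlim[OF eventually_gt_at_top n])
  have "(\<lambda>k. K * (sqrt (1 / x k) * sqrt (1 / (1 - x k))) * (E (m k) + E (n k))) \<longlonglongrightarrow> K * (sqrt (1 / p) * sqrt (1 / (1 - p))) * (0 + 0)"
    using p by (intro tendsto_intros x_lim filterlim_compose[OF E m] filterlim_compose[OF E n]) auto
  then have lim: "(\<lambda>k. K * (sqrt (1 / x k) * sqrt (1 / (1 - x k))) * (E (m k) + E (n k))) \<longlonglongrightarrow> 0" by simp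
  show "(\<lambda>k. expectation (linear_gap est g (m k) (n k))) \<longlonglongrightarrow> 0"
  proof (rule tendsto_sandwich[OF _ _ tendsto_const lim])
    show "eventually (\<lambda>k. expectation (linear_gap est g (m k) (n k)) \<le> K * (sqrt (1 / x k) * sqrt (1 / (1 - x k))) * (E (m k) + E (n k))) sequentially"
      using c m0 n0
    proof eventually_elim
      case (elim k)
      have "1 / x k = real (m k + n k) / real (m k)" "1 / (1 - x k) = real (m k + n k) / real (n k)"
        using elim by (auto simp: x_def field_simps)
      moreover have "\<bar>real (m k) / real (m k + n k) - p\<bar> \<le> c / sqrt (real (m k + n k))" using elim by simp
      ultimately show ?case
        using expectation_linear_gap_le[OF est g elim(2,3), of c "\<theta> Pbar"] by (simp only: K_def E_def)
    qed
    show "eventually (\<lambda>k. 0 \<le> expectation (linear_gap est g (m k) (n k))) sequentially"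
      by (rule always_eventually, rule allI, rule integral_nonneg_AE) (simp add: linear_gap_bounds)
  qed
qed

end

section \<open>Measurability of the supremum distance and the final assembly\<close>

lemma sup_cdf_distance_measurable:
  assumes Z: "\<And>\<pi>. \<pi> permutes {..<N} \<Longrightarrow> (\<lambda>\<omega>. T (\<lambda>i. Z \<omega> (\<pi> i))) \<in> borel_measurable M" and \<tau>: "\<tau> > 0"
  shows "(\<lambda>\<omega>. SUP t. \<bar>permutation_cdf N T (Z \<omega>) t - cdf std_normal_distribution (t / \<tau>)\<bar>) \<in> borel_measurable M"
proof (rule borel_measurable_cSUP_right_continuous)
  interpret real_distribution std_normal_distribution by (rule real_dist_normal_dist)
  show "\<bar>permutation_cdf N T (Z \<omega>) t - cdf std_normal_distribution (t / \<tau>)\<bar> \<le> 1" for \<omega> t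
    using permutation_cdf_bounds[of N T "Z \<omega>" t] cdf_nonneg[of "t / \<tau>"] cdf_bounded_prob[of "t / \<tau>"] by linarith
  show "(\<lambda>\<omega>. \<bar>permutation_cdf N T (Z \<omega>) t - cdf std_normal_distribution (t / \<tau>)\<bar>) \<in> borel_measurable M" for t
  proof -
    have "(\<lambda>\<omega>. if T (\<lambda>i. Z \<omega> (\<pi> i)) \<le> t then 1 else 0 :: real) \<in> borel_measurable M" if "\<pi> \<in> {\<pi>. \<pi> permutes {..<N}}" for \<pi>
    proof -
      have [measurable]: "(\<lambda>\<omega>. T (\<lambda>i. Z \<omega> (\<pi> i))) \<in> borel_measurable M" using that by (intro Z) simp
      show ?thesis by measurable
    qed
    then show ?thesis
      unfolding permutation_cdf_def
      by (intro borel_measurable_abs borel_measurable_diff borel_measurable_times borel_measurable_const borel_measurable_sum)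
  qed
  show "continuous (at_right t) (\<lambda>t. \<bar>permutation_cdf N T (Z \<omega>) t - cdf std_normal_distribution (t / \<tau>)\<bar>)" for \<omega> t
  proof -
    have "isCont (\<lambda>t. cdf std_normal_distribution (t / \<tau>)) t"
      by (rule isCont_o2[OF _ continuous_cdf_std_normal]) (use \<tau> in auto)
    then have "continuous (at_right t) (\<lambda>t. cdf std_normal_distribution (t / \<tau>))"
      by (rule continuous_at_imp_continuous_at_within)
    then show ?thesis
      by (intro continuous_rabs continuous_diff continuous_at_right_permutation_cdf)
  qed
qed

theorem theorem2p1:
  fixes S P Q Pbar :: "'a measure"
    and \<P> :: "'a measure set"
    and \<theta> :: "'a measure \<Rightarrow> real"
    and est :: "nat \<Rightarrow> (nat \<Rightarrow> 'a) \<Rightarrow> real"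
    and f :: "'a measure \<Rightarrow> 'a \<Rightarrow> real"
    and M :: "'w measure"
    and X Y :: "nat \<Rightarrow> 'w \<Rightarrow> 'a"
    and m n :: "nat \<Rightarrow> nat"
    and p :: real
  assumes "\<P> \<subseteq> space (prob_algebra S)"
    and "\<And>r. est r \<in> borel_measurable (\<Pi>\<^sub>M i\<in>{..<r}. S)"
    and "P \<in> \<P>" and "Q \<in> \<P>"
    and "prob_space M"
    and "prob_space.indep_vars M (\<lambda>_. S) (case_sum X Y) UNIV"
    and "\<And>i. distr M S (X i) = P" and "\<And>j. distr M S (Y j) = Q"
    and "filterlim m at_top sequentially" and "filterlim n at_top sequentially"
    and "0 < p" and "p < 1"
    and "(\<lambda>k. real (m k) / real (m k + n k)) \<longlonglongrightarrow> p"
    and "(\<lambda>k. real (m k) / real (m k + n k) - p) \<in> O(\<lambda>k. 1 / sqrt (real (m k + n k)))"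
    and "Pbar = mixture p P Q" and "Pbar \<in> \<P>"
    and "\<And>R. R \<in> {P, Q, Pbar} \<Longrightarrow> asymptotically_linear est \<theta> R (f R)"
  shows "converges_in_prob M
    (\<lambda>k \<omega>. SUP t. \<bar>permutation_cdf (m k + n k) (two_sample_stat est (m k) (n k))
                        (pooled_sample (m k) X Y \<omega>) t
                    - cdf std_normal_distribution
                        (t / sqrt (1 / (p * (1 - p)) * (LINT x|Pbar. (f Pbar x)\<^sup>2)))\<bar>) 0"
proof -
  interpret ts: two_sample S P Q M X Y p by (rule two_sample.intro) (fact assms)+
  note est = assms(2) and m = assms(9) and n = assms(10) and x = assms(13) and rate = assms(14)
  define g where "g = f Pbar"
  define \<sigma>2 where "\<sigma>2 = (LINT x|Pbar. (g x)\<^sup>2)"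
  define \<tau> where "\<tau> = sqrt (1 / (p * (1 - p)) * \<sigma>2)"
  define \<Psi> where "\<Psi> k \<omega> = (SUP t. \<bar>permutation_cdf (m k + n k) (two_sample_stat est (m k) (n k))
      (pooled_sample (m k) X Y \<omega>) t - cdf std_normal_distribution (t / \<tau>)\<bar>)" for k \<omega>
  define \<mu> where "\<mu> h k \<omega> = (\<Sum>j<m k + n k. h (pooled_sample (m k) X Y \<omega> j)) / real (m k + n k)" for h :: "'a \<Rightarrow> real" and k \<omega>
  have Pbar: "Pbar = mixture p P Q" by (rule assms)
  have al: "asymptotically_linear est \<theta> (mixture p P Q) g"
    using assms(17)[of Pbar] by (simp add: g_def Pbar)
  have g: "integrable Pbar g" "(LINT x|Pbar. g x) = 0" "integrable Pbar (\<lambda>x. (g x)\<^sup>2)" "\<sigma>2 > 0"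
    using al by (simp_all add: asymptotically_linear_def Pbar \<sigma>2_def)
  have gS[measurable]: "g \<in> borel_measurable S"
    using al by (intro ts.measurable_S) (simp add: asymptotically_linear_def)
  have \<tau>: "\<tau> > 0" using g(4) assms(11,12) by (simp add: \<tau>_def)
  have \<Psi>_meas: "\<Psi> k \<in> borel_measurable M" for k
    unfolding \<Psi>_def[abs_def]
    by (rule sup_cdf_distance_measurable[OF _ \<tau>]) (rule ts.two_sample_stat_measurable[OF est])
  have "(\<lambda>k. ts.prob {\<omega>\<in>space M. \<bar>\<Psi> k \<omega> - 0\<bar> > \<epsilon>}) \<longlonglongrightarrow> 0" if \<epsilon>: "\<epsilon> > 0" for \<epsilon>
  proof (rule permutation_clt_uniform[OF assms(11,12) g(4) \<epsilon>, folded \<tau>_def], goal_cases)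
    case (1 \<delta>)
    note \<delta> = 1(1) and unif = 1(2)
    \<comment> \<open>The events on which one of the data-dependent hypotheses of
      \<open>permutation_clt_uniform\<close> fails: first moment, second moment, maximum,
      linearization. Its two other hypotheses concern sample sizes only and hold for all large
      \<open>k\<close>. As \<delta> depends on \<epsilon> alone, it suffices that each event has
      vanishing probability.\<close>
    define B1 where "B1 k = {\<omega>\<in>space M. \<bar>\<mu> g k \<omega> - (LINT x|Pbar. g x)\<bar> \<ge> \<delta>}" for k
    define B2 where "B2 k = {\<omega>\<in>space M. \<bar>\<mu> (\<lambda>x. (g x)\<^sup>2) k \<omega> - (LINT x|Pbar. (g x)\<^sup>2)\<bar> \<ge> \<delta>}" for k
    define B3 where "B3 k = {\<omega>\<in>space M. \<exists>j<m k + n k. \<bar>g (pooled_sample (m k) X Y \<omega> j)\<bar> > \<delta> * sqrt (real (m k + n k))}" for k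
    define B4 where "B4 k = {\<omega>\<in>space M. ts.linear_gap est g (m k) (n k) \<omega> \<ge> \<delta>}" for k
    have B1: "(\<lambda>k. ts.prob (B1 k)) \<longlonglongrightarrow> 0"
      unfolding B1_def \<mu>_def Pbar by (rule ts.pooled_weak_law[OF m n x g(1)[unfolded Pbar] \<delta>])
    have B2: "(\<lambda>k. ts.prob (B2 k)) \<longlonglongrightarrow> 0"
      unfolding B2_def \<mu>_def Pbar by (rule ts.pooled_weak_law[OF m n x g(3)[unfolded Pbar] \<delta>])
    have B3: "(\<lambda>k. ts.prob (B3 k)) \<longlonglongrightarrow> 0"
      unfolding B3_def by (rule ts.pooled_max_negligible[OF m n gS g(3)[unfolded Pbar] \<delta>])
    have B4: "(\<lambda>k. ts.prob (B4 k)) \<longlonglongrightarrow> 0"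
      unfolding B4_def by (rule ts.linear_gap_negligible[OF est al m n x rate \<delta>])
    have [measurable]: "B1 k \<in> sets M" "B2 k \<in> sets M" "B3 k \<in> sets M" for k
      unfolding B1_def B2_def B3_def \<mu>_def by measurable
    have [measurable]: "B4 k \<in> sets M" for k
      using ts.linear_gap_measurable[OF est gS, of "m k" "n k"] unfolding B4_def by measurable
    have "eventually (\<lambda>k. \<bar>real (m k) / real (m k + n k) - p\<bar> < \<delta>) sequentially"
      using tendstoD[OF x \<delta>] by (simp add: dist_real_def)
    moreover have "eventually (\<lambda>k. 1 / \<delta> < real (m k)) sequentially"
      using filterlim_compose[OF filterlim_real_sequentially m] by (simp add: filterlim_at_top_dense)
    ultimately have ev: "eventually (\<lambda>k. ts.prob {\<omega>\<in>space M. \<bar>\<Psi> k \<omega> - 0\<bar> > \<epsilon>}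
        \<le> ts.prob (B1 k) + ts.prob (B2 k) + ts.prob (B3 k) + ts.prob (B4 k)) sequentially"
    proof eventually_elim
      case (elim k)
      have "{\<omega>\<in>space M. \<bar>\<Psi> k \<omega> - 0\<bar> > \<epsilon>} \<subseteq> B1 k \<union> B2 k \<union> B3 k \<union> B4 k"
      proof (rule subsetI, rule ccontr)
        fix \<omega> assume "\<omega> \<in> {\<omega>\<in>space M. \<bar>\<Psi> k \<omega> - 0\<bar> > \<epsilon>}" and nB: "\<omega> \<notin> B1 k \<union> B2 k \<union> B3 k \<union> B4 k"
        then have \<omega>: "\<omega> \<in> space M" "\<bar>\<Psi> k \<omega>\<bar> > \<epsilon>" by auto
        define z where "z = pooled_sample (m k) X Y \<omega>"
        have le: "\<bar>permutation_cdf (m k + n k) (two_sample_stat est (m k) (n k)) z t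
            - cdf std_normal_distribution (t / \<tau>)\<bar> \<le> \<epsilon>" for t
        proof -
          have "\<bar>(\<Sum>\<pi> | \<pi> permutes {..<m k + n k}. if two_sample_stat est (m k) (n k) (\<lambda>i. z (\<pi> i)) \<le> t then 1 else 0) / fact (m k + n k)
            - cdf std_normal_distribution (t / \<tau>)\<bar> \<le> \<epsilon>"
          proof (rule unif[of "m k" "n k" "\<lambda>j. g (z j)"])
            show "1 / \<delta> < real (m k + n k)" using elim(2) by simp
            show "\<bar>(\<Sum>j<m k + n k. g (z j)) / real (m k + n k)\<bar> < \<delta>"
              using nB \<omega> g(2) by (simp add: B1_def \<mu>_def z_def not_le)
            show "\<bar>(\<Sum>j<m k + n k. (g (z j))\<^sup>2) / real (m k + n k) - \<sigma>2\<bar> < \<delta>"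
              using nB \<omega> by (simp add: B2_def \<mu>_def z_def \<sigma>2_def not_le)
            show "\<bar>g (z j)\<bar> \<le> \<delta> * sqrt (real (m k + n k))" if "j < m k + n k" for j
            proof (rule ccontr)
              assume "\<not> ?thesis"
              then have "\<omega> \<in> B3 k" using \<omega>(1) that unfolding B3_def z_def not_le by blast
              then show False using nB by blast
            qed
            show "(\<Sum>\<pi> | \<pi> permutes {..<m k + n k}. min 1 \<bar>two_sample_stat est (m k) (n k) (\<lambda>i. z (\<pi> i))
                - mean_contrast (m k) (n k) (\<lambda>i. g (z (\<pi> i)))\<bar>) / fact (m k + n k) < \<delta>"
              using nB \<omega> by (simp add: B4_def z_def ts.linear_gap_def not_le)
          qed (rule elim(1))
          then show ?thesis by (simp add: permutation_cdf_def)
        qed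
        then have bdd: "bdd_above (range (\<lambda>t. \<bar>permutation_cdf (m k + n k) (two_sample_stat est (m k) (n k)) z t
            - cdf std_normal_distribution (t / \<tau>)\<bar>))" by (auto intro!: bdd_aboveI2)
        have "\<Psi> k \<omega> \<le> \<epsilon>" unfolding \<Psi>_def z_def[symmetric] by (rule cSUP_least) (auto intro: le)
        moreover have "0 \<le> \<Psi> k \<omega>" unfolding \<Psi>_def z_def[symmetric] by (rule cSUP_upper2[OF bdd, of 0]) auto
        ultimately show False using \<omega>(2) by simp
      qed
      then have "ts.prob {\<omega>\<in>space M. \<bar>\<Psi> k \<omega> - 0\<bar> > \<epsilon>} \<le> ts.prob (B1 k \<union> B2 k \<union> B3 k \<union> B4 k)"
        by (intro ts.finite_measure_mono) auto
      also have "\<dots> \<le> ts.prob (B1 k) + ts.prob (B2 k) + ts.prob (B3 k) + ts.prob (B4 k)"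
        by (intro order_trans[OF measure_Un_le] add_mono order_refl) auto
      finally show ?case .
    qed
    show ?thesis
      by (rule tendsto_sandwich[OF _ ev tendsto_const])
        (use tendsto_add[OF tendsto_add[OF tendsto_add[OF B1 B2] B3] B4] in auto)
  qed
  then have "converges_in_prob M \<Psi> 0"
    using \<Psi>_meas by (simp add: converges_in_prob_def)
  then show ?thesis by (simp only: \<Psi>_def[abs_def] \<tau>_def \<sigma>2_def g_def)
qed

end
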